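(* The category $\mathsf{CDeVe}$ of compact de Vries extensions is dually equivalent to the category $\mathsf{KHaus}$ of compact Hausdorff spaces and continuous maps.
   Context: A de Vries algebra is a pair $\mathfrak A=(A,\prec)$, where $A$ is a complete Boolean algebra and $\prec$ is a binary relation on $A$ with: (DV1) $1\prec 1$; (DV2) $a\prec b$ implies $a\le b$; (DV3) $a\le b\prec c\le d$ implies $a\prec d$; (DV4) $a\prec b,c$ implies $a\prec b\wedge c$; (DV5) $a\prec b$ implies $\neg b\prec\neg a$; (DV6) $a\prec b$ implies there is $c$ with $a\prec c\prec b$; (DV7) $b=\bigvee\{a\in A\mid a\prec b\}$. A de Vries morphism $\rho:\mathfrak A\to\mathfrak B$ is a map with: (M1) $\rho(0)=0$; (M2) $\rho(a\wedge b)=\rho(a)\wedge\rho(b)$; (M3) $a\prec b$ implies $\neg\rho(\neg a)\prec\rho(b)$; (M4) $\rho(b)=\bigvee\{\rho(a)\mid a\prec b\}$. The composition of de Vries morphisms $\rho_1:\mathfrak A_1\to\mathfrak A_2$ and $\rho_2:\mathfrak A_2\to\mathfrak A_3$ is $(\rho_2\star\rho_1)(b)=\bigvee\{\rho_2(\rho_1(a))\mid a\prec b\}$. A de Vries algebra is extremally disconnected if $a\prec b$ iff $a\le b$, and atomic if $A$ is an atomic Boolean algebra. A de Vries extension is a one-to-one de Vries morphism $\alpha:\mathfrak A\to\mathfrak B$ with $\mathfrak B$ atomic and extremally disconnected such that every element of $\mathfrak B$ is a join of meets of elements of $\alpha[\mathfrak A]$. The category $\mathsf{DeVe}$ has as objects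 de Vries extensions; a morphism from $\alpha:\mathfrak A\to\mathfrak B$ to $\alpha':\mathfrak A'\to\mathfrak B'$ is a pair $(\rho,\sigma)$ with $\rho:\mathfrak A\to\mathfrak A'$ a de Vries morphism and $\sigma:\mathfrak B\to\mathfrak B'$ a complete Boolean homomorphism such that $\sigma\circ\alpha=\alpha'\star\rho$. Composition is $(\rho_2,\sigma_2)(\rho_1,\sigma_1)=(\rho_2\star\rho_1,\sigma_2\circ\sigma_1)$. A filter $F$ of $\mathfrak A$ is round if for each $b\in F$ there is $a\in F$ with $a\prec b$; an ideal $I$ is round if for each $a\in I$ there is $b\in I$ with $a\prec b$. A de Vries extension $\alpha:\mathfrak A\to\mathfrak B$ is compact if: whenever $F$ is a round filter and $I$ a round ideal of $\mathfrak A$ with $\bigwedge\alpha[F]\le\bigvee\alpha[I]$, then $F\cap I\ne\varnothing$. $\mathsf{CDeVe}$ is the full subcategory of $\mathsf{DeVe}$ consisting of compact de Vries extensions. *)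

theory Defs
  imports "HOL-Analysis.T1_Spaces" "HOL-Algebra.Complete_Lattice" "HOL-Library.Equipollence"
begin

no_notation lesspoll (infixl \<open>\<prec>\<close> 50)

section \<open>Categories\<close>

text \<open>Hom-sets are indexed by pairs of objects and need not be disjoint. Composition takes the three
  objects involved as arguments because the composite of de Vries morphisms depends on the algebras:
  \<open>Comp C X Y Z g f\<close> is the composite of \<open>f\<close> from \<open>X\<close> to \<open>Y\<close> and \<open>g\<close> from \<open>Y\<close> to \<open>Z\<close>.\<close>

record ('o, 'm) category =
  Ob :: "'o set"
  Hom :: "'o \<Rightarrow> 'o \<Rightarrow> 'm set"
  Id :: "'o \<Rightarrow> 'm"
  Comp :: "'o \<Rightarrow> 'o \<Rightarrow> 'o \<Rightarrow> 'm \<Rightarrow> 'm \<Rightarrow> 'm"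

locale category =
  fixes C :: "('o, 'm) category"
  assumes Id_in_Hom: "X \<in> Ob C \<Longrightarrow> Id C X \<in> Hom C X X"
    and Comp_in_Hom:
      "\<lbrakk>X \<in> Ob C; Y \<in> Ob C; Z \<in> Ob C; f \<in> Hom C X Y; g \<in> Hom C Y Z\<rbrakk>
        \<Longrightarrow> Comp C X Y Z g f \<in> Hom C X Z"
    and Comp_Id_right: "\<lbrakk>X \<in> Ob C; Y \<in> Ob C; f \<in> Hom C X Y\<rbrakk> \<Longrightarrow> Comp C X X Y f (Id C X) = f"
    and Comp_Id_left: "\<lbrakk>X \<in> Ob C; Y \<in> Ob C; f \<in> Hom C X Y\<rbrakk> \<Longrightarrow> Comp C X Y Y (Id C Y) f = f"
    and Comp_assoc:
      "\<lbrakk>W \<in> Ob C; X \<in> Ob C; Y \<in> Ob C; Z \<in> Ob C; f \<in> Hom C W X; g \<in> Hom C X Y; h \<in> Hom C Y Z\<rbrakk>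
        \<Longrightarrow> Comp C W Y Z h (Comp C W X Y g f) = Comp C W X Z (Comp C X Y Z h g) f"

definition opposite :: "('o, 'm) category \<Rightarrow> ('o, 'm) category" where
  "opposite C = \<lparr>Ob = Ob C, Hom = (\<lambda>X Y. Hom C Y X), Id = Id C,
     Comp = (\<lambda>X Y Z g f. Comp C Z Y X f g)\<rparr>"

definition full_subcategory :: "('o, 'm) category \<Rightarrow> ('o \<Rightarrow> bool) \<Rightarrow> ('o, 'm) category" where
  "full_subcategory C P = C\<lparr>Ob := {X \<in> Ob C. P X}\<rparr>"

definition isomorphism :: "('o, 'm) category \<Rightarrow> 'o \<Rightarrow> 'o \<Rightarrow> 'm \<Rightarrow> bool" where
  "isomorphism C X Y f \<longleftrightarrow> f \<in> Hom C X Y \<and>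
     (\<exists>g \<in> Hom C Y X. Comp C X Y X g f = Id C X \<and> Comp C Y X Y f g = Id C Y)"

locale cat_functor = source: category C + target: category D
  for C :: "('o, 'm) category" and D :: "('p, 'n) category" +
  fixes F\<^sub>o :: "'o \<Rightarrow> 'p" and F\<^sub>m :: "'o \<Rightarrow> 'o \<Rightarrow> 'm \<Rightarrow> 'n"
  assumes map_Ob: "X \<in> Ob C \<Longrightarrow> F\<^sub>o X \<in> Ob D"
    and map_Hom: "\<lbrakk>X \<in> Ob C; Y \<in> Ob C; f \<in> Hom C X Y\<rbrakk> \<Longrightarrow> F\<^sub>m X Y f \<in> Hom D (F\<^sub>o X) (F\<^sub>o Y)"
    and map_Id: "X \<in> Ob C \<Longrightarrow> F\<^sub>m X X (Id C X) = Id D (F\<^sub>o X)"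
    and map_Comp:
      "\<lbrakk>X \<in> Ob C; Y \<in> Ob C; Z \<in> Ob C; f \<in> Hom C X Y; g \<in> Hom C Y Z\<rbrakk>
        \<Longrightarrow> F\<^sub>m X Z (Comp C X Y Z g f) = Comp D (F\<^sub>o X) (F\<^sub>o Y) (F\<^sub>o Z) (F\<^sub>m Y Z g) (F\<^sub>m X Y f)"

locale natural_isomorphism = F: cat_functor C D F\<^sub>o F\<^sub>m + G: cat_functor C D G\<^sub>o G\<^sub>m
  for C :: "('o, 'm) category" and D :: "('p, 'n) category" and F\<^sub>o F\<^sub>m G\<^sub>o G\<^sub>m +
  fixes \<eta> :: "'o \<Rightarrow> 'n"
  assumes component_iso: "X \<in> Ob C \<Longrightarrow> isomorphism D (F\<^sub>o X) (G\<^sub>o X) (\<eta> X)"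
    and naturality:
      "\<lbrakk>X \<in> Ob C; Y \<in> Ob C; f \<in> Hom C X Y\<rbrakk> \<Longrightarrow>
        Comp D (F\<^sub>o X) (F\<^sub>o Y) (G\<^sub>o Y) (\<eta> Y) (F\<^sub>m X Y f) =
        Comp D (F\<^sub>o X) (G\<^sub>o X) (G\<^sub>o Y) (G\<^sub>m X Y f) (\<eta> X)"

definition equivalent_categories :: "('o, 'm) category \<Rightarrow> ('p, 'n) category \<Rightarrow> bool" where
  "equivalent_categories C D \<longleftrightarrow>
     (\<exists>F\<^sub>o F\<^sub>m G\<^sub>o G\<^sub>m \<eta> \<epsilon>.
        cat_functor C D F\<^sub>o F\<^sub>m \<and> cat_functor D C G\<^sub>o G\<^sub>m \<and>
        natural_isomorphism C C (\<lambda>X. X) (\<lambda>X Y f. f)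
          (\<lambda>X. G\<^sub>o (F\<^sub>o X)) (\<lambda>X Y f. G\<^sub>m (F\<^sub>o X) (F\<^sub>o Y) (F\<^sub>m X Y f)) \<eta> \<and>
        natural_isomorphism D D
          (\<lambda>X. F\<^sub>o (G\<^sub>o X)) (\<lambda>X Y f. F\<^sub>m (G\<^sub>o X) (G\<^sub>o Y) (G\<^sub>m X Y f)) (\<lambda>X. X) (\<lambda>X Y f. f) \<epsilon>)"

definition dually_equivalent :: "('o, 'm) category \<Rightarrow> ('p, 'n) category \<Rightarrow> bool" where
  "dually_equivalent C D \<longleftrightarrow> equivalent_categories (opposite C) D"


section \<open>De Vries algebras\<close>

locale complete_boolean_algebra = complete_lattice L for L (structure) +
  assumes distrib:
      "\<lbrakk>x \<in> carrier L; y \<in> carrier L; z \<in> carrier L\<rbrakk>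
        \<Longrightarrow> x \<sqinter> (y \<squnion> z) = (x \<sqinter> y) \<squnion> (x \<sqinter> z)"
    and complemented:
      "x \<in> carrier L \<Longrightarrow> \<exists>y \<in> carrier L. x \<sqinter> y = \<bottom> \<and> x \<squnion> y = \<top>"

definition complement :: "('a, 'b) gorder_scheme \<Rightarrow> 'a \<Rightarrow> 'a" (\<open>\<sim>\<index> _\<close> [81] 80) where
  "\<sim>\<^bsub>L\<^esub> x = (THE y. y \<in> carrier L \<and> x \<sqinter>\<^bsub>L\<^esub> y = \<bottom>\<^bsub>L\<^esub> \<and> x \<squnion>\<^bsub>L\<^esub> y = \<top>\<^bsub>L\<^esub>)"

record 'a devries_structure = "'a gorder" +
  prec :: "'a \<Rightarrow> 'a \<Rightarrow> bool" (infixl \<open>\<prec>\<index>\<close> 50)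

locale devries_algebra = complete_boolean_algebra A for A :: "'a devries_structure" (structure) +
  assumes DV1: "\<top> \<prec> \<top>"
    and DV2: "\<lbrakk>a \<in> carrier A; b \<in> carrier A; a \<prec> b\<rbrakk> \<Longrightarrow> a \<sqsubseteq> b"
    and DV3: "\<lbrakk>a \<in> carrier A; b \<in> carrier A; c \<in> carrier A; d \<in> carrier A; a \<sqsubseteq> b; b \<prec> c; c \<sqsubseteq> d\<rbrakk>
      \<Longrightarrow> a \<prec> d"
    and DV4: "\<lbrakk>a \<in> carrier A; b \<in> carrier A; c \<in> carrier A; a \<prec> b; a \<prec> c\<rbrakk> \<Longrightarrow> a \<prec> b \<sqinter> c"
    and DV5: "\<lbrakk>a \<in> carrier A; b \<in> carrier A; a \<prec> b\<rbrakk> \<Longrightarrow> (\<sim> b) \<prec> (\<sim> a)"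
    and DV6: "\<lbrakk>a \<in> carrier A; b \<in> carrier A; a \<prec> b\<rbrakk> \<Longrightarrow> \<exists>c \<in> carrier A. a \<prec> c \<and> c \<prec> b"
    and DV7: "b \<in> carrier A \<Longrightarrow> b = \<Squnion>{a \<in> carrier A. a \<prec> b}"

text \<open>Maps between carriers are extensional functions, so that equality of morphisms is equality on
  the carrier.\<close>

definition devries_morphism ::
  "'a devries_structure \<Rightarrow> 'b devries_structure \<Rightarrow> ('a \<Rightarrow> 'b) \<Rightarrow> bool" where
  "devries_morphism A B \<rho> \<longleftrightarrow>
     \<rho> \<in> carrier A \<rightarrow>\<^sub>E carrier B \<and>
     \<rho> \<bottom>\<^bsub>A\<^esub> = \<bottom>\<^bsub>B\<^esub> \<and>
     (\<forall>a \<in> carrier A. \<forall>b \<in> carrier A. \<rho> (a \<sqinter>\<^bsub>A\<^esub> b) = \<rho> a \<sqinter>\<^bsub>B\<^esub> \<rho> b) \<and>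
     (\<forall>a \<in> carrier A. \<forall>b \<in> carrier A. a \<prec>\<^bsub>A\<^esub> b \<longrightarrow> (\<sim>\<^bsub>B\<^esub> \<rho> (\<sim>\<^bsub>A\<^esub> a)) \<prec>\<^bsub>B\<^esub> \<rho> b) \<and>
     (\<forall>b \<in> carrier A. \<rho> b = \<Squnion>\<^bsub>B\<^esub>{\<rho> a | a. a \<in> carrier A \<and> a \<prec>\<^bsub>A\<^esub> b})"

text \<open>\<open>devries_comp A\<^sub>1 A\<^sub>3 \<rho>\<^sub>2 \<rho>\<^sub>1\<close> is \<open>\<rho>\<^sub>2 \<star> \<rho>\<^sub>1\<close> for \<open>\<rho>\<^sub>1\<close> from \<open>A\<^sub>1\<close> to \<open>A\<^sub>2\<close> and \<open>\<rho>\<^sub>2\<close> from \<open>A\<^sub>2\<close> to \<open>A\<^sub>3\<close>.\<close>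

definition devries_comp ::
  "'a devries_structure \<Rightarrow> 'c devries_structure \<Rightarrow> ('b \<Rightarrow> 'c) \<Rightarrow> ('a \<Rightarrow> 'b) \<Rightarrow> 'a \<Rightarrow> 'c" where
  "devries_comp A\<^sub>1 A\<^sub>3 \<rho>\<^sub>2 \<rho>\<^sub>1 =
     (\<lambda>b \<in> carrier A\<^sub>1. \<Squnion>\<^bsub>A\<^sub>3\<^esub>{\<rho>\<^sub>2 (\<rho>\<^sub>1 a) | a. a \<in> carrier A\<^sub>1 \<and> a \<prec>\<^bsub>A\<^sub>1\<^esub> b})"

definition extremally_disconnected :: "'a devries_structure \<Rightarrow> bool" where
  "extremally_disconnected A \<longleftrightarrow>
     (\<forall>a \<in> carrier A. \<forall>b \<in> carrier A. a \<prec>\<^bsub>A\<^esub> b \<longleftrightarrow> a \<sqsubseteq>\<^bsub>A\<^esub> b)"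

definition lattice_atom :: "('a, 'b) gorder_scheme \<Rightarrow> 'a \<Rightarrow> bool" where
  "lattice_atom L x \<longleftrightarrow> x \<in> carrier L \<and> x \<noteq> \<bottom>\<^bsub>L\<^esub> \<and>
     (\<forall>y \<in> carrier L. y \<sqsubseteq>\<^bsub>L\<^esub> x \<longrightarrow> y = \<bottom>\<^bsub>L\<^esub> \<or> y = x)"

definition atomic_lattice :: "('a, 'b) gorder_scheme \<Rightarrow> bool" where
  "atomic_lattice L \<longleftrightarrow>
     (\<forall>b \<in> carrier L. b \<noteq> \<bottom>\<^bsub>L\<^esub> \<longrightarrow> (\<exists>x. lattice_atom L x \<and> x \<sqsubseteq>\<^bsub>L\<^esub> b))"

definition complete_boolean_hom ::
  "('a, 'c) gorder_scheme \<Rightarrow> ('b, 'd) gorder_scheme \<Rightarrow> ('a \<Rightarrow> 'b) \<Rightarrow> bool" where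
  "complete_boolean_hom B B' \<sigma> \<longleftrightarrow>
     \<sigma> \<in> carrier B \<rightarrow>\<^sub>E carrier B' \<and>
     (\<forall>S \<subseteq> carrier B. \<sigma> (\<Squnion>\<^bsub>B\<^esub>S) = \<Squnion>\<^bsub>B'\<^esub>(\<sigma> ` S)) \<and>
     (\<forall>S \<subseteq> carrier B. \<sigma> (\<Sqinter>\<^bsub>B\<^esub>S) = \<Sqinter>\<^bsub>B'\<^esub>(\<sigma> ` S)) \<and>
     (\<forall>a \<in> carrier B. \<sigma> (\<sim>\<^bsub>B\<^esub> a) = (\<sim>\<^bsub>B'\<^esub> \<sigma> a))"


section \<open>De Vries extensions\<close>

record ('a, 'b) extension =
  src :: "'a devries_structure"
  tgt :: "'b devries_structure"
  emb :: "'a \<Rightarrow> 'b"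

definition devries_extension :: "('a, 'b) extension \<Rightarrow> bool" where
  "devries_extension E \<longleftrightarrow>
     devries_algebra (src E) \<and> devries_algebra (tgt E) \<and>
     devries_morphism (src E) (tgt E) (emb E) \<and> inj_on (emb E) (carrier (src E)) \<and>
     atomic_lattice (tgt E) \<and> extremally_disconnected (tgt E) \<and>
     (\<forall>b \<in> carrier (tgt E). \<exists>\<S>. (\<forall>S \<in> \<S>. S \<subseteq> emb E ` carrier (src E)) \<and>
        b = \<Squnion>\<^bsub>tgt E\<^esub>((\<lambda>S. \<Sqinter>\<^bsub>tgt E\<^esub>S) ` \<S>))"

definition DeVe :: "(('a, 'b) extension, ('a \<Rightarrow> 'a) \<times> ('b \<Rightarrow> 'b)) category" where
  "DeVe = \<lparr>
     Ob = {E. devries_extension E},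
     Hom = (\<lambda>E E'. {(\<rho>, \<sigma>). devries_morphism (src E) (src E') \<rho> \<and>
        complete_boolean_hom (tgt E) (tgt E') \<sigma> \<and>
        compose (carrier (src E)) \<sigma> (emb E) = devries_comp (src E) (tgt E') (emb E') \<rho>}),
     Id = (\<lambda>E. (restrict id (carrier (src E)), restrict id (carrier (tgt E)))),
     Comp = (\<lambda>E\<^sub>1 E\<^sub>2 E\<^sub>3 (\<rho>\<^sub>2, \<sigma>\<^sub>2) (\<rho>\<^sub>1, \<sigma>\<^sub>1).
        (devries_comp (src E\<^sub>1) (src E\<^sub>3) \<rho>\<^sub>2 \<rho>\<^sub>1, compose (carrier (tgt E\<^sub>1)) \<sigma>\<^sub>2 \<sigma>\<^sub>1))\<rparr>"

text \<open>Filters and ideals are nonempty but not required to be proper.\<close>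

definition lattice_filter :: "('a, 'b) gorder_scheme \<Rightarrow> 'a set \<Rightarrow> bool" where
  "lattice_filter L F \<longleftrightarrow> F \<subseteq> carrier L \<and> F \<noteq> {} \<and>
     (\<forall>a \<in> F. \<forall>b \<in> carrier L. a \<sqsubseteq>\<^bsub>L\<^esub> b \<longrightarrow> b \<in> F) \<and> (\<forall>a \<in> F. \<forall>b \<in> F. a \<sqinter>\<^bsub>L\<^esub> b \<in> F)"

definition lattice_ideal :: "('a, 'b) gorder_scheme \<Rightarrow> 'a set \<Rightarrow> bool" where
  "lattice_ideal L I \<longleftrightarrow> I \<subseteq> carrier L \<and> I \<noteq> {} \<and>
     (\<forall>b \<in> I. \<forall>a \<in> carrier L. a \<sqsubseteq>\<^bsub>L\<^esub> b \<longrightarrow> a \<in> I) \<and> (\<forall>a \<in> I. \<forall>b \<in> I. a \<squnion>\<^bsub>L\<^esub> b \<in> I)"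

definition round_filter :: "'a devries_structure \<Rightarrow> 'a set \<Rightarrow> bool" where
  "round_filter A F \<longleftrightarrow> lattice_filter A F \<and> (\<forall>b \<in> F. \<exists>a \<in> F. a \<prec>\<^bsub>A\<^esub> b)"

definition round_ideal :: "'a devries_structure \<Rightarrow> 'a set \<Rightarrow> bool" where
  "round_ideal A I \<longleftrightarrow> lattice_ideal A I \<and> (\<forall>a \<in> I. \<exists>b \<in> I. a \<prec>\<^bsub>A\<^esub> b)"

definition compact_extension :: "('a, 'b) extension \<Rightarrow> bool" where
  "compact_extension E \<longleftrightarrow>
     (\<forall>F I. round_filter (src E) F \<and> round_ideal (src E) I \<and>
        \<Sqinter>\<^bsub>tgt E\<^esub>(emb E ` F) \<sqsubseteq>\<^bsub>tgt E\<^esub> \<Squnion>\<^bsub>tgt E\<^esub>(emb E ` I) \<longrightarrow> F \<inter> I \<noteq> {})"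

definition CDeVe :: "(('a, 'b) extension, ('a \<Rightarrow> 'a) \<times> ('b \<Rightarrow> 'b)) category" where
  "CDeVe = full_subcategory DeVe compact_extension"


section \<open>Compact Hausdorff spaces\<close>

text \<open>All objects live in a type \<open>'u\<close>, which plays the role of a set-theoretic universe. The dual of
  a space \<open>X\<close> contains a copy of the power set of \<open>X\<close>, so spaces are required to be small in the
  sense that this power set fits into \<open>'u\<close>. No size condition is needed on the algebraic side: if an
  atomic complete Boolean algebra lies in \<open>'u\<close>, then so does the power set of its set of atoms.
  If the cardinality of \<open>'u\<close> is a strong limit, then small means of cardinality less than that
  of \<open>'u\<close>.\<close>

definition small :: "'u set \<Rightarrow> bool" where
  "small S \<longleftrightarrow> Pow S \<lesssim> (UNIV :: 'u set)"

definition KHaus :: "('u topology, 'u \<Rightarrow> 'u) category" where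
  "KHaus = \<lparr>
     Ob = {X. compact_space X \<and> Hausdorff_space X \<and> small (topspace X)},
     Hom = (\<lambda>X Y. {f \<in> extensional (topspace X). continuous_map X Y f}),
     Id = (\<lambda>X. restrict id (topspace X)),
     Comp = (\<lambda>X Y Z g f. compose (topspace X) g f)\<rparr>"

text \<open>The smallness condition excludes no space up to homeomorphism once \<open>'u\<close> is chosen large enough.\<close>

lemma compact_Hausdorff_represented_in_KHaus:
  fixes X :: "'a topology"
  assumes "compact_space X" "Hausdorff_space X"
  shows "\<exists>Y \<in> Ob (KHaus :: ('a set topology, 'a set \<Rightarrow> 'a set) category). X homeomorphic_space Y"
proof -
  define s :: "'a \<Rightarrow> 'a set" where "s = (\<lambda>x. {x})"
  define Y where "Y = pullback_topology (s ` topspace X) the_elem X"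
  have top: "topspace Y = s ` topspace X"
    by (auto simp: Y_def topspace_pullback_topology s_def)
  have 1: "continuous_map Y X the_elem"
    unfolding continuous_map_alt top
    by (auto simp: Y_def openin_pullback_topology s_def)
  have 2: "continuous_map X Y s"
    unfolding Y_def by (intro continuous_map_pullback')
      (auto simp: s_def o_def)
  have hom: "X homeomorphic_space Y"
    unfolding homeomorphic_space_def homeomorphic_maps_def
    using 1 2 by (intro exI[of _ s] exI[of _ the_elem]) (auto simp: top s_def)
  have "inj_on \<Union> (Pow (topspace Y))"
  proof (rule inj_on_inverseI[of _ "image s"])
    fix S assume "S \<in> Pow (topspace Y)"
    then have "\<And>t. t \<in> S \<Longrightarrow> \<exists>x. t = {x}"
      by (auto simp: top s_def)
    then show "s ` \<Union>S = S"
      unfolding s_def by fastforce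
  qed
  then have "small (topspace Y)"
    unfolding small_def lepoll_def by blast
  then show ?thesis
    using hom assms homeomorphic_compact_space homeomorphic_Hausdorff_space
    by (intro bexI[of _ Y]) (auto simp: KHaus_def)
qed

end

theory Submission
  imports Defs "HOL-Analysis.Abstract_Topological_Spaces"
begin

text \<open>
  Let \<open>\<alpha>\<close> be a de Vries extension from \<open>A\<close> to \<open>B\<close>. Since \<open>B\<close> is a complete atomic Boolean algebra, it
  is the power set of its set \<open>X\<close> of atoms, and \<open>\<alpha>\<close> becomes a map \<open>U\<close> that sends \<open>a\<close> to the set of
  atoms below \<open>\<alpha> a\<close>. As \<open>\<alpha>\<close> preserves finite meets, the sets \<open>U a\<close> are a base of a topology on \<open>X\<close>,
  and since \<open>\<alpha>\<close> is one-to-one, \<open>U b\<close> is disjoint from \<open>U a\<close> exactly if \<open>b\<close> lies below \<open>\<sim> a\<close>, so that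
  the closure of \<open>U a\<close> is \<open>X - U (\<sim> a)\<close>. The axioms of a de Vries morphism now speak about the
  topology: (M3) says that the closure of \<open>U a\<close> lies in \<open>U b\<close> if \<open>a \<prec> b\<close>, and (M4) says that \<open>U b\<close> is
  the union of the \<open>U a\<close> with \<open>a \<prec> b\<close>. Because \<open>\<alpha>[A]\<close> generates \<open>B\<close>, the space is Hausdorff. If \<open>\<alpha>\<close>
  is compact, then so is the space (\<open>compact_atom_space\<close>), and the converse of (M3) holds: \<open>a \<prec> b\<close> if
  the closure of \<open>U a\<close> lies in \<open>U b\<close> (\<open>prec_iff\<close>).

  This construction is a contravariant functor. A complete homomorphism \<open>\<sigma>\<close> between power sets is the
  preimage map of a unique function \<open>f\<close> between the sets of atoms. For a morphism \<open>(\<rho>, \<sigma>)\<close> from \<open>\<alpha>\<close> to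
  \<open>\<alpha>'\<close>, the equation \<open>\<sigma> \<circ> \<alpha> = \<alpha>' \<star> \<rho>\<close> says that the preimage of \<open>U a\<close> under \<open>f\<close> is the union of the
  sets \<open>U' (\<rho> c)\<close> with \<open>c \<prec> a\<close>. Hence \<open>f\<close> is continuous, and \<open>\<rho> a\<close> is the join of all \<open>c\<close> for which
  \<open>U' c\<close> lies in the preimage of \<open>U a\<close> (\<open>morphism_eq_interior_sup\<close>); so \<open>f\<close> determines \<open>\<rho>\<close> as well as
  \<open>\<sigma>\<close>. Conversely, for each continuous \<open>f\<close> into the space of \<open>\<alpha>\<close> from the space of a compact \<open>\<alpha>'\<close> this
  join defines a morphism (\<open>extension_morphism_dual\<close>). The functor is therefore fully faithful.

  It is essentially surjective because a compact Hausdorff space is homeomorphic to the space of atoms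
  of the inclusion of its regular open sets, ordered by \<open>V \<prec> W\<close> if the closure of \<open>V\<close> lies in \<open>W\<close>, into
  its power set (\<open>compact_extension_space\<close>, \<open>homeomorphic_dual\<close>). A fully faithful and essentially
  surjective functor is an equivalence.
\<close>

no_notation lesspoll (infixl \<open>\<prec>\<close> 50)
no_notation eq_closure_of (\<open>closure'_of\<index>\<close>)

section \<open>Fully faithful and essentially surjective functors\<close>

lemma category_opposite: "category C \<Longrightarrow> category (opposite C)"
  by (auto simp: opposite_def category_def)

lemma category_full_subcategory: "category C \<Longrightarrow> category (full_subcategory C P)"
  by (auto simp: full_subcategory_def category_def)

text \<open>The quasi-inverse chooses for each object \<open>Z\<close> of \<open>D\<close> an object \<open>G Z\<close> and an isomorphism \<open>e Z\<close> from
  \<open>F (G Z)\<close> to \<open>Z\<close>, and sends a morphism to the unique preimage under \<open>F\<close> of its conjugate by these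
  isomorphisms. Equations between morphisms of \<open>C\<close> may be checked after applying \<open>F\<close>, because \<open>F\<close> is
  faithful, and there they follow by cancelling some \<open>e Z\<close>. One natural isomorphism is \<open>e\<close>, the other
  consists of the preimages of the inverses \<open>e' (F X)\<close>.\<close>

lemma equivalent_categories_if_fully_faithful_surjective:
  fixes C :: "('o, 'm) category" and D :: "('p, 'n) category"
  assumes "cat_functor C D F\<^sub>o F\<^sub>m"
    and faithful: "\<And>X Y. \<lbrakk>X \<in> Ob C; Y \<in> Ob C\<rbrakk> \<Longrightarrow> inj_on (F\<^sub>m X Y) (Hom C X Y)"
    and full: "\<And>X Y. \<lbrakk>X \<in> Ob C; Y \<in> Ob C\<rbrakk> \<Longrightarrow> Hom D (F\<^sub>o X) (F\<^sub>o Y) \<subseteq> F\<^sub>m X Y ` Hom C X Y"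
    and surjective: "\<And>Z. Z \<in> Ob D \<Longrightarrow> \<exists>X \<in> Ob C. \<exists>e. isomorphism D (F\<^sub>o X) Z e"
  shows "equivalent_categories C D"
proof -
  interpret F: cat_functor C D F\<^sub>o F\<^sub>m by fact
  note Fc = F.target.Comp_in_Hom and Fi = F.target.Id_in_Hom and Fa = F.target.Comp_assoc
    and Fr = F.target.Comp_Id_right and Fl = F.target.Comp_Id_left and FO = F.map_Ob
  note Cc = F.source.Comp_in_Hom and Ci = F.source.Id_in_Hom

  define inverse_pair where "inverse_pair Z X e e' \<longleftrightarrow>
      X \<in> Ob C \<and> e \<in> Hom D (F\<^sub>o X) Z \<and> e' \<in> Hom D Z (F\<^sub>o X) \<and>
      Comp D (F\<^sub>o X) Z (F\<^sub>o X) e' e = Id D (F\<^sub>o X) \<and> Comp D Z (F\<^sub>o X) Z e e' = Id D Z" for Z X e e'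
  have "\<exists>X e e'. inverse_pair Z X e e'" if "Z \<in> Ob D" for Z
    using surjective[OF that] unfolding isomorphism_def inverse_pair_def by blast
  then have "\<forall>Z. \<exists>t. Z \<in> Ob D \<longrightarrow> inverse_pair Z (fst t) (fst (snd t)) (snd (snd t))"
    by (metis fst_conv snd_conv)
  from choice[OF this] obtain t where t: "\<And>Z. Z \<in> Ob D \<Longrightarrow> inverse_pair Z (fst (t Z)) (fst (snd (t Z))) (snd (snd (t Z)))"
    by blast
  define G where "G Z = fst (t Z)" for Z
  define e where "e Z = fst (snd (t Z))" for Z
  define e' where "e' Z = snd (snd (t Z))" for Z
  have G: "G Z \<in> Ob C"
    and e: "e Z \<in> Hom D (F\<^sub>o (G Z)) Z"
    and e': "e' Z \<in> Hom D Z (F\<^sub>o (G Z))"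
    and e'e: "Comp D (F\<^sub>o (G Z)) Z (F\<^sub>o (G Z)) (e' Z) (e Z) = Id D (F\<^sub>o (G Z))"
    and ee': "Comp D Z (F\<^sub>o (G Z)) Z (e Z) (e' Z) = Id D Z"
    if "Z \<in> Ob D" for Z
    using t[OF that] by (auto simp: inverse_pair_def G_def e_def e'_def)

  define L where "L X Y h = (SOME f. f \<in> Hom C X Y \<and> F\<^sub>m X Y f = h)" for X Y h
  have L: "L X Y h \<in> Hom C X Y \<and> F\<^sub>m X Y (L X Y h) = h"
    if "X \<in> Ob C" "Y \<in> Ob C" "h \<in> Hom D (F\<^sub>o X) (F\<^sub>o Y)" for X Y h
  proof -
    have "\<exists>f. f \<in> Hom C X Y \<and> F\<^sub>m X Y f = h"
      using full[OF that(1,2)] that(3) by blast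
    then show ?thesis
      unfolding L_def by (rule someI_ex)
  qed
  have eqI: "f = g" if "X \<in> Ob C" "Y \<in> Ob C" "f \<in> Hom C X Y" "g \<in> Hom C X Y" "F\<^sub>m X Y f = F\<^sub>m X Y g" for X Y f g
    using inj_onD[OF faithful[OF that(1,2)] that(5,3,4)] .

  \<comment> \<open>the conjugate of a morphism of \<open>D\<close> by the chosen isomorphisms\<close>
  define K where "K Z W g = Comp D (F\<^sub>o (G Z)) W (F\<^sub>o (G W)) (e' W) (Comp D (F\<^sub>o (G Z)) Z W g (e Z))" for Z W g
  have K_Hom: "K Z W g \<in> Hom D (F\<^sub>o (G Z)) (F\<^sub>o (G W))" if "Z \<in> Ob D" "W \<in> Ob D" "g \<in> Hom D Z W" for Z W g
    unfolding K_def by (intro Fc[of _ W] Fc[of _ Z] FO G e e' that)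
  have K_Id: "K Z Z (Id D Z) = Id D (F\<^sub>o (G Z))" if "Z \<in> Ob D" for Z
    using that by (simp add: K_def Fl[of "F\<^sub>o (G Z)"] FO G e e'e)
  have eK: "Comp D (F\<^sub>o (G Z)) (F\<^sub>o (G W)) W (e W) (K Z W g) = Comp D (F\<^sub>o (G Z)) Z W g (e Z)"
    if "Z \<in> Ob D" "W \<in> Ob D" "g \<in> Hom D Z W" for Z W g
  proof -
    have h: "Comp D (F\<^sub>o (G Z)) Z W g (e Z) \<in> Hom D (F\<^sub>o (G Z)) W"
      by (intro Fc[of _ Z] FO G e that)
    then show ?thesis
      unfolding K_def using that
      by (simp add: Fa[of "F\<^sub>o (G Z)" W "F\<^sub>o (G W)" W] FO G e e' ee' Fl[of "F\<^sub>o (G Z)" W])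
  qed
  have K_cancel: "h = k"
    if "X \<in> Ob D" "W \<in> Ob D" "h \<in> Hom D X (F\<^sub>o (G W))" "k \<in> Hom D X (F\<^sub>o (G W))"
      "Comp D X (F\<^sub>o (G W)) W (e W) h = Comp D X (F\<^sub>o (G W)) W (e W) k" for X W h k
  proof -
    have "Comp D X W (F\<^sub>o (G W)) (e' W) (Comp D X (F\<^sub>o (G W)) W (e W) h) = h"
      if "h \<in> Hom D X (F\<^sub>o (G W))" for h
      using \<open>X \<in> Ob D\<close> \<open>W \<in> Ob D\<close> that
      by (simp add: Fa[of X "F\<^sub>o (G W)" W "F\<^sub>o (G W)"] FO G e e' e'e Fl[of X "F\<^sub>o (G W)"])
    then show ?thesis
      using that by metis
  qed
  have K_Comp: "K Z V (Comp D Z W V g f) = Comp D (F\<^sub>o (G Z)) (F\<^sub>o (G W)) (F\<^sub>o (G V)) (K W V g) (K Z W f)"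
    if "Z \<in> Ob D" "W \<in> Ob D" "V \<in> Ob D" "f \<in> Hom D Z W" "g \<in> Hom D W V" for Z W V f g
  proof (rule K_cancel[of "F\<^sub>o (G Z)" V])
    have gf: "Comp D Z W V g f \<in> Hom D Z V"
      by (rule Fc[of Z W V]) fact+
    then show "K Z V (Comp D Z W V g f) \<in> Hom D (F\<^sub>o (G Z)) (F\<^sub>o (G V))"
      by (intro K_Hom that)
    show "Comp D (F\<^sub>o (G Z)) (F\<^sub>o (G W)) (F\<^sub>o (G V)) (K W V g) (K Z W f) \<in> Hom D (F\<^sub>o (G Z)) (F\<^sub>o (G V))"
      by (intro Fc[of _ "F\<^sub>o (G W)"] K_Hom FO G that)
    have "Comp D (F\<^sub>o (G Z)) (F\<^sub>o (G V)) V (e V)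
            (Comp D (F\<^sub>o (G Z)) (F\<^sub>o (G W)) (F\<^sub>o (G V)) (K W V g) (K Z W f)) =
          Comp D (F\<^sub>o (G Z)) (F\<^sub>o (G W)) V (Comp D (F\<^sub>o (G W)) W V g (e W)) (K Z W f)"
      using that by (simp add: Fa[of "F\<^sub>o (G Z)" "F\<^sub>o (G W)" "F\<^sub>o (G V)" V] FO G K_Hom e eK)
    also have "\<dots> = Comp D (F\<^sub>o (G Z)) W V g (Comp D (F\<^sub>o (G Z)) (F\<^sub>o (G W)) W (e W) (K Z W f))"
      using that by (simp add: Fa[of "F\<^sub>o (G Z)" "F\<^sub>o (G W)" W V] FO G K_Hom e)
    also have "\<dots> = Comp D (F\<^sub>o (G Z)) W V g (Comp D (F\<^sub>o (G Z)) Z W f (e Z))"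
      using that by (simp add: eK)
    also have "\<dots> = Comp D (F\<^sub>o (G Z)) (F\<^sub>o (G V)) V (e V) (K Z V (Comp D Z W V g f))"
      using that gf by (simp add: eK Fa[of "F\<^sub>o (G Z)" Z W V] FO G e)
    finally show "Comp D (F\<^sub>o (G Z)) (F\<^sub>o (G V)) V (e V) (K Z V (Comp D Z W V g f)) =
        Comp D (F\<^sub>o (G Z)) (F\<^sub>o (G V)) V (e V)
            (Comp D (F\<^sub>o (G Z)) (F\<^sub>o (G W)) (F\<^sub>o (G V)) (K W V g) (K Z W f))" ..
  qed (use that FO G in auto)

  define G\<^sub>m where "G\<^sub>m Z W g = L (G Z) (G W) (K Z W g)" for Z W g
  have Gm: "G\<^sub>m Z W g \<in> Hom C (G Z) (G W)" "F\<^sub>m (G Z) (G W) (G\<^sub>m Z W g) = K Z W g"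
    if "Z \<in> Ob D" "W \<in> Ob D" "g \<in> Hom D Z W" for Z W g
    using L[OF G[OF that(1)] G[OF that(2)] K_Hom[OF that]] by (auto simp: G\<^sub>m_def)
  interpret G: cat_functor D C G G\<^sub>m
  proof
    fix Z assume Z: "Z \<in> Ob D"
    then show "G\<^sub>m Z Z (Id D Z) = Id C (G Z)"
      by (intro eqI[of "G Z" "G Z"]) (auto simp: G Gm Fi Ci K_Id F.map_Id)
  next
    fix Z W V f g
    assume *: "Z \<in> Ob D" "W \<in> Ob D" "V \<in> Ob D" "f \<in> Hom D Z W" "g \<in> Hom D W V"
    have gf: "Comp D Z W V g f \<in> Hom D Z V"
      by (rule Fc[of Z W V]) fact+
    show "G\<^sub>m Z V (Comp D Z W V g f) = Comp C (G Z) (G W) (G V) (G\<^sub>m W V g) (G\<^sub>m Z W f)"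
    proof (rule eqI[of "G Z" "G V"])
      show "Comp C (G Z) (G W) (G V) (G\<^sub>m W V g) (G\<^sub>m Z W f) \<in> Hom C (G Z) (G V)"
        by (rule Cc[of _ "G W"]) (auto simp: G Gm *)
      show "F\<^sub>m (G Z) (G V) (G\<^sub>m Z V (Comp D Z W V g f)) =
          F\<^sub>m (G Z) (G V) (Comp C (G Z) (G W) (G V) (G\<^sub>m W V g) (G\<^sub>m Z W f))"
        using * gf by (simp add: F.map_Comp G Gm K_Comp)
    qed (use * gf in \<open>auto simp: G Gm\<close>)
  qed (auto simp: G Gm)

  define \<eta> where "\<eta> X = L X (G (F\<^sub>o X)) (e' (F\<^sub>o X))" for X
  have eta: "\<eta> X \<in> Hom C X (G (F\<^sub>o X))" "F\<^sub>m X (G (F\<^sub>o X)) (\<eta> X) = e' (F\<^sub>o X)" if "X \<in> Ob C" for X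
    using L[of X "G (F\<^sub>o X)" "e' (F\<^sub>o X)"] that FO G e' by (auto simp: \<eta>_def)
  have 1: "natural_isomorphism C C (\<lambda>X. X) (\<lambda>X Y f. f)
          (\<lambda>X. G (F\<^sub>o X)) (\<lambda>X Y f. G\<^sub>m (F\<^sub>o X) (F\<^sub>o Y) (F\<^sub>m X Y f)) \<eta>"
  proof unfold_locales
    fix X assume X: "X \<in> Ob C"
    define \<eta>' where "\<eta>' = L (G (F\<^sub>o X)) X (e (F\<^sub>o X))"
    have eta': "\<eta>' \<in> Hom C (G (F\<^sub>o X)) X" "F\<^sub>m (G (F\<^sub>o X)) X \<eta>' = e (F\<^sub>o X)"
      using L[of "G (F\<^sub>o X)" X "e (F\<^sub>o X)"] X FO G e by (auto simp: \<eta>'_def)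
    have "Comp C X (G (F\<^sub>o X)) X \<eta>' (\<eta> X) = Id C X"
      using X eta eta' by (intro eqI[of X X]) (auto intro!: Cc[of X "G (F\<^sub>o X)" X]
          simp: F.map_Comp FO G Ci F.map_Id ee')
    moreover have "Comp C (G (F\<^sub>o X)) X (G (F\<^sub>o X)) (\<eta> X) \<eta>' = Id C (G (F\<^sub>o X))"
      using X eta eta' by (intro eqI[of "G (F\<^sub>o X)" "G (F\<^sub>o X)"]) (auto intro!: Cc[of "G (F\<^sub>o X)" X "G (F\<^sub>o X)"]
          simp: F.map_Comp FO G Ci F.map_Id e'e)
    ultimately show "isomorphism C X (G (F\<^sub>o X)) (\<eta> X)"
      using eta(1)[OF X] eta'(1) by (auto simp: isomorphism_def)
  next
    fix X Y f assume *: "X \<in> Ob C" "Y \<in> Ob C" "f \<in> Hom C X Y"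
    then have Ff: "F\<^sub>m X Y f \<in> Hom D (F\<^sub>o X) (F\<^sub>o Y)"
      by (rule F.map_Hom)
    have GF: "G\<^sub>m (F\<^sub>o X) (F\<^sub>o Y) (F\<^sub>m X Y f) \<in> Hom C (G (F\<^sub>o X)) (G (F\<^sub>o Y))"
      by (rule Gm(1)[OF FO[OF *(1)] FO[OF *(2)] Ff])
    show "Comp C X Y (G (F\<^sub>o Y)) (\<eta> Y) f =
        Comp C X (G (F\<^sub>o X)) (G (F\<^sub>o Y)) (G\<^sub>m (F\<^sub>o X) (F\<^sub>o Y) (F\<^sub>m X Y f)) (\<eta> X)"
    proof (rule eqI[of X "G (F\<^sub>o Y)"])
      show "Comp C X Y (G (F\<^sub>o Y)) (\<eta> Y) f \<in> Hom C X (G (F\<^sub>o Y))"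
        using * by (intro Cc[of _ Y] eta FO G)
      show "Comp C X (G (F\<^sub>o X)) (G (F\<^sub>o Y)) (G\<^sub>m (F\<^sub>o X) (F\<^sub>o Y) (F\<^sub>m X Y f)) (\<eta> X) \<in> Hom C X (G (F\<^sub>o Y))"
        using * GF by (intro Cc[of _ "G (F\<^sub>o X)"] eta FO G)
      show "F\<^sub>m X (G (F\<^sub>o Y)) (Comp C X Y (G (F\<^sub>o Y)) (\<eta> Y) f) =
          F\<^sub>m X (G (F\<^sub>o Y)) (Comp C X (G (F\<^sub>o X)) (G (F\<^sub>o Y)) (G\<^sub>m (F\<^sub>o X) (F\<^sub>o Y) (F\<^sub>m X Y f)) (\<eta> X))"
      proof (rule K_cancel[of "F\<^sub>o X" "F\<^sub>o Y"])
        let ?fe = "Comp D (F\<^sub>o X) (F\<^sub>o Y) (F\<^sub>o (G (F\<^sub>o Y))) (e' (F\<^sub>o Y)) (F\<^sub>m X Y f)"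
        let ?ek = "Comp D (F\<^sub>o X) (F\<^sub>o (G (F\<^sub>o X))) (F\<^sub>o (G (F\<^sub>o Y))) (K (F\<^sub>o X) (F\<^sub>o Y) (F\<^sub>m X Y f)) (e' (F\<^sub>o X))"
        have l: "F\<^sub>m X (G (F\<^sub>o Y)) (Comp C X Y (G (F\<^sub>o Y)) (\<eta> Y) f) = ?fe"
          using * by (simp add: F.map_Comp FO G eta)
        have r: "F\<^sub>m X (G (F\<^sub>o Y)) (Comp C X (G (F\<^sub>o X)) (G (F\<^sub>o Y)) (G\<^sub>m (F\<^sub>o X) (F\<^sub>o Y) (F\<^sub>m X Y f)) (\<eta> X)) = ?ek"
          using * GF by (simp add: F.map_Comp FO G eta Gm Ff)
        show "F\<^sub>m X (G (F\<^sub>o Y)) (Comp C X Y (G (F\<^sub>o Y)) (\<eta> Y) f) \<in> Hom D (F\<^sub>o X) (F\<^sub>o (G (F\<^sub>o Y)))"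
          unfolding l using * Ff by (intro Fc[of _ "F\<^sub>o Y"] FO G e')
        show "F\<^sub>m X (G (F\<^sub>o Y)) (Comp C X (G (F\<^sub>o X)) (G (F\<^sub>o Y)) (G\<^sub>m (F\<^sub>o X) (F\<^sub>o Y) (F\<^sub>m X Y f)) (\<eta> X)) \<in> Hom D (F\<^sub>o X) (F\<^sub>o (G (F\<^sub>o Y)))"
          unfolding r using * Ff by (intro Fc[of _ "F\<^sub>o (G (F\<^sub>o X))"] FO G e' K_Hom)
        have "Comp D (F\<^sub>o X) (F\<^sub>o (G (F\<^sub>o Y))) (F\<^sub>o Y) (e (F\<^sub>o Y)) ?fe = F\<^sub>m X Y f"
          using * Ff by (simp add: Fa[of "F\<^sub>o X" "F\<^sub>o Y" "F\<^sub>o (G (F\<^sub>o Y))" "F\<^sub>o Y"] FO G e e' ee' Fl[of "F\<^sub>o X" "F\<^sub>o Y"])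
        moreover have "Comp D (F\<^sub>o X) (F\<^sub>o (G (F\<^sub>o Y))) (F\<^sub>o Y) (e (F\<^sub>o Y)) ?ek = F\<^sub>m X Y f"
          using * Ff
          by (simp add: Fa[of "F\<^sub>o X" "F\<^sub>o (G (F\<^sub>o X))" "F\<^sub>o (G (F\<^sub>o Y))" "F\<^sub>o Y"] FO G e e' K_Hom eK)
            (simp add: Fa[of "F\<^sub>o X" "F\<^sub>o (G (F\<^sub>o X))" "F\<^sub>o X" "F\<^sub>o Y", symmetric] FO G e e' ee' Fr)
        ultimately show "Comp D (F\<^sub>o X) (F\<^sub>o (G (F\<^sub>o Y))) (F\<^sub>o Y) (e (F\<^sub>o Y)) (F\<^sub>m X (G (F\<^sub>o Y)) (Comp C X Y (G (F\<^sub>o Y)) (\<eta> Y) f)) =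
          Comp D (F\<^sub>o X) (F\<^sub>o (G (F\<^sub>o Y))) (F\<^sub>o Y) (e (F\<^sub>o Y))
            (F\<^sub>m X (G (F\<^sub>o Y)) (Comp C X (G (F\<^sub>o X)) (G (F\<^sub>o Y)) (G\<^sub>m (F\<^sub>o X) (F\<^sub>o Y) (F\<^sub>m X Y f)) (\<eta> X)))"
          unfolding l r by simp
      qed (use * FO in auto)
    qed (use * FO G in auto)
  qed (auto simp: FO G.map_Ob F.map_Hom G.map_Hom F.map_Id G.map_Id F.map_Comp G.map_Comp)
  have 2: "natural_isomorphism D D
          (\<lambda>Z. F\<^sub>o (G Z)) (\<lambda>Z W f. F\<^sub>m (G Z) (G W) (G\<^sub>m Z W f)) (\<lambda>X. X) (\<lambda>X Y f. f) e"
  proof unfold_locales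
    fix Z assume "Z \<in> Ob D"
    then show "isomorphism D (F\<^sub>o (G Z)) Z (e Z)"
      by (auto simp: isomorphism_def e ee' e'e intro!: bexI[of _ "e' Z"] e')
  qed (auto simp: FO G.map_Ob F.map_Hom G.map_Hom F.map_Id G.map_Id F.map_Comp G.map_Comp Gm eK K_Hom K_Id K_Comp)
  show ?thesis
    unfolding equivalent_categories_def
    using F.cat_functor_axioms G.cat_functor_axioms 1 2 by blast
qed

section \<open>Complete Boolean algebras and their atoms\<close>

context complete_boolean_algebra
begin

lemma top_carrier [simp]: "\<top> \<in> carrier L"
  by simp

lemma bottom_carrier [simp]: "\<bottom> \<in> carrier L"
  by simp

lemma meet_le_iff: "\<lbrakk>x \<in> carrier L; y \<in> carrier L; z \<in> carrier L\<rbrakk> \<Longrightarrow> z \<sqsubseteq> x \<sqinter> y \<longleftrightarrow> z \<sqsubseteq> x \<and> z \<sqsubseteq> y"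
  by (meson le_trans meet_closed meet_le meet_left meet_right)

lemma meet_mono:
  "\<lbrakk>x \<sqsubseteq> x'; y \<sqsubseteq> y'; x \<in> carrier L; y \<in> carrier L; x' \<in> carrier L; y' \<in> carrier L\<rbrakk>
    \<Longrightarrow> x \<sqinter> y \<sqsubseteq> x' \<sqinter> y'"
  by (meson le_trans meet_closed meet_le meet_left meet_right)

lemma le_bottom_iff: "x \<in> carrier L \<Longrightarrow> x \<sqsubseteq> \<bottom> \<longleftrightarrow> x = \<bottom>"
  by (auto intro: le_antisym)

lemma top_le_iff: "x \<in> carrier L \<Longrightarrow> \<top> \<sqsubseteq> x \<longleftrightarrow> x = \<top>"
  by (auto intro: le_antisym)

lemma bottom_meet' [simp]: "x \<in> carrier L \<Longrightarrow> \<bottom> \<sqinter> x = \<bottom>" "x \<in> carrier L \<Longrightarrow> x \<sqinter> \<bottom> = \<bottom>"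
  using bottom_meet[of x] by (simp_all add: eq_is_equal meet_comm[of _ x])

lemma top_meet' [simp]: "x \<in> carrier L \<Longrightarrow> \<top> \<sqinter> x = x" "x \<in> carrier L \<Longrightarrow> x \<sqinter> \<top> = x"
  using top_meet[of x] by (simp_all add: eq_is_equal meet_comm[of _ x])

lemma bottom_join' [simp]: "x \<in> carrier L \<Longrightarrow> \<bottom> \<squnion> x = x" "x \<in> carrier L \<Longrightarrow> x \<squnion> \<bottom> = x"
  using bottom_join[of x] by (simp_all add: eq_is_equal join_comm[of _ x])

lemma complement_unique:
  assumes "x \<in> carrier L" "y \<in> carrier L" "z \<in> carrier L"
    and "x \<sqinter> y = \<bottom>" "x \<squnion> z = \<top>"
  shows "y \<sqsubseteq> z"
proof -
  have "y = y \<sqinter> (x \<squnion> z)"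
    using assms by simp
  also have "\<dots> = (y \<sqinter> x) \<squnion> (y \<sqinter> z)"
    using assms by (intro distrib)
  also have "\<dots> = y \<sqinter> z"
    using assms by (simp add: meet_comm[of _ y x])
  finally show ?thesis
    using assms by (metis meet_right)
qed

lemma complement_ex1:
  assumes "x \<in> carrier L"
  shows "\<exists>!y. y \<in> carrier L \<and> x \<sqinter> y = \<bottom> \<and> x \<squnion> y = \<top>"
  using complemented[OF assms] complement_unique[OF assms] le_antisym by metis

lemma
  assumes "x \<in> carrier L"
  shows complement_closed [simp]: "\<sim> x \<in> carrier L"
    and meet_complement: "x \<sqinter> \<sim> x = \<bottom>"
    and join_complement: "x \<squnion> \<sim> x = \<top>"
  using theI'[OF complement_ex1[OF assms]] unfolding complement_def by auto

lemma complementI: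
  assumes "x \<in> carrier L" "y \<in> carrier L" "x \<sqinter> y = \<bottom>" "x \<squnion> y = \<top>"
  shows "\<sim> x = y"
  using complement_ex1[OF assms(1)] assms meet_complement join_complement complement_closed by blast

lemma complement_complement [simp]: "x \<in> carrier L \<Longrightarrow> \<sim> (\<sim> x) = x"
  by (metis complementI complement_closed join_comm join_complement meet_comm meet_complement)

lemma le_complement_iff:
  assumes "x \<in> carrier L" "y \<in> carrier L"
  shows "x \<sqsubseteq> \<sim> y \<longleftrightarrow> x \<sqinter> y = \<bottom>"
proof
  assume "x \<sqsubseteq> \<sim> y"
  then have "x \<sqinter> y \<sqsubseteq> \<sim> y \<sqinter> y"
    using assms by (intro meet_mono) auto
  then show "x \<sqinter> y = \<bottom>"
    using assms by (simp add: meet_complement meet_comm[of _ "\<sim> y"] le_bottom_iff)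
next
  assume "x \<sqinter> y = \<bottom>"
  then show "x \<sqsubseteq> \<sim> y"
    using assms complement_unique[of y x "\<sim> y"] by (simp add: join_complement meet_comm)
qed

lemma le_iff_disjoint_complement:
  "\<lbrakk>x \<in> carrier L; y \<in> carrier L\<rbrakk> \<Longrightarrow> x \<sqsubseteq> y \<longleftrightarrow> x \<sqinter> \<sim> y = \<bottom>"
  using le_complement_iff[of x "\<sim> y"] by simp

lemma disjoint_mono:
  "\<lbrakk>y \<sqinter> z = \<bottom>; x \<sqsubseteq> y; x \<in> carrier L; y \<in> carrier L; z \<in> carrier L\<rbrakk> \<Longrightarrow> x \<sqinter> z = \<bottom>"
  by (metis le_complement_iff le_trans complement_closed)

text \<open>An element of a Boolean algebra is determined by the elements disjoint from it. As
  disjointness passes through arbitrary joins (\<open>disjoint_sup_iff\<close>), this gives the infinite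
  distributive law \<open>meet_sup_le\<close>.\<close>

lemma leI_disjoint:
  assumes "x \<in> carrier L" "y \<in> carrier L"
    and "\<And>z. \<lbrakk>z \<in> carrier L; z \<sqinter> y = \<bottom>\<rbrakk> \<Longrightarrow> z \<sqinter> x = \<bottom>"
  shows "x \<sqsubseteq> y"
  using assms by (metis complement_closed le_iff_disjoint_complement meet_comm meet_complement)

lemma complement_antimono:
  "\<lbrakk>x \<sqsubseteq> y; x \<in> carrier L; y \<in> carrier L\<rbrakk> \<Longrightarrow> \<sim> y \<sqsubseteq> \<sim> x"
  by (metis complement_closed le_complement_iff le_iff_disjoint_complement meet_comm)

lemma complement_bottom [simp]: "\<sim> \<bottom> = \<top>"
  by (rule complementI) auto

lemma complement_top [simp]: "\<sim> \<top> = \<bottom>"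
  by (metis bottom_carrier complement_bottom complement_complement)

lemma complement_join:
  assumes "x \<in> carrier L" "y \<in> carrier L"
  shows "\<sim> (x \<squnion> y) = \<sim> x \<sqinter> \<sim> y"
proof (rule le_antisym)
  show "\<sim> (x \<squnion> y) \<sqsubseteq> \<sim> x \<sqinter> \<sim> y"
    using assms by (intro meet_le complement_antimono join_left join_right) auto
  have "x \<squnion> y \<sqsubseteq> \<sim> (\<sim> x \<sqinter> \<sim> y)"
    using assms
    by (intro join_le) (metis complement_antimono complement_closed complement_complement
        meet_closed meet_left meet_right)+
  then show "\<sim> x \<sqinter> \<sim> y \<sqsubseteq> \<sim> (x \<squnion> y)"
    using assms by (metis complement_antimono complement_closed complement_complement
        join_closed meet_closed)
qed (use assms in auto)

lemma sup_le_iff: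
  assumes "S \<subseteq> carrier L" "y \<in> carrier L"
  shows "\<Squnion>S \<sqsubseteq> y \<longleftrightarrow> (\<forall>s \<in> S. s \<sqsubseteq> y)"
proof
  assume y: "\<Squnion>S \<sqsubseteq> y"
  show "\<forall>s \<in> S. s \<sqsubseteq> y"
  proof
    fix s assume "s \<in> S"
    then show "s \<sqsubseteq> y"
      using assms by (intro le_trans[OF sup_upper y]) auto
  qed
qed (use assms sup_least in auto)

lemma sup_mono: "\<lbrakk>S \<subseteq> T; T \<subseteq> carrier L\<rbrakk> \<Longrightarrow> \<Squnion>S \<sqsubseteq> \<Squnion>T"
  by (rule sup_least) (auto intro: sup_upper)

lemma sup_empty [simp]: "\<Squnion>{} = \<bottom>"
  using weak_sup_empty by (simp add: eq_is_equal)

lemma inf_empty [simp]: "\<Sqinter>{} = \<top>"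
  using weak_inf_empty by (simp add: eq_is_equal)

lemma sup_insert: "\<lbrakk>a \<in> carrier L; S \<subseteq> carrier L\<rbrakk> \<Longrightarrow> \<Squnion>(insert a S) = a \<squnion> \<Squnion>S"
  using weak_sup_insert by (simp add: eq_is_equal)

lemma disjoint_sup_iff:
  assumes "S \<subseteq> carrier L" "x \<in> carrier L"
  shows "x \<sqinter> \<Squnion>S = \<bottom> \<longleftrightarrow> (\<forall>s \<in> S. x \<sqinter> s = \<bottom>)"
proof -
  have "x \<sqinter> \<Squnion>S = \<bottom> \<longleftrightarrow> \<Squnion>S \<sqsubseteq> \<sim> x"
    using assms by (metis le_complement_iff meet_comm sup_closed)
  also have "\<dots> \<longleftrightarrow> (\<forall>s \<in> S. s \<sqsubseteq> \<sim> x)"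
    using assms by (simp add: sup_le_iff)
  also have "\<dots> \<longleftrightarrow> (\<forall>s \<in> S. x \<sqinter> s = \<bottom>)"
    using assms by (metis le_complement_iff meet_comm subsetD)
  finally show ?thesis .
qed

text \<open>If \<open>w\<close> is disjoint from \<open>z\<close>, then \<open>w \<sqinter> x\<close> is disjoint from all elements of \<open>S\<close>, hence from their join.\<close>

lemma meet_sup_le:
  assumes "S \<subseteq> carrier L" "x \<in> carrier L" "z \<in> carrier L" and "\<And>s. s \<in> S \<Longrightarrow> x \<sqinter> s \<sqsubseteq> z"
  shows "x \<sqinter> \<Squnion>S \<sqsubseteq> z"
proof (rule leI_disjoint)
  fix w assume w: "w \<in> carrier L" "w \<sqinter> z = \<bottom>"
  have "(w \<sqinter> x) \<sqinter> s = \<bottom>" if "s \<in> S" for s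
  proof -
    have s: "s \<in> carrier L"
      using that assms by auto
    have "(x \<sqinter> s) \<sqinter> w = \<bottom>"
      using assms w that s disjoint_mono[of z w "x \<sqinter> s"] by (simp add: meet_comm[of _ w])
    then show ?thesis
      using w assms s by (metis meet_assoc meet_comm)
  qed
  then have "(w \<sqinter> x) \<sqinter> \<Squnion>S = \<bottom>"
    using w assms by (simp add: disjoint_sup_iff)
  then show "w \<sqinter> (x \<sqinter> \<Squnion>S) = \<bottom>"
    using w assms by (simp add: meet_assoc)
qed (use assms in auto)

lemma sup_meet_sup_le:
  assumes "S \<subseteq> carrier L" "T \<subseteq> carrier L" "z \<in> carrier L"
    and "\<And>s t. \<lbrakk>s \<in> S; t \<in> T\<rbrakk> \<Longrightarrow> s \<sqinter> t \<sqsubseteq> z"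
  shows "\<Squnion>S \<sqinter> \<Squnion>T \<sqsubseteq> z"
proof (rule meet_sup_le)
  fix t assume t: "t \<in> T"
  have "t \<sqinter> \<Squnion>S \<sqsubseteq> z"
    using assms t by (intro meet_sup_le) (auto simp: meet_comm[of _ t])
  then show "\<Squnion>S \<sqinter> t \<sqsubseteq> z"
    by (simp add: meet_comm)
qed (use assms in auto)

end

definition atoms :: "('a, 'b) gorder_scheme \<Rightarrow> 'a set" where
  "atoms L = {x. lattice_atom L x}"

definition atoms_below :: "('a, 'b) gorder_scheme \<Rightarrow> 'a \<Rightarrow> 'a set" where
  "atoms_below L b = {x \<in> atoms L. x \<sqsubseteq>\<^bsub>L\<^esub> b}"

lemma atoms_below_subset: "atoms_below L b \<subseteq> atoms L"
  by (auto simp: atoms_below_def)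

context complete_boolean_algebra
begin

lemma atoms_carrier: "atoms L \<subseteq> carrier L"
  by (auto simp: atoms_def lattice_atom_def)

lemma atom_le_or_disjoint:
  assumes "x \<in> atoms L" "b \<in> carrier L"
  shows "x \<sqsubseteq> b \<or> x \<sqinter> b = \<bottom>"
proof -
  have x: "x \<in> carrier L"
    using assms atoms_carrier by auto
  then have "x \<sqinter> b = \<bottom> \<or> x \<sqinter> b = x"
    using assms meet_left[of x b] by (auto simp: atoms_def lattice_atom_def)
  then show ?thesis
    using meet_right[OF x assms(2)] by auto
qed

lemma atom_not_disjoint:
  assumes "x \<in> atoms L" "b \<in> carrier L" "x \<sqsubseteq> b"
  shows "x \<sqinter> b \<noteq> \<bottom>"
proof -
  have "x \<in> carrier L" "x \<noteq> \<bottom>"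
    using assms by (auto simp: atoms_def lattice_atom_def)
  moreover have "x \<sqsubseteq> x \<sqinter> b"
    using assms calculation by (intro meet_le) auto
  ultimately show ?thesis
    by (auto simp: le_bottom_iff)
qed

lemma atom_le_complement_iff:
  assumes "x \<in> atoms L" "b \<in> carrier L"
  shows "x \<sqsubseteq> \<sim> b \<longleftrightarrow> \<not> x \<sqsubseteq> b"
  using atom_le_or_disjoint[OF assms] atom_not_disjoint[OF assms] le_complement_iff[of x b] assms
    atoms_carrier by auto

lemma atom_le_sup_iff:
  assumes "x \<in> atoms L" "S \<subseteq> carrier L"
  shows "x \<sqsubseteq> \<Squnion>S \<longleftrightarrow> (\<exists>s \<in> S. x \<sqsubseteq> s)"
proof -
  have x: "x \<in> carrier L"
    using assms atoms_carrier by auto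
  have "x \<sqsubseteq> b \<longleftrightarrow> x \<sqinter> b \<noteq> \<bottom>" if "b \<in> carrier L" for b
    using assms(1) that atom_le_or_disjoint atom_not_disjoint by blast
  then show ?thesis
    using assms x disjoint_sup_iff[of S x] by (auto simp: subset_iff)
qed

lemma atom_le_atom_iff: "\<lbrakk>x \<in> atoms L; y \<in> atoms L\<rbrakk> \<Longrightarrow> x \<sqsubseteq> y \<longleftrightarrow> x = y"
  by (auto simp: atoms_def lattice_atom_def)

lemma atom_le_inf_iff:
  assumes "x \<in> carrier L" "S \<subseteq> carrier L"
  shows "x \<sqsubseteq> \<Sqinter>S \<longleftrightarrow> (\<forall>s \<in> S. x \<sqsubseteq> s)"
proof
  assume "x \<sqsubseteq> \<Sqinter>S"
  then show "\<forall>s \<in> S. x \<sqsubseteq> s"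
    using assms by (meson inf_closed inf_lower le_trans subsetD)
next
  assume "\<forall>s \<in> S. x \<sqsubseteq> s"
  with assms show "x \<sqsubseteq> \<Sqinter>S"
    by (intro inf_greatest) auto
qed

lemma atoms_below_sup: "S \<subseteq> carrier L \<Longrightarrow> atoms_below L (\<Squnion>S) = (\<Union>s \<in> S. atoms_below L s)"
  by (auto simp: atoms_below_def atom_le_sup_iff)

lemma atoms_below_inf:
  "S \<subseteq> carrier L \<Longrightarrow> atoms_below L (\<Sqinter>S) = {x \<in> atoms L. \<forall>s \<in> S. x \<in> atoms_below L s}"
  using atoms_carrier by (auto simp: atoms_below_def atom_le_inf_iff)

lemma atoms_below_complement: "b \<in> carrier L \<Longrightarrow> atoms_below L (\<sim> b) = atoms L - atoms_below L b"
  by (auto simp: atoms_below_def atom_le_complement_iff)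

lemma atoms_below_meet:
  "\<lbrakk>b \<in> carrier L; c \<in> carrier L\<rbrakk> \<Longrightarrow> atoms_below L (b \<sqinter> c) = atoms_below L b \<inter> atoms_below L c"
  using atoms_carrier by (auto simp: atoms_below_def meet_le_iff)

lemma atoms_below_bottom [simp]: "atoms_below L \<bottom> = {}"
  using atoms_below_sup[of "{}"] by simp

lemma atoms_below_top [simp]: "atoms_below L \<top> = atoms L"
  using atoms_below_inf[of "{}"] by simp

text \<open>Together with \<open>atoms_below_inject\<close> and the rules for joins, meets and complements above, this
  identifies a complete atomic Boolean algebra with the power set of its set of atoms.\<close>

lemma atoms_below_sup_atoms: "S \<subseteq> atoms L \<Longrightarrow> atoms_below L (\<Squnion>S) = S"
  using atoms_carrier atoms_below_sup[of S] by (auto simp: atoms_below_def atom_le_atom_iff subset_iff)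

end

locale atomic_complete_boolean_algebra = complete_boolean_algebra +
  assumes atomic: "atomic_lattice L"
begin

lemma atoms_below_subset_iff:
  assumes "b \<in> carrier L" "c \<in> carrier L"
  shows "atoms_below L b \<subseteq> atoms_below L c \<longleftrightarrow> b \<sqsubseteq> c"
proof
  assume "b \<sqsubseteq> c"
  then show "atoms_below L b \<subseteq> atoms_below L c"
    using assms atoms_carrier by (auto simp: atoms_below_def intro: le_trans)
next
  assume *: "atoms_below L b \<subseteq> atoms_below L c"
  show "b \<sqsubseteq> c"
  proof (rule ccontr)
    assume "\<not> b \<sqsubseteq> c"
    then have "b \<sqinter> \<sim> c \<noteq> \<bottom>"
      using assms by (simp add: le_iff_disjoint_complement)
    then obtain x where "x \<in> atoms_below L (b \<sqinter> \<sim> c)"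
      using assms atomic by (auto simp: atomic_lattice_def atoms_below_def atoms_def)
    then show False
      using * assms by (auto simp: atoms_below_meet atoms_below_complement)
  qed
qed

lemma atoms_below_inject:
  "\<lbrakk>atoms_below L b = atoms_below L c; b \<in> carrier L; c \<in> carrier L\<rbrakk> \<Longrightarrow> b = c"
  using atoms_below_subset_iff[of b c] atoms_below_subset_iff[of c b] by (intro le_antisym) auto

lemma sup_atoms_below:
  assumes "b \<in> carrier L"
  shows "\<Squnion>(atoms_below L b) = b"
proof (rule atoms_below_inject)
  show "atoms_below L (\<Squnion>(atoms_below L b)) = atoms_below L b"
    by (intro atoms_below_sup_atoms atoms_below_subset)
  show "\<Squnion>(atoms_below L b) \<in> carrier L"
    using order_trans[OF atoms_below_subset atoms_carrier] by simp
qed (rule assms)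

end

section \<open>De Vries algebras and their morphisms\<close>

context devries_algebra
begin

lemma prec_le: "\<lbrakk>a \<prec> b; a \<in> carrier A; b \<in> carrier A\<rbrakk> \<Longrightarrow> a \<sqsubseteq> b"
  by (rule DV2)

lemma prec_mono_left: "\<lbrakk>a \<sqsubseteq> b; b \<prec> c; a \<in> carrier A; b \<in> carrier A; c \<in> carrier A\<rbrakk> \<Longrightarrow> a \<prec> c"
  using DV3[of a b c c] by simp

lemma prec_mono_right: "\<lbrakk>a \<prec> b; b \<sqsubseteq> c; a \<in> carrier A; b \<in> carrier A; c \<in> carrier A\<rbrakk> \<Longrightarrow> a \<prec> c"
  using DV3[of a a b c] by simp

lemma prec_complement_iff:
  "\<lbrakk>a \<in> carrier A; b \<in> carrier A\<rbrakk> \<Longrightarrow> \<sim> b \<prec> \<sim> a \<longleftrightarrow> a \<prec> b"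
  using DV5[of a b] DV5[of "\<sim> b" "\<sim> a"] by auto

lemma bottom_prec: "b \<in> carrier A \<Longrightarrow> \<bottom> \<prec> b"
  using DV5[OF _ _ DV1] by (auto intro: prec_mono_right)

lemma prec_top: "b \<in> carrier A \<Longrightarrow> b \<prec> \<top>"
  using DV1 by (auto intro: prec_mono_left)

lemma join_prec:
  assumes "a \<prec> c" "b \<prec> c" "a \<in> carrier A" "b \<in> carrier A" "c \<in> carrier A"
  shows "a \<squnion> b \<prec> c"
proof -
  have "\<sim> c \<prec> \<sim> a \<sqinter> \<sim> b"
    using assms by (intro DV4) (auto simp: prec_complement_iff)
  then show ?thesis
    using assms prec_complement_iff[of "a \<squnion> b" c] by (simp add: complement_join)
qed

lemma sup_prec:
  assumes "finite S" "S \<subseteq> carrier A" "c \<in> carrier A" "\<And>s. s \<in> S \<Longrightarrow> s \<prec> c"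
  shows "\<Squnion>S \<prec> c"
  using assms by (induction S) (auto simp: bottom_prec sup_insert join_prec)

lemma meet_prec_meet:
  assumes "a \<prec> b" "c \<prec> d" "a \<in> carrier A" "b \<in> carrier A" "c \<in> carrier A" "d \<in> carrier A"
  shows "a \<sqinter> c \<prec> b \<sqinter> d"
  using assms by (intro DV4) (auto intro: prec_mono_left meet_left meet_right)

end

definition prec_below :: "'a devries_structure \<Rightarrow> 'a \<Rightarrow> 'a set" where
  "prec_below A b = {a \<in> carrier A. a \<prec>\<^bsub>A\<^esub> b}"

lemma prec_below_iff: "a \<in> prec_below A b \<longleftrightarrow> a \<in> carrier A \<and> a \<prec>\<^bsub>A\<^esub> b"
  by (simp add: prec_below_def)

lemma prec_below_subset: "prec_below A b \<subseteq> carrier A"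
  by (auto simp: prec_below_iff)

lemma prec_below_image: "{f a | a. a \<in> carrier A \<and> a \<prec>\<^bsub>A\<^esub> b} = f ` prec_below A b"
  by (auto simp: prec_below_iff)

lemma (in devries_algebra) sup_prec_below: "b \<in> carrier A \<Longrightarrow> \<Squnion>(prec_below A b) = b"
  using DV7[of b] by (simp add: prec_below_def)

locale devries_hom = A: devries_algebra A + B: devries_algebra B
  for A :: "'a devries_structure" and B :: "'b devries_structure" +
  fixes \<rho> :: "'a \<Rightarrow> 'b"
  assumes morphism: "devries_morphism A B \<rho>"
begin

lemma PiE: "\<rho> \<in> carrier A \<rightarrow>\<^sub>E carrier B"
  using morphism by (simp add: devries_morphism_def)

lemma closed [simp]: "a \<in> carrier A \<Longrightarrow> \<rho> a \<in> carrier B"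
  using PiE by auto

lemma image_subset: "\<rho> ` prec_below A b \<subseteq> carrier B"
  by (auto simp: prec_below_iff)

lemma map_bottom [simp]: "\<rho> \<bottom>\<^bsub>A\<^esub> = \<bottom>\<^bsub>B\<^esub>"
  using morphism by (simp add: devries_morphism_def)

lemma map_meet: "\<lbrakk>a \<in> carrier A; b \<in> carrier A\<rbrakk> \<Longrightarrow> \<rho> (a \<sqinter>\<^bsub>A\<^esub> b) = \<rho> a \<sqinter>\<^bsub>B\<^esub> \<rho> b"
  using morphism unfolding devries_morphism_def by blast

lemma map_prec_complement:
  "\<lbrakk>a \<prec>\<^bsub>A\<^esub> b; a \<in> carrier A; b \<in> carrier A\<rbrakk> \<Longrightarrow> (\<sim>\<^bsub>B\<^esub> \<rho> (\<sim>\<^bsub>A\<^esub> a)) \<prec>\<^bsub>B\<^esub> \<rho> b"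
  using morphism unfolding devries_morphism_def by blast

lemma map_eq_sup: "b \<in> carrier A \<Longrightarrow> \<rho> b = \<Squnion>\<^bsub>B\<^esub>(\<rho> ` prec_below A b)"
  using morphism unfolding devries_morphism_def prec_below_image by blast

lemma map_mono: "\<lbrakk>a \<sqsubseteq>\<^bsub>A\<^esub> b; a \<in> carrier A; b \<in> carrier A\<rbrakk> \<Longrightarrow> \<rho> a \<sqsubseteq>\<^bsub>B\<^esub> \<rho> b"
  by (metis A.le_iff_join B.meet_right A.le_iff_meet map_meet closed)

lemma map_disjoint:
  assumes "a \<sqinter>\<^bsub>A\<^esub> b = \<bottom>\<^bsub>A\<^esub>" "a \<in> carrier A" "b \<in> carrier A"
  shows "\<rho> a \<sqinter>\<^bsub>B\<^esub> \<rho> b = \<bottom>\<^bsub>B\<^esub>"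
  using assms map_meet[of a b] by simp

lemma map_le_complement:
  assumes "a \<in> carrier A"
  shows "\<rho> a \<sqsubseteq>\<^bsub>B\<^esub> (\<sim>\<^bsub>B\<^esub> \<rho> (\<sim>\<^bsub>A\<^esub> a))"
  using assms by (simp add: B.le_complement_iff map_disjoint A.meet_complement)

lemma map_prec: "\<lbrakk>a \<prec>\<^bsub>A\<^esub> b; a \<in> carrier A; b \<in> carrier A\<rbrakk> \<Longrightarrow> \<rho> a \<prec>\<^bsub>B\<^esub> \<rho> b"
  by (rule B.prec_mono_left[OF map_le_complement map_prec_complement]) auto

lemma map_top [simp]: "\<rho> \<top>\<^bsub>A\<^esub> = \<top>\<^bsub>B\<^esub>"
proof -
  have "\<top>\<^bsub>B\<^esub> \<prec>\<^bsub>B\<^esub> \<rho> \<top>\<^bsub>A\<^esub>"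
    using map_prec_complement[OF A.DV1] by simp
  then show ?thesis
    using B.prec_le[of "\<top>\<^bsub>B\<^esub>" "\<rho> \<top>\<^bsub>A\<^esub>"] by (simp add: B.top_le_iff)
qed

end

lemma devries_morphismI:
  assumes "\<rho> \<in> carrier A \<rightarrow>\<^sub>E carrier B" "\<rho> \<bottom>\<^bsub>A\<^esub> = \<bottom>\<^bsub>B\<^esub>"
    and "\<And>a b. \<lbrakk>a \<in> carrier A; b \<in> carrier A\<rbrakk> \<Longrightarrow> \<rho> (a \<sqinter>\<^bsub>A\<^esub> b) = \<rho> a \<sqinter>\<^bsub>B\<^esub> \<rho> b"
    and "\<And>a b. \<lbrakk>a \<in> carrier A; b \<in> carrier A; a \<prec>\<^bsub>A\<^esub> b\<rbrakk> \<Longrightarrow> (\<sim>\<^bsub>B\<^esub> \<rho> (\<sim>\<^bsub>A\<^esub> a)) \<prec>\<^bsub>B\<^esub> \<rho> b"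
    and "\<And>b. b \<in> carrier A \<Longrightarrow> \<rho> b = \<Squnion>\<^bsub>B\<^esub>(\<rho> ` prec_below A b)"
  shows "devries_morphism A B \<rho>"
  using assms unfolding devries_morphism_def prec_below_image by blast

lemma devries_comp_apply:
  "b \<in> carrier A \<Longrightarrow> devries_comp A C \<rho>\<^sub>2 \<rho>\<^sub>1 b = \<Squnion>\<^bsub>C\<^esub>((\<lambda>a. \<rho>\<^sub>2 (\<rho>\<^sub>1 a)) ` prec_below A b)"
  by (simp add: devries_comp_def prec_below_image)

lemma devries_comp_extensional: "devries_comp A C \<rho>\<^sub>2 \<rho>\<^sub>1 \<in> extensional (carrier A)"
  by (simp add: devries_comp_def)

text \<open>The composite \<open>\<rho>\<^sub>2 \<star> \<rho>\<^sub>1\<close> is the largest map below \<open>\<rho>\<^sub>2 \<circ> \<rho>\<^sub>1\<close> that satisfies (M4). It lies between the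
  values of \<open>\<rho>\<^sub>2 \<circ> \<rho>\<^sub>1\<close> at an argument and at the elements well below it (\<open>comp_le\<close>, \<open>le_comp\<close>), so
  that interpolation transfers the axioms from the plain composite.\<close>

locale devries_hom_pair = f: devries_hom A B \<rho>\<^sub>1 + g: devries_hom B C \<rho>\<^sub>2
  for A :: "'a devries_structure" and B :: "'b devries_structure" and C :: "'c devries_structure"
    and \<rho>\<^sub>1 \<rho>\<^sub>2
begin

abbreviation comp (\<open>\<kappa>\<close>) where "\<kappa> \<equiv> devries_comp A C \<rho>\<^sub>2 \<rho>\<^sub>1"

lemma pair_image_subset: "(\<lambda>a. \<rho>\<^sub>2 (\<rho>\<^sub>1 a)) ` prec_below A b \<subseteq> carrier C"
  by (auto simp: prec_below_iff)

lemma comp_closed [simp]: "b \<in> carrier A \<Longrightarrow> \<kappa> b \<in> carrier C"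
  using pair_image_subset by (simp add: devries_comp_apply)

lemma pair_mono:
  "\<lbrakk>a \<sqsubseteq>\<^bsub>A\<^esub> b; a \<in> carrier A; b \<in> carrier A\<rbrakk> \<Longrightarrow> \<rho>\<^sub>2 (\<rho>\<^sub>1 a) \<sqsubseteq>\<^bsub>C\<^esub> \<rho>\<^sub>2 (\<rho>\<^sub>1 b)"
  by (simp add: f.map_mono g.map_mono)

lemma le_comp:
  "\<lbrakk>a \<prec>\<^bsub>A\<^esub> b; a \<in> carrier A; b \<in> carrier A\<rbrakk> \<Longrightarrow> \<rho>\<^sub>2 (\<rho>\<^sub>1 a) \<sqsubseteq>\<^bsub>C\<^esub> \<kappa> b"
  using pair_image_subset by (auto simp: devries_comp_apply prec_below_iff intro!: g.B.sup_upper)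

lemma comp_le_iff:
  "\<lbrakk>b \<in> carrier A; c \<in> carrier C\<rbrakk> \<Longrightarrow>
    \<kappa> b \<sqsubseteq>\<^bsub>C\<^esub> c \<longleftrightarrow> (\<forall>a \<in> prec_below A b. \<rho>\<^sub>2 (\<rho>\<^sub>1 a) \<sqsubseteq>\<^bsub>C\<^esub> c)"
  using pair_image_subset by (simp add: devries_comp_apply g.B.sup_le_iff)

lemma comp_le: "b \<in> carrier A \<Longrightarrow> \<kappa> b \<sqsubseteq>\<^bsub>C\<^esub> \<rho>\<^sub>2 (\<rho>\<^sub>1 b)"
  by (simp add: comp_le_iff prec_below_iff f.A.prec_le pair_mono)

lemma comp_mono: "\<lbrakk>a \<sqsubseteq>\<^bsub>A\<^esub> b; a \<in> carrier A; b \<in> carrier A\<rbrakk> \<Longrightarrow> \<kappa> a \<sqsubseteq>\<^bsub>C\<^esub> \<kappa> b"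
  by (auto simp: comp_le_iff prec_below_iff intro!: le_comp intro: f.A.prec_mono_right)

lemma comp_meet:
  assumes "a \<in> carrier A" "b \<in> carrier A"
  shows "\<kappa> (a \<sqinter>\<^bsub>A\<^esub> b) = \<kappa> a \<sqinter>\<^bsub>C\<^esub> \<kappa> b"
proof (rule g.B.le_antisym)
  show "\<kappa> (a \<sqinter>\<^bsub>A\<^esub> b) \<sqsubseteq>\<^bsub>C\<^esub> \<kappa> a \<sqinter>\<^bsub>C\<^esub> \<kappa> b"
    using assms by (intro g.B.meet_le comp_mono f.A.meet_left f.A.meet_right) auto
  have "\<Squnion>\<^bsub>C\<^esub>((\<lambda>a. \<rho>\<^sub>2 (\<rho>\<^sub>1 a)) ` prec_below A a) \<sqinter>\<^bsub>C\<^esub>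
      \<Squnion>\<^bsub>C\<^esub>((\<lambda>a. \<rho>\<^sub>2 (\<rho>\<^sub>1 a)) ` prec_below A b) \<sqsubseteq>\<^bsub>C\<^esub> \<kappa> (a \<sqinter>\<^bsub>A\<^esub> b)"
  proof (rule g.B.sup_meet_sup_le)
    fix s t
    assume "s \<in> (\<lambda>a. \<rho>\<^sub>2 (\<rho>\<^sub>1 a)) ` prec_below A a" "t \<in> (\<lambda>a. \<rho>\<^sub>2 (\<rho>\<^sub>1 a)) ` prec_below A b"
    then obtain c d where cd: "c \<in> carrier A" "c \<prec>\<^bsub>A\<^esub> a" "d \<in> carrier A" "d \<prec>\<^bsub>A\<^esub> b"
      "s = \<rho>\<^sub>2 (\<rho>\<^sub>1 c)" "t = \<rho>\<^sub>2 (\<rho>\<^sub>1 d)"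
      by (auto simp: prec_below_iff)
    then have "s \<sqinter>\<^bsub>C\<^esub> t = \<rho>\<^sub>2 (\<rho>\<^sub>1 (c \<sqinter>\<^bsub>A\<^esub> d))"
      by (simp add: f.map_meet g.map_meet)
    then show "s \<sqinter>\<^bsub>C\<^esub> t \<sqsubseteq>\<^bsub>C\<^esub> \<kappa> (a \<sqinter>\<^bsub>A\<^esub> b)"
      using cd assms by (simp add: le_comp f.A.meet_prec_meet)
  qed (use assms pair_image_subset in auto)
  then show "\<kappa> a \<sqinter>\<^bsub>C\<^esub> \<kappa> b \<sqsubseteq>\<^bsub>C\<^esub> \<kappa> (a \<sqinter>\<^bsub>A\<^esub> b)"
    using assms by (simp add: devries_comp_apply)
qed (use assms in auto)

lemma comp_prec:
  assumes "a \<prec>\<^bsub>A\<^esub> b" "a \<in> carrier A" "b \<in> carrier A"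
  shows "(\<sim>\<^bsub>C\<^esub> \<kappa> (\<sim>\<^bsub>A\<^esub> a)) \<prec>\<^bsub>C\<^esub> \<kappa> b"
proof -
  \<comment> \<open>one interpolant for each of the two values of the composite\<close>
  obtain c where c: "c \<in> carrier A" "a \<prec>\<^bsub>A\<^esub> c" "c \<prec>\<^bsub>A\<^esub> b"
    using f.A.DV6 assms by blast
  then obtain d where d: "d \<in> carrier A" "c \<prec>\<^bsub>A\<^esub> d" "d \<prec>\<^bsub>A\<^esub> b"
    using f.A.DV6 assms by blast
  have "(\<sim>\<^bsub>C\<^esub> \<rho>\<^sub>2 (\<sim>\<^bsub>B\<^esub> (\<sim>\<^bsub>B\<^esub> \<rho>\<^sub>1 (\<sim>\<^bsub>A\<^esub> c)))) \<prec>\<^bsub>C\<^esub> \<rho>\<^sub>2 (\<rho>\<^sub>1 d)"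
    using c d by (intro g.map_prec_complement f.map_prec_complement) auto
  then have 1: "(\<sim>\<^bsub>C\<^esub> \<rho>\<^sub>2 (\<rho>\<^sub>1 (\<sim>\<^bsub>A\<^esub> c))) \<prec>\<^bsub>C\<^esub> \<rho>\<^sub>2 (\<rho>\<^sub>1 d)"
    using c by simp
  have 2: "(\<sim>\<^bsub>C\<^esub> \<kappa> (\<sim>\<^bsub>A\<^esub> a)) \<sqsubseteq>\<^bsub>C\<^esub> (\<sim>\<^bsub>C\<^esub> \<rho>\<^sub>2 (\<rho>\<^sub>1 (\<sim>\<^bsub>A\<^esub> c)))"
    using c assms by (intro g.B.complement_antimono le_comp) (auto simp: f.A.prec_complement_iff)
  show ?thesis
    using g.B.DV3[OF _ _ _ _ 2 1 le_comp] c d assms by simp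
qed

lemma comp_eq_sup:
  assumes "b \<in> carrier A"
  shows "\<kappa> b = \<Squnion>\<^bsub>C\<^esub>(\<kappa> ` prec_below A b)"
proof (rule g.B.le_antisym)
  have sub: "\<kappa> ` prec_below A b \<subseteq> carrier C"
    by (auto simp: prec_below_iff)
  show "\<kappa> b \<sqsubseteq>\<^bsub>C\<^esub> \<Squnion>\<^bsub>C\<^esub>(\<kappa> ` prec_below A b)"
    unfolding comp_le_iff[OF assms g.B.sup_closed[OF sub]]
  proof
    fix a assume "a \<in> prec_below A b"
    then have a: "a \<in> carrier A" "a \<prec>\<^bsub>A\<^esub> b"
      by (auto simp: prec_below_iff)
    then obtain c where c: "c \<in> carrier A" "a \<prec>\<^bsub>A\<^esub> c" "c \<prec>\<^bsub>A\<^esub> b"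
      using f.A.DV6 assms by blast
    have "\<rho>\<^sub>2 (\<rho>\<^sub>1 a) \<sqsubseteq>\<^bsub>C\<^esub> \<kappa> c"
      using a c by (intro le_comp)
    also have "\<kappa> c \<sqsubseteq>\<^bsub>C\<^esub> \<Squnion>\<^bsub>C\<^esub>(\<kappa> ` prec_below A b)"
      using c sub by (intro g.B.sup_upper) (auto simp: prec_below_iff)
    finally show "\<rho>\<^sub>2 (\<rho>\<^sub>1 a) \<sqsubseteq>\<^bsub>C\<^esub> \<Squnion>\<^bsub>C\<^esub>(\<kappa> ` prec_below A b)"
      using a c sub by simp
  qed
  show "\<Squnion>\<^bsub>C\<^esub>(\<kappa> ` prec_below A b) \<sqsubseteq>\<^bsub>C\<^esub> \<kappa> b"
    using assms sub by (auto simp: g.B.sup_le_iff prec_below_iff intro!: comp_mono f.A.prec_le)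
qed (use assms in \<open>auto simp: prec_below_iff intro!: g.B.sup_closed\<close>)

lemma devries_comp_morphism: "devries_morphism A C \<kappa>"
proof (rule devries_morphismI)
  show "\<kappa> \<in> carrier A \<rightarrow>\<^sub>E carrier C"
    using devries_comp_extensional by (auto simp: PiE_iff)
  show "\<kappa> \<bottom>\<^bsub>A\<^esub> = \<bottom>\<^bsub>C\<^esub>"
    using comp_le[of "\<bottom>\<^bsub>A\<^esub>"] by (simp add: g.B.le_bottom_iff)
qed (use comp_meet comp_prec comp_eq_sup in auto)

end

text \<open>Both sides at \<open>b\<close> are the join of the values \<open>\<rho>\<^sub>3 (\<rho>\<^sub>2 (\<rho>\<^sub>1 a))\<close> for \<open>a \<prec> b\<close>; an interpolant between \<open>a\<close>
  and \<open>b\<close> makes up for the additional join inside either of them.\<close>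

lemma devries_comp_assoc:
  assumes "devries_hom A B \<rho>\<^sub>1" "devries_hom B C \<rho>\<^sub>2" "devries_hom C D \<rho>\<^sub>3"
  shows "devries_comp A D \<rho>\<^sub>3 (devries_comp A C \<rho>\<^sub>2 \<rho>\<^sub>1) = devries_comp A D (devries_comp B D \<rho>\<^sub>3 \<rho>\<^sub>2) \<rho>\<^sub>1"
proof -
  interpret f: devries_hom A B \<rho>\<^sub>1 by fact
  interpret g: devries_hom B C \<rho>\<^sub>2 by fact
  interpret h: devries_hom C D \<rho>\<^sub>3 by fact
  interpret fg: devries_hom_pair A B C \<rho>\<^sub>1 \<rho>\<^sub>2 ..
  interpret gh: devries_hom_pair B C D \<rho>\<^sub>2 \<rho>\<^sub>3 ..
  interpret k: devries_hom A C "devries_comp A C \<rho>\<^sub>2 \<rho>\<^sub>1"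
    by unfold_locales (rule fg.devries_comp_morphism)
  interpret l: devries_hom B D "devries_comp B D \<rho>\<^sub>3 \<rho>\<^sub>2"
    by unfold_locales (rule gh.devries_comp_morphism)
  interpret kh: devries_hom_pair A C D "devries_comp A C \<rho>\<^sub>2 \<rho>\<^sub>1" \<rho>\<^sub>3 ..
  interpret fl: devries_hom_pair A B D \<rho>\<^sub>1 "devries_comp B D \<rho>\<^sub>3 \<rho>\<^sub>2" ..
  show ?thesis
  proof (rule extensionalityI[OF devries_comp_extensional devries_comp_extensional])
    fix b assume b: "b \<in> carrier A"
    show "kh.comp b = fl.comp b"
    proof (rule h.B.le_antisym)
      show "kh.comp b \<sqsubseteq>\<^bsub>D\<^esub> fl.comp b"
        unfolding kh.comp_le_iff[OF b fl.comp_closed[OF b]]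
      proof
        fix a assume "a \<in> prec_below A b"
        then have a: "a \<in> carrier A" "a \<prec>\<^bsub>A\<^esub> b"
          by (auto simp: prec_below_iff)
        then obtain c where c: "c \<in> carrier A" "a \<prec>\<^bsub>A\<^esub> c" "c \<prec>\<^bsub>A\<^esub> b"
          using f.A.DV6 b by blast
        have "\<rho>\<^sub>3 (fg.comp a) \<sqsubseteq>\<^bsub>D\<^esub> \<rho>\<^sub>3 (\<rho>\<^sub>2 (\<rho>\<^sub>1 a))"
          using a by (intro h.map_mono fg.comp_le) auto
        also have "\<dots> \<sqsubseteq>\<^bsub>D\<^esub> gh.comp (\<rho>\<^sub>1 c)"
          using a c by (intro gh.le_comp f.map_prec) auto
        also have "\<dots> \<sqsubseteq>\<^bsub>D\<^esub> fl.comp b"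
          using b c by (intro fl.le_comp)
        finally show "\<rho>\<^sub>3 (fg.comp a) \<sqsubseteq>\<^bsub>D\<^esub> fl.comp b"
          using a b c by simp
      qed
      show "fl.comp b \<sqsubseteq>\<^bsub>D\<^esub> kh.comp b"
        unfolding fl.comp_le_iff[OF b kh.comp_closed[OF b]]
      proof
        fix a assume "a \<in> prec_below A b"
        then have a: "a \<in> carrier A" "a \<prec>\<^bsub>A\<^esub> b"
          by (auto simp: prec_below_iff)
        then obtain c where c: "c \<in> carrier A" "a \<prec>\<^bsub>A\<^esub> c" "c \<prec>\<^bsub>A\<^esub> b"
          using f.A.DV6 b by blast
        have "gh.comp (\<rho>\<^sub>1 a) \<sqsubseteq>\<^bsub>D\<^esub> \<rho>\<^sub>3 (\<rho>\<^sub>2 (\<rho>\<^sub>1 a))"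
          using a by (intro gh.comp_le) auto
        also have "\<dots> \<sqsubseteq>\<^bsub>D\<^esub> \<rho>\<^sub>3 (fg.comp c)"
          using a c by (intro h.map_mono fg.le_comp) auto
        also have "\<dots> \<sqsubseteq>\<^bsub>D\<^esub> kh.comp b"
          using b c by (intro kh.le_comp)
        finally show "gh.comp (\<rho>\<^sub>1 a) \<sqsubseteq>\<^bsub>D\<^esub> kh.comp b"
          using a b c by simp
      qed
    qed (use b in auto)
  qed
qed

lemma devries_morphism_id:
  assumes "devries_algebra A"
  shows "devries_morphism A A (restrict id (carrier A))"
proof -
  interpret devries_algebra A by fact
  have "restrict id (carrier A) ` prec_below A b = prec_below A b" for b
    by (auto simp: prec_below_iff image_iff)
  then show ?thesis
    by (intro devries_morphismI) (auto simp: sup_prec_below)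
qed

lemma devries_comp_id_right:
  assumes "devries_hom A B \<rho>"
  shows "devries_comp A B \<rho> (restrict id (carrier A)) = \<rho>"
proof -
  interpret devries_hom A B \<rho> by fact
  show ?thesis
  proof (rule extensionalityI[OF devries_comp_extensional])
    fix b assume "b \<in> carrier A"
    then show "devries_comp A B \<rho> (restrict id (carrier A)) b = \<rho> b"
      by (auto simp: devries_comp_apply prec_below_iff map_eq_sup[of b] intro!: arg_cong[of _ _ "Lattice.sup B"] image_cong)
  qed (use PiE in \<open>simp add: PiE_def\<close>)
qed

lemma devries_comp_id_left:
  assumes "devries_hom A B \<rho>"
  shows "devries_comp A B (restrict id (carrier B)) \<rho> = \<rho>"
proof -
  interpret devries_hom A B \<rho> by fact
  show ?thesis
  proof (rule extensionalityI[OF devries_comp_extensional])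
    fix b assume "b \<in> carrier A"
    then show "devries_comp A B (restrict id (carrier B)) \<rho> b = \<rho> b"
      by (auto simp: devries_comp_apply prec_below_iff map_eq_sup[of b] intro!: arg_cong[of _ _ "Lattice.sup B"] image_cong)
  qed (use PiE in \<open>simp add: PiE_def\<close>)
qed

section \<open>The categories of de Vries extensions and of compact Hausdorff spaces\<close>

lemma complete_boolean_homE:
  assumes "complete_boolean_hom B B' \<sigma>"
  shows "\<sigma> \<in> carrier B \<rightarrow>\<^sub>E carrier B'"
    and "S \<subseteq> carrier B \<Longrightarrow> \<sigma> (\<Squnion>\<^bsub>B\<^esub>S) = \<Squnion>\<^bsub>B'\<^esub>(\<sigma> ` S)"
    and "S \<subseteq> carrier B \<Longrightarrow> \<sigma> (\<Sqinter>\<^bsub>B\<^esub>S) = \<Sqinter>\<^bsub>B'\<^esub>(\<sigma> ` S)"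
    and "a \<in> carrier B \<Longrightarrow> \<sigma> (\<sim>\<^bsub>B\<^esub> a) = (\<sim>\<^bsub>B'\<^esub> \<sigma> a)"
  using assms unfolding complete_boolean_hom_def by blast+

lemma complete_boolean_hom_id:
  assumes "complete_boolean_algebra B"
  shows "complete_boolean_hom B B (restrict id (carrier B))"
proof -
  interpret complete_boolean_algebra B by fact
  have "restrict id (carrier B) ` S = S" if "S \<subseteq> carrier B" for S
    using that by (auto simp: image_iff subset_iff)
  then show ?thesis
    by (auto simp: complete_boolean_hom_def)
qed

lemma complete_boolean_hom_compose:
  assumes "complete_boolean_algebra B\<^sub>1" "complete_boolean_hom B\<^sub>1 B\<^sub>2 \<sigma>" "complete_boolean_hom B\<^sub>2 B\<^sub>3 \<tau>"
  shows "complete_boolean_hom B\<^sub>1 B\<^sub>3 (compose (carrier B\<^sub>1) \<tau> \<sigma>)"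
proof -
  interpret complete_boolean_algebra B\<^sub>1 by fact
  note s = complete_boolean_homE[OF assms(2)] and t = complete_boolean_homE[OF assms(3)]
  have im: "compose (carrier B\<^sub>1) \<tau> \<sigma> ` S = \<tau> ` \<sigma> ` S" "\<sigma> ` S \<subseteq> carrier B\<^sub>2" if "S \<subseteq> carrier B\<^sub>1" for S
    using that s(1) by (auto simp: compose_def image_iff subset_iff)
  show ?thesis
    unfolding complete_boolean_hom_def
    using s t by (auto simp: im compose_eq PiE_iff Pi_iff)
qed

locale extension =
  fixes E :: "('a, 'b) extension"
  assumes ext: "devries_extension E"
begin

abbreviation A where "A \<equiv> src E"
abbreviation B where "B \<equiv> tgt E"
abbreviation \<alpha> where "\<alpha> \<equiv> emb E"

sublocale emb: devries_hom A B \<alpha>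
  using ext by (auto simp: devries_extension_def devries_hom_def devries_hom_axioms_def)

end

definition extension_morphism ::
  "('a, 'b) extension \<Rightarrow> ('c, 'd) extension \<Rightarrow> ('a \<Rightarrow> 'c) \<Rightarrow> ('b \<Rightarrow> 'd) \<Rightarrow> bool" where
  "extension_morphism E E' \<rho> \<sigma> \<longleftrightarrow> devries_morphism (src E) (src E') \<rho> \<and>
     complete_boolean_hom (tgt E) (tgt E') \<sigma> \<and>
     compose (carrier (src E)) \<sigma> (emb E) = devries_comp (src E) (tgt E') (emb E') \<rho>"

lemma Ob_DeVe: "E \<in> Ob DeVe \<longleftrightarrow> devries_extension E"
  by (simp add: DeVe_def)

lemma Hom_DeVe: "(\<rho>, \<sigma>) \<in> Hom DeVe E E' \<longleftrightarrow> extension_morphism E E' \<rho> \<sigma>"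
  by (simp add: DeVe_def extension_morphism_def)

lemma Comp_DeVe:
  "Comp DeVe E\<^sub>1 E\<^sub>2 E\<^sub>3 (\<rho>\<^sub>2, \<sigma>\<^sub>2) (\<rho>\<^sub>1, \<sigma>\<^sub>1) =
    (devries_comp (src E\<^sub>1) (src E\<^sub>3) \<rho>\<^sub>2 \<rho>\<^sub>1, compose (carrier (tgt E\<^sub>1)) \<sigma>\<^sub>2 \<sigma>\<^sub>1)"
  by (simp add: DeVe_def)

lemma Id_DeVe: "Id DeVe E = (restrict id (carrier (src E)), restrict id (carrier (tgt E)))"
  by (simp add: DeVe_def)

lemma extension_morphism_id:
  assumes "devries_extension E"
  shows "extension_morphism E E (restrict id (carrier (src E))) (restrict id (carrier (tgt E)))"
proof -
  interpret extension E
    using assms by unfold_locales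
  have "compose (carrier A) (restrict id (carrier B)) \<alpha> = devries_comp A B \<alpha> (restrict id (carrier A))"
    unfolding devries_comp_id_right[OF emb.devries_hom_axioms] using emb.PiE
    by (intro extensionalityI[of _ "carrier A"]) (auto simp: compose_eq PiE_def)
  then show ?thesis
    unfolding extension_morphism_def
    using devries_morphism_id[OF emb.A.devries_algebra_axioms]
      complete_boolean_hom_id[OF emb.B.complete_boolean_algebra_axioms] by simp
qed

text \<open>As \<open>\<sigma>\<^sub>2\<close> preserves joins, it can be moved inside the join that defines \<open>\<alpha>\<^sub>2 \<star> \<rho>\<^sub>1\<close>. This turns
  \<open>\<sigma>\<^sub>2 \<circ> (\<alpha>\<^sub>2 \<star> \<rho>\<^sub>1)\<close> into \<open>(\<alpha>\<^sub>3 \<star> \<rho>\<^sub>2) \<star> \<rho>\<^sub>1\<close>, and associativity does the rest.\<close>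

lemma extension_morphism_comp:
  assumes "devries_extension E\<^sub>1" "devries_extension E\<^sub>2" "devries_extension E\<^sub>3"
    and "extension_morphism E\<^sub>1 E\<^sub>2 \<rho>\<^sub>1 \<sigma>\<^sub>1" "extension_morphism E\<^sub>2 E\<^sub>3 \<rho>\<^sub>2 \<sigma>\<^sub>2"
  shows "extension_morphism E\<^sub>1 E\<^sub>3 (devries_comp (src E\<^sub>1) (src E\<^sub>3) \<rho>\<^sub>2 \<rho>\<^sub>1)
    (compose (carrier (tgt E\<^sub>1)) \<sigma>\<^sub>2 \<sigma>\<^sub>1)"
proof -
  interpret E1: extension E\<^sub>1 using assms by unfold_locales
  interpret E2: extension E\<^sub>2 using assms by unfold_locales
  interpret E3: extension E\<^sub>3 using assms by unfold_locales
  interpret r1: devries_hom E1.A E2.A \<rho>\<^sub>1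
    by unfold_locales (use assms in \<open>simp add: extension_morphism_def\<close>)
  interpret r2: devries_hom E2.A E3.A \<rho>\<^sub>2
    by unfold_locales (use assms in \<open>simp add: extension_morphism_def\<close>)
  interpret r12: devries_hom_pair E1.A E2.A E3.A \<rho>\<^sub>1 \<rho>\<^sub>2 ..
  have s1: "complete_boolean_hom E1.B E2.B \<sigma>\<^sub>1" and s2: "complete_boolean_hom E2.B E3.B \<sigma>\<^sub>2"
    using assms by (auto simp: extension_morphism_def)
  have c1: "\<sigma>\<^sub>1 (E1.\<alpha> a) = devries_comp E1.A E2.B E2.\<alpha> \<rho>\<^sub>1 a" if "a \<in> carrier E1.A" for a
    using assms(4) that unfolding extension_morphism_def by (metis compose_eq)
  have c2: "\<sigma>\<^sub>2 (E2.\<alpha> a) = devries_comp E2.A E3.B E3.\<alpha> \<rho>\<^sub>2 a" if "a \<in> carrier E2.A" for a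
    using assms(5) that unfolding extension_morphism_def by (metis compose_eq)
  have "compose (carrier E1.A) (compose (carrier E1.B) \<sigma>\<^sub>2 \<sigma>\<^sub>1) E1.\<alpha> =
      devries_comp E1.A E3.B (devries_comp E2.A E3.B E3.\<alpha> \<rho>\<^sub>2) \<rho>\<^sub>1"
  proof (rule extensionalityI[OF compose_extensional devries_comp_extensional])
    fix a assume a: "a \<in> carrier E1.A"
    have sub: "(\<lambda>c. E2.\<alpha> (\<rho>\<^sub>1 c)) ` prec_below E1.A a \<subseteq> carrier E2.B"
      by (auto simp: prec_below_iff)
    have "compose (carrier E1.A) (compose (carrier E1.B) \<sigma>\<^sub>2 \<sigma>\<^sub>1) E1.\<alpha> a =
        \<sigma>\<^sub>2 (\<Squnion>\<^bsub>E2.B\<^esub>((\<lambda>c. E2.\<alpha> (\<rho>\<^sub>1 c)) ` prec_below E1.A a))"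
      using a by (simp add: compose_eq c1 devries_comp_apply)
    also have "\<dots> = \<Squnion>\<^bsub>E3.B\<^esub>((\<lambda>c. \<sigma>\<^sub>2 (E2.\<alpha> (\<rho>\<^sub>1 c))) ` prec_below E1.A a)"
      using complete_boolean_homE(2)[OF s2 sub] by (simp add: image_image)
    also have "(\<lambda>c. \<sigma>\<^sub>2 (E2.\<alpha> (\<rho>\<^sub>1 c))) ` prec_below E1.A a =
        (\<lambda>c. devries_comp E2.A E3.B E3.\<alpha> \<rho>\<^sub>2 (\<rho>\<^sub>1 c)) ` prec_below E1.A a"
      by (intro image_cong) (auto simp: prec_below_iff c2)
    finally show "compose (carrier E1.A) (compose (carrier E1.B) \<sigma>\<^sub>2 \<sigma>\<^sub>1) E1.\<alpha> a =
        devries_comp E1.A E3.B (devries_comp E2.A E3.B E3.\<alpha> \<rho>\<^sub>2) \<rho>\<^sub>1 a"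
      using a by (simp add: devries_comp_apply)
  qed
  also have "\<dots> = devries_comp E1.A E3.B E3.\<alpha> (devries_comp E1.A E3.A \<rho>\<^sub>2 \<rho>\<^sub>1)"
    by (rule devries_comp_assoc[symmetric])
      (rule r1.devries_hom_axioms r2.devries_hom_axioms E3.emb.devries_hom_axioms)+
  finally show ?thesis
    unfolding extension_morphism_def
    using r12.devries_comp_morphism
      complete_boolean_hom_compose[OF E1.emb.B.complete_boolean_algebra_axioms s1 s2] by simp
qed

lemma category_DeVe: "category (DeVe :: (('a, 'b) extension, ('a \<Rightarrow> 'a) \<times> ('b \<Rightarrow> 'b)) category)"
proof
  fix E :: "('a, 'b) extension"
  assume "E \<in> Ob DeVe"
  then show "Id DeVe E \<in> Hom DeVe E E"
    by (simp add: Id_DeVe Hom_DeVe Ob_DeVe extension_morphism_id)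
next
  fix E\<^sub>1 E\<^sub>2 E\<^sub>3 :: "('a, 'b) extension" and f g
  assume "E\<^sub>1 \<in> Ob DeVe" "E\<^sub>2 \<in> Ob DeVe" "E\<^sub>3 \<in> Ob DeVe" "f \<in> Hom DeVe E\<^sub>1 E\<^sub>2" "g \<in> Hom DeVe E\<^sub>2 E\<^sub>3"
  then show "Comp DeVe E\<^sub>1 E\<^sub>2 E\<^sub>3 g f \<in> Hom DeVe E\<^sub>1 E\<^sub>3"
    by (cases f, cases g) (simp add: Comp_DeVe Hom_DeVe Ob_DeVe extension_morphism_comp)
next
  fix E\<^sub>1 E\<^sub>2 :: "('a, 'b) extension" and f
  assume *: "E\<^sub>1 \<in> Ob DeVe" "E\<^sub>2 \<in> Ob DeVe" "f \<in> Hom DeVe E\<^sub>1 E\<^sub>2"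
  obtain \<rho> \<sigma> where f: "f = (\<rho>, \<sigma>)" by fastforce
  interpret E1: extension E\<^sub>1 using * by unfold_locales (simp add: Ob_DeVe)
  interpret E2: extension E\<^sub>2 using * by unfold_locales (simp add: Ob_DeVe)
  interpret r: devries_hom E1.A E2.A \<rho>
    by unfold_locales (use * f in \<open>simp add: Hom_DeVe extension_morphism_def\<close>)
  have \<sigma>: "\<sigma> \<in> carrier E1.B \<rightarrow>\<^sub>E carrier E2.B"
    using * f by (auto simp: Hom_DeVe extension_morphism_def complete_boolean_hom_def)
  show "Comp DeVe E\<^sub>1 E\<^sub>1 E\<^sub>2 f (Id DeVe E\<^sub>1) = f"
    using \<sigma> unfolding f Id_DeVe Comp_DeVe devries_comp_id_right[OF r.devries_hom_axioms]
    by (auto simp: compose_def PiE_def fun_eq_iff extensional_def)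
  show "Comp DeVe E\<^sub>1 E\<^sub>2 E\<^sub>2 (Id DeVe E\<^sub>2) f = f"
    using \<sigma> unfolding f Id_DeVe Comp_DeVe devries_comp_id_left[OF r.devries_hom_axioms]
    by (auto simp: compose_def PiE_def fun_eq_iff extensional_def Pi_iff)
next
  fix E\<^sub>1 E\<^sub>2 E\<^sub>3 E\<^sub>4 :: "('a, 'b) extension" and f g h
  assume *: "E\<^sub>1 \<in> Ob DeVe" "E\<^sub>2 \<in> Ob DeVe" "E\<^sub>3 \<in> Ob DeVe" "E\<^sub>4 \<in> Ob DeVe"
    "f \<in> Hom DeVe E\<^sub>1 E\<^sub>2" "g \<in> Hom DeVe E\<^sub>2 E\<^sub>3" "h \<in> Hom DeVe E\<^sub>3 E\<^sub>4"
  obtain \<rho>\<^sub>1 \<sigma>\<^sub>1 \<rho>\<^sub>2 \<sigma>\<^sub>2 \<rho>\<^sub>3 \<sigma>\<^sub>3 where fgh: "f = (\<rho>\<^sub>1, \<sigma>\<^sub>1)" "g = (\<rho>\<^sub>2, \<sigma>\<^sub>2)" "h = (\<rho>\<^sub>3, \<sigma>\<^sub>3)"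
    by (metis surj_pair)
  have hom: "devries_hom (src E\<^sub>1) (src E\<^sub>2) \<rho>\<^sub>1" "devries_hom (src E\<^sub>2) (src E\<^sub>3) \<rho>\<^sub>2"
      "devries_hom (src E\<^sub>3) (src E\<^sub>4) \<rho>\<^sub>3"
    using * fgh by (auto simp: Hom_DeVe Ob_DeVe extension_morphism_def devries_extension_def
        devries_hom_def devries_hom_axioms_def)
  have "\<sigma>\<^sub>1 \<in> carrier (tgt E\<^sub>1) \<rightarrow>\<^sub>E carrier (tgt E\<^sub>2)"
    using * fgh by (auto simp: Hom_DeVe extension_morphism_def complete_boolean_hom_def)
  then have "compose (carrier (tgt E\<^sub>1)) \<sigma>\<^sub>3 (compose (carrier (tgt E\<^sub>1)) \<sigma>\<^sub>2 \<sigma>\<^sub>1) =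
      compose (carrier (tgt E\<^sub>1)) (compose (carrier (tgt E\<^sub>2)) \<sigma>\<^sub>3 \<sigma>\<^sub>2) \<sigma>\<^sub>1"
    by (intro compose_assoc) auto
  then show "Comp DeVe E\<^sub>1 E\<^sub>3 E\<^sub>4 h (Comp DeVe E\<^sub>1 E\<^sub>2 E\<^sub>3 g f) =
      Comp DeVe E\<^sub>1 E\<^sub>2 E\<^sub>4 (Comp DeVe E\<^sub>2 E\<^sub>3 E\<^sub>4 h g) f"
    by (simp add: fgh Comp_DeVe devries_comp_assoc[OF hom])
qed

lemma category_KHaus: "category KHaus"
proof
  fix W X Y Z :: "'a topology" and f g h
  assume *: "f \<in> Hom KHaus W X" "g \<in> Hom KHaus X Y" "h \<in> Hom KHaus Y Z"
  then have "f \<in> topspace W \<rightarrow> topspace X"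
    by (auto simp: KHaus_def dest: continuous_map_image_subset_topspace)
  then show "Comp KHaus W Y Z h (Comp KHaus W X Y g f) = Comp KHaus W X Z (Comp KHaus X Y Z h g) f"
    by (auto simp: KHaus_def intro!: compose_assoc)
next
  fix X Y Z :: "'a topology" and f g
  assume *: "f \<in> Hom KHaus X Y" "g \<in> Hom KHaus Y Z"
  then have "continuous_map X Z (g \<circ> f)"
    by (auto simp: KHaus_def intro: continuous_map_compose)
  then have "continuous_map X Z (compose (topspace X) g f)"
    by (rule continuous_map_eq) (simp add: compose_def)
  then show "Comp KHaus X Y Z g f \<in> Hom KHaus X Z"
    by (simp add: KHaus_def)
next
  fix X Y :: "'a topology" and f
  assume *: "f \<in> Hom KHaus X Y"
  then have "f \<in> topspace X \<rightarrow> topspace Y"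
    by (auto simp: KHaus_def dest: continuous_map_image_subset_topspace)
  with * show "Comp KHaus X X Y f (Id KHaus X) = f" "Comp KHaus X Y Y (Id KHaus Y) f = f"
    by (auto simp: KHaus_def compose_def fun_eq_iff extensional_def Pi_iff)
qed (auto simp: KHaus_def)

section \<open>The space of atoms of a de Vries extension\<close>

definition basic_open :: "('a, 'b) extension \<Rightarrow> 'a \<Rightarrow> 'b set" where
  "basic_open E a = atoms_below (tgt E) (emb E a)"

definition atom_space :: "('a, 'b) extension \<Rightarrow> 'b topology" where
  "atom_space E = topology (arbitrary union_of (\<lambda>S. S \<in> basic_open E ` carrier (src E)))"

context extension
begin

abbreviation X where "X \<equiv> atoms B"
abbreviation U where "U \<equiv> basic_open E"

sublocale B: atomic_complete_boolean_algebra B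
  using ext by unfold_locales (simp add: devries_extension_def)

lemma U_subset: "U a \<subseteq> X"
  by (simp add: basic_open_def atoms_below_subset)

lemma U_bottom [simp]: "U \<bottom>\<^bsub>A\<^esub> = {}"
  by (simp add: basic_open_def)

lemma U_top [simp]: "U \<top>\<^bsub>A\<^esub> = X"
  by (simp add: basic_open_def)

lemma U_meet: "\<lbrakk>a \<in> carrier A; b \<in> carrier A\<rbrakk> \<Longrightarrow> U (a \<sqinter>\<^bsub>A\<^esub> b) = U a \<inter> U b"
  by (simp add: basic_open_def emb.map_meet emb.B.atoms_below_meet)

lemma U_inject: "\<lbrakk>U a = U b; a \<in> carrier A; b \<in> carrier A\<rbrakk> \<Longrightarrow> a = b"
  using ext by (auto simp: basic_open_def devries_extension_def dest: B.atoms_below_inject inj_onD)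

lemma U_subset_iff:
  assumes "a \<in> carrier A" "b \<in> carrier A"
  shows "U a \<subseteq> U b \<longleftrightarrow> a \<sqsubseteq>\<^bsub>A\<^esub> b"
proof -
  have "a \<sqsubseteq>\<^bsub>A\<^esub> b \<longleftrightarrow> a \<sqinter>\<^bsub>A\<^esub> b = a"
    using emb.A.le_iff_join[OF assms] by auto
  also have "\<dots> \<longleftrightarrow> U (a \<sqinter>\<^bsub>A\<^esub> b) = U a"
    using U_inject[of "a \<sqinter>\<^bsub>A\<^esub> b" a] assms by (intro iffI) simp_all
  also have "\<dots> \<longleftrightarrow> U a \<subseteq> U b"
    unfolding U_meet[OF assms] by blast
  finally show ?thesis ..
qed

lemma U_disjoint_iff:
  assumes "a \<in> carrier A" "b \<in> carrier A"
  shows "U a \<inter> U b = {} \<longleftrightarrow> a \<sqinter>\<^bsub>A\<^esub> b = \<bottom>\<^bsub>A\<^esub>"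
proof -
  have "U (a \<sqinter>\<^bsub>A\<^esub> b) = U \<bottom>\<^bsub>A\<^esub> \<longleftrightarrow> a \<sqinter>\<^bsub>A\<^esub> b = \<bottom>\<^bsub>A\<^esub>"
    using U_inject[of "a \<sqinter>\<^bsub>A\<^esub> b" "\<bottom>\<^bsub>A\<^esub>"] assms by (intro iffI) simp_all
  then show ?thesis
    by (simp add: U_meet[OF assms])
qed

lemma U_complement_disjoint: "a \<in> carrier A \<Longrightarrow> U a \<inter> U (\<sim>\<^bsub>A\<^esub> a) = {}"
  by (simp add: U_disjoint_iff emb.A.meet_complement)

text \<open>This and the next lemma are (M3) and (M4). The set on the left is the closure of \<open>U a\<close>.\<close>

lemma U_prec:
  assumes "a \<prec>\<^bsub>A\<^esub> b" "a \<in> carrier A" "b \<in> carrier A"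
  shows "X - U (\<sim>\<^bsub>A\<^esub> a) \<subseteq> U b"
proof -
  have "(\<sim>\<^bsub>B\<^esub> \<alpha> (\<sim>\<^bsub>A\<^esub> a)) \<sqsubseteq>\<^bsub>B\<^esub> \<alpha> b"
    using emb.map_prec_complement[OF assms] assms by (intro emb.B.prec_le) auto
  then show ?thesis
    using assms by (simp add: basic_open_def flip: B.atoms_below_subset_iff emb.B.atoms_below_complement)
qed

lemma U_eq_Union: "b \<in> carrier A \<Longrightarrow> U b = (\<Union>a \<in> prec_below A b. U a)"
  unfolding basic_open_def using emb.image_subset
  by (subst emb.map_eq_sup) (auto simp: emb.B.atoms_below_sup)

text \<open>An atom is a join of meets of elements of \<open>\<alpha>[A]\<close>, hence equal to one of these meets, and no other atom
  lies below all elements that this meet is made of.\<close>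

lemma atoms_separated:
  assumes "x \<in> X" "y \<in> X" "x \<noteq> y"
  obtains a where "a \<in> carrier A" "x \<in> U a" "y \<notin> U a"
proof -
  have x: "x \<in> carrier B" and y: "y \<in> carrier B"
    using assms emb.B.atoms_carrier by auto
  obtain \<S> where \<S>: "\<forall>S \<in> \<S>. S \<subseteq> \<alpha> ` carrier A" "x = \<Squnion>\<^bsub>B\<^esub>((\<lambda>S. \<Sqinter>\<^bsub>B\<^esub>S) ` \<S>)"
    using ext x unfolding devries_extension_def by meson
  have sub: "S \<subseteq> carrier B" if "S \<in> \<S>" for S
    using \<S>(1) that emb.closed by blast
  have inf: "(\<lambda>S. \<Sqinter>\<^bsub>B\<^esub>S) ` \<S> \<subseteq> carrier B"
    using sub by (auto intro!: emb.B.weak.inf_closed)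
  have "x \<sqsubseteq>\<^bsub>B\<^esub> \<Squnion>\<^bsub>B\<^esub>((\<lambda>S. \<Sqinter>\<^bsub>B\<^esub>S) ` \<S>)"
    using \<S>(2) x by simp
  then obtain S where S: "S \<in> \<S>" "x \<sqsubseteq>\<^bsub>B\<^esub> \<Sqinter>\<^bsub>B\<^esub>S"
    using emb.B.atom_le_sup_iff[OF assms(1) inf] by auto
  have "\<Sqinter>\<^bsub>B\<^esub>S \<sqsubseteq>\<^bsub>B\<^esub> x"
    using emb.B.sup_upper[OF inf imageI[OF S(1)]] \<S>(2) by simp
  then have "y \<sqsubseteq>\<^bsub>B\<^esub> x" if "y \<sqsubseteq>\<^bsub>B\<^esub> \<Sqinter>\<^bsub>B\<^esub>S"
    using emb.B.le_trans[OF that] x y sub[OF S(1)] by auto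
  then have "\<not> y \<sqsubseteq>\<^bsub>B\<^esub> \<Sqinter>\<^bsub>B\<^esub>S"
    using assms by (auto simp: emb.B.atom_le_atom_iff)
  then obtain s where s: "s \<in> S" "\<not> y \<sqsubseteq>\<^bsub>B\<^esub> s"
    using emb.B.atom_le_inf_iff[OF y sub[OF S(1)]] by blast
  moreover have "x \<sqsubseteq>\<^bsub>B\<^esub> s"
    using emb.B.atom_le_inf_iff[OF x sub[OF S(1)]] S(2) s(1) by blast
  moreover obtain a where "a \<in> carrier A" "s = \<alpha> a"
    using \<S>(1) S(1) s(1) by blast
  ultimately show thesis
    using assms by (intro that[of a]) (auto simp: basic_open_def atoms_below_def)
qed

lemma openin_atom_space:
  "openin (atom_space E) = arbitrary union_of (\<lambda>S. S \<in> U ` carrier A)"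
proof -
  have "S \<inter> T \<in> U ` carrier A" if "S \<in> U ` carrier A" "T \<in> U ` carrier A" for S T
    using that by (auto simp flip: U_meet)
  then show ?thesis
    unfolding atom_space_def by (intro topology_inverse' istopology_base)
qed

lemma openin_U: "a \<in> carrier A \<Longrightarrow> openin (atom_space E) (U a)"
  unfolding openin_atom_space by (rule arbitrary_union_of_inc) auto

lemma openin_atom_spaceE:
  assumes "openin (atom_space E) W" "x \<in> W"
  obtains a where "a \<in> carrier A" "x \<in> U a" "U a \<subseteq> W"
proof -
  obtain \<U> where "\<U> \<subseteq> U ` carrier A" "W = \<Union>\<U>"
    using assms(1) unfolding openin_atom_space union_of_def by auto
  then obtain a where "a \<in> carrier A" "x \<in> U a" "U a \<in> \<U>"
    using assms(2) by blast
  then show thesis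
    using that \<open>W = \<Union>\<U>\<close> by blast
qed

lemma topspace_atom_space: "topspace (atom_space E) = X"
proof
  show "X \<subseteq> topspace (atom_space E)"
    using openin_subset[OF openin_U[of "\<top>\<^bsub>A\<^esub>"]] by simp
  show "topspace (atom_space E) \<subseteq> X"
  proof
    fix x assume "x \<in> topspace (atom_space E)"
    then obtain a where "x \<in> U a"
      using openin_atom_spaceE[OF openin_topspace] by metis
    then show "x \<in> X"
      using U_subset by auto
  qed
qed

text \<open>If \<open>U a\<close> contains \<open>x\<close> but not \<open>y\<close>, then \<open>x\<close> lies in \<open>U c\<close> for some \<open>c \<prec> a\<close>. The closure of \<open>U c\<close> lies in
  \<open>U a\<close>, so its complement \<open>U (\<sim> c)\<close> contains \<open>y\<close>.\<close>

lemma Hausdorff_atom_space: "Hausdorff_space (atom_space E)"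
  unfolding Hausdorff_space_def
proof (intro allI impI)
  fix x y assume "x \<in> topspace (atom_space E) \<and> y \<in> topspace (atom_space E) \<and> x \<noteq> y"
  then have xy: "x \<in> X" "y \<in> X" "x \<noteq> y"
    by (auto simp: topspace_atom_space)
  then obtain a where a: "a \<in> carrier A" "x \<in> U a" "y \<notin> U a"
    using atoms_separated by metis
  then obtain c where c: "c \<in> carrier A" "c \<prec>\<^bsub>A\<^esub> a" "x \<in> U c"
    using U_eq_Union[of a] by (auto simp: prec_below_iff)
  then have "y \<in> U (\<sim>\<^bsub>A\<^esub> c)"
    using U_prec[of c a] a xy by auto
  then show "\<exists>V W. openin (atom_space E) V \<and> openin (atom_space E) W \<and> x \<in> V \<and> y \<in> W \<and> disjnt V W"
    using c by (intro exI[of _ "U c"] exI[of _ "U (\<sim>\<^bsub>A\<^esub> c)"])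
      (auto simp: openin_U disjnt_def U_complement_disjoint)
qed

text \<open>A set of atoms can be recovered from its join, so the power set of \<open>X\<close> embeds in \<open>B\<close>. Thus the space of
  atoms satisfies the size condition on the objects of \<open>KHaus\<close>.\<close>

lemma small_atoms: "Pow X \<lesssim> (UNIV :: 'b set)"
proof -
  have "inj_on (\<lambda>S. \<Squnion>\<^bsub>B\<^esub>S) (Pow X)"
    by (rule inj_on_inverseI[of _ "atoms_below B"]) (auto simp: emb.B.atoms_below_sup_atoms)
  then show ?thesis
    unfolding lepoll_def by blast
qed

end

locale compact_devries_extension = extension +
  assumes compact: "compact_extension E"
begin

lemma compactD:
  assumes "round_filter A F" "round_ideal A I" "{x \<in> X. \<forall>a \<in> F. x \<in> U a} \<subseteq> (\<Union>a \<in> I. U a)"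
  shows "F \<inter> I \<noteq> {}"
proof -
  have F: "\<alpha> ` F \<subseteq> carrier B" and I: "\<alpha> ` I \<subseteq> carrier B"
    using assms(1,2) emb.closed
    unfolding round_filter_def lattice_filter_def round_ideal_def lattice_ideal_def by blast+
  have "atoms_below B (\<Sqinter>\<^bsub>B\<^esub>(\<alpha> ` F)) \<subseteq> atoms_below B (\<Squnion>\<^bsub>B\<^esub>(\<alpha> ` I))"
    using assms(3) by (auto simp: emb.B.atoms_below_inf[OF F] emb.B.atoms_below_sup[OF I] basic_open_def)
  then have "\<Sqinter>\<^bsub>B\<^esub>(\<alpha> ` F) \<sqsubseteq>\<^bsub>B\<^esub> \<Squnion>\<^bsub>B\<^esub>(\<alpha> ` I)"
    using F I by (simp add: B.atoms_below_subset_iff)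
  then show ?thesis
    using compact assms(1,2) unfolding compact_extension_def by blast
qed

lemma round_ideal_prec_below:
  assumes "b \<in> carrier A"
  shows "round_ideal A (prec_below A b)"
  unfolding round_ideal_def lattice_ideal_def
proof (intro conjI ballI impI)
  show "prec_below A b \<subseteq> carrier A"
    by (rule prec_below_subset)
  show "prec_below A b \<noteq> {}"
    using emb.A.bottom_prec[OF assms] emb.A.bottom_carrier unfolding prec_below_def by blast
  show "c \<in> prec_below A b" if "d \<in> prec_below A b" "c \<in> carrier A" "c \<sqsubseteq>\<^bsub>A\<^esub> d" for c d
    using that assms emb.A.prec_mono_left by (auto simp: prec_below_iff)
  show "c \<squnion>\<^bsub>A\<^esub> d \<in> prec_below A b" if "c \<in> prec_below A b" "d \<in> prec_below A b" for c d
    using that assms emb.A.join_prec by (auto simp: prec_below_iff)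
  show "\<exists>d \<in> prec_below A b. c \<prec>\<^bsub>A\<^esub> d" if "c \<in> prec_below A b" for c
    using that assms emb.A.DV6[of c b] unfolding prec_below_def by blast
qed

lemma round_filter_prec_above:
  assumes "a \<in> carrier A"
  shows "round_filter A {b \<in> carrier A. a \<prec>\<^bsub>A\<^esub> b}"
  unfolding round_filter_def lattice_filter_def
proof (intro conjI ballI impI)
  show "{b \<in> carrier A. a \<prec>\<^bsub>A\<^esub> b} \<noteq> {}"
    using emb.A.prec_top[OF assms] emb.A.top_carrier by blast
  show "d \<in> {b \<in> carrier A. a \<prec>\<^bsub>A\<^esub> b}" if "c \<in> {b \<in> carrier A. a \<prec>\<^bsub>A\<^esub> b}" "d \<in> carrier A" "c \<sqsubseteq>\<^bsub>A\<^esub> d" for c d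
    using that assms emb.A.prec_mono_right by auto
  show "c \<sqinter>\<^bsub>A\<^esub> d \<in> {b \<in> carrier A. a \<prec>\<^bsub>A\<^esub> b}"
    if "c \<in> {b \<in> carrier A. a \<prec>\<^bsub>A\<^esub> b}" "d \<in> {b \<in> carrier A. a \<prec>\<^bsub>A\<^esub> b}" for c d
    using that assms emb.A.DV4 by auto
  show "\<exists>c \<in> {b \<in> carrier A. a \<prec>\<^bsub>A\<^esub> b}. c \<prec>\<^bsub>A\<^esub> d" if "d \<in> {b \<in> carrier A. a \<prec>\<^bsub>A\<^esub> b}" for d
    using that assms emb.A.DV6[of a d] by blast
qed auto

text \<open>If the closure of \<open>U a\<close> lies in \<open>U b\<close>, compactness applies to the filter of all elements well above
  \<open>a\<close> and the ideal of all elements well below \<open>b\<close>: the sets \<open>U c\<close> with \<open>a \<prec> c\<close> intersect in the closure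
  of \<open>U a\<close>, and those with \<open>c \<prec> b\<close> cover \<open>U b\<close>. A common element \<open>c\<close> satisfies \<open>a \<prec> c \<prec> b\<close>.\<close>

lemma prec_iff:
  assumes a: "a \<in> carrier A" and b: "b \<in> carrier A"
  shows "a \<prec>\<^bsub>A\<^esub> b \<longleftrightarrow> X - U (\<sim>\<^bsub>A\<^esub> a) \<subseteq> U b"
proof
  assume sub: "X - U (\<sim>\<^bsub>A\<^esub> a) \<subseteq> U b"
  have "{x \<in> X. \<forall>c \<in> {c \<in> carrier A. a \<prec>\<^bsub>A\<^esub> c}. x \<in> U c} \<subseteq> X - U (\<sim>\<^bsub>A\<^esub> a)"
  proof safe
    fix x assume x: "\<forall>c \<in> {c \<in> carrier A. a \<prec>\<^bsub>A\<^esub> c}. x \<in> U c" and "x \<in> U (\<sim>\<^bsub>A\<^esub> a)"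
    then obtain d where d: "d \<in> carrier A" "d \<prec>\<^bsub>A\<^esub> (\<sim>\<^bsub>A\<^esub> a)" "x \<in> U d"
      using U_eq_Union[of "\<sim>\<^bsub>A\<^esub> a"] a by (auto simp: prec_below_iff)
    then have "a \<prec>\<^bsub>A\<^esub> (\<sim>\<^bsub>A\<^esub> d)"
      using emb.A.DV5[of d "\<sim>\<^bsub>A\<^esub> a"] a by simp
    then show False
      using x d U_complement_disjoint[of d] by auto
  qed
  also have "\<dots> \<subseteq> (\<Union>c \<in> prec_below A b. U c)"
    using sub U_eq_Union[OF b] by simp
  finally obtain c where "c \<in> carrier A" "a \<prec>\<^bsub>A\<^esub> c" "c \<prec>\<^bsub>A\<^esub> b"
    using compactD[OF round_filter_prec_above[OF a] round_ideal_prec_below[OF b]]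
    by (auto simp: prec_below_iff)
  then show "a \<prec>\<^bsub>A\<^esub> b"
    using a b by (intro emb.A.prec_mono_right[of a c b] emb.A.prec_le)
qed (use assms U_prec in auto)

lemma in_U_complement_sup:
  assumes "finite D" "D \<subseteq> carrier A" "x \<in> X" "\<And>d. d \<in> D \<Longrightarrow> x \<in> U (\<sim>\<^bsub>A\<^esub> d)"
  shows "x \<in> U (\<sim>\<^bsub>A\<^esub> (\<Squnion>\<^bsub>A\<^esub>D))"
  using assms by (induction D) (auto simp: emb.A.sup_insert emb.A.complement_join U_meet)

text \<open>Compactness of the extension is applied to the trivial filter and to an ideal made from an open cover.
  The ideal consists of the elements below a finite join of elements \<open>e\<close>, each of which is well below
  some \<open>c\<close> such that \<open>U c\<close> lies in a member of the cover. It is round because each \<open>e\<close> can be enlarged by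
  interpolation. So \<open>\<top>\<close> is the join of finitely many such \<open>e\<close>. The sets \<open>U e\<close> themselves need not
  cover \<open>X\<close>, but their closures do, by \<open>in_U_complement_sup\<close>, and the closure of \<open>U e\<close> lies in \<open>U c\<close>.\<close>

lemma compact_atom_space: "compact_space (atom_space E)"
  unfolding compact_space_alt topspace_atom_space
proof (intro allI impI)
  fix \<W> assume "(\<forall>W \<in> \<W>. openin (atom_space E) W) \<and> X \<subseteq> \<Union>\<W>"
  then have op: "\<And>W. W \<in> \<W> \<Longrightarrow> openin (atom_space E) W" and cover: "X \<subseteq> \<Union>\<W>"
    by auto
  define C where "C = {e \<in> carrier A. \<exists>c \<in> carrier A. \<exists>W \<in> \<W>. e \<prec>\<^bsub>A\<^esub> c \<and> U c \<subseteq> W}"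
  define I where "I = {d \<in> carrier A. \<exists>D. finite D \<and> D \<subseteq> C \<and> d \<sqsubseteq>\<^bsub>A\<^esub> \<Squnion>\<^bsub>A\<^esub>D}"
  have C: "C \<subseteq> carrier A"
    by (auto simp: C_def)
  have supC: "\<Squnion>\<^bsub>A\<^esub>D \<in> carrier A" if "D \<subseteq> C" for D
    using that C by (intro emb.A.weak.sup_closed) auto
  have "round_ideal A I"
    unfolding round_ideal_def lattice_ideal_def
  proof (intro conjI ballI impI)
    show "I \<subseteq> carrier A"
      by (auto simp: I_def)
    have "\<bottom>\<^bsub>A\<^esub> \<in> I"
      by (auto simp: I_def intro!: exI[of _ "{}"])
    then show "I \<noteq> {}"
      by auto
    show "a \<in> I" if "b \<in> I" "a \<in> carrier A" "a \<sqsubseteq>\<^bsub>A\<^esub> b" for a b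
    proof -
      obtain D where D: "finite D" "D \<subseteq> C" "b \<sqsubseteq>\<^bsub>A\<^esub> \<Squnion>\<^bsub>A\<^esub>D" "b \<in> carrier A"
        using \<open>b \<in> I\<close> by (auto simp: I_def)
      then have "a \<sqsubseteq>\<^bsub>A\<^esub> \<Squnion>\<^bsub>A\<^esub>D"
        using that supC[of D] emb.A.le_trans[of a b "\<Squnion>\<^bsub>A\<^esub>D"] by blast
      then show ?thesis
        using D that unfolding I_def by blast
    qed
    show "a \<squnion>\<^bsub>A\<^esub> b \<in> I" if ab: "a \<in> I" "b \<in> I" for a b
    proof -
      obtain D D' where D: "finite D" "D \<subseteq> C" "a \<sqsubseteq>\<^bsub>A\<^esub> \<Squnion>\<^bsub>A\<^esub>D" and D': "finite D'" "D' \<subseteq> C" "b \<sqsubseteq>\<^bsub>A\<^esub> \<Squnion>\<^bsub>A\<^esub>D'"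
        and car: "a \<in> carrier A" "b \<in> carrier A"
        using ab by (auto simp: I_def)
      have mono: "\<Squnion>\<^bsub>A\<^esub>D \<sqsubseteq>\<^bsub>A\<^esub> \<Squnion>\<^bsub>A\<^esub>(D \<union> D')" "\<Squnion>\<^bsub>A\<^esub>D' \<sqsubseteq>\<^bsub>A\<^esub> \<Squnion>\<^bsub>A\<^esub>(D \<union> D')"
        using D(2) D'(2) C by (auto intro!: emb.A.sup_mono)
      have "a \<sqsubseteq>\<^bsub>A\<^esub> \<Squnion>\<^bsub>A\<^esub>(D \<union> D')" "b \<sqsubseteq>\<^bsub>A\<^esub> \<Squnion>\<^bsub>A\<^esub>(D \<union> D')"
        using emb.A.le_trans[OF D(3) mono(1)] emb.A.le_trans[OF D'(3) mono(2)]
          D D' car supC[of D] supC[of D'] supC[of "D \<union> D'"] by auto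
      then have "a \<squnion>\<^bsub>A\<^esub> b \<sqsubseteq>\<^bsub>A\<^esub> \<Squnion>\<^bsub>A\<^esub>(D \<union> D')"
        using D D' car supC[of "D \<union> D'"] by (intro emb.A.join_le) auto
      then show ?thesis
        using D(1,2) D'(1,2) car emb.A.join_closed[of a b] unfolding I_def
        by (intro CollectI conjI exI[of _ "D \<union> D'"]) auto
    qed
    show "\<exists>b \<in> I. a \<prec>\<^bsub>A\<^esub> b" if a: "a \<in> I" for a
    proof -
      obtain D where D: "finite D" "D \<subseteq> C" "a \<sqsubseteq>\<^bsub>A\<^esub> \<Squnion>\<^bsub>A\<^esub>D" and car: "a \<in> carrier A"
        using a by (auto simp: I_def)
      have "\<forall>e \<in> D. \<exists>e' \<in> C. e \<prec>\<^bsub>A\<^esub> e'"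
        using D(2) emb.A.DV6 unfolding C_def by blast
      then obtain g where g: "\<And>e. e \<in> D \<Longrightarrow> g e \<in> C \<and> e \<prec>\<^bsub>A\<^esub> g e"
        by metis
      have gD: "g ` D \<subseteq> C"
        using g by auto
      have "e \<prec>\<^bsub>A\<^esub> \<Squnion>\<^bsub>A\<^esub>(g ` D)" if "e \<in> D" for e
      proof (rule emb.A.prec_mono_right[of e "g e"])
        show "g e \<sqsubseteq>\<^bsub>A\<^esub> \<Squnion>\<^bsub>A\<^esub>(g ` D)"
          using that gD C by (intro emb.A.sup_upper) auto
      qed (use that g[OF that] D(2) C supC[OF gD] in auto)
      then have "\<Squnion>\<^bsub>A\<^esub>D \<prec>\<^bsub>A\<^esub> \<Squnion>\<^bsub>A\<^esub>(g ` D)"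
        using D C supC[OF gD] by (intro emb.A.sup_prec) auto
      then have "a \<prec>\<^bsub>A\<^esub> \<Squnion>\<^bsub>A\<^esub>(g ` D)"
        using D(2,3) car supC[OF gD] supC[of D] emb.A.prec_mono_left[of a "\<Squnion>\<^bsub>A\<^esub>D"] by blast
      moreover have "\<Squnion>\<^bsub>A\<^esub>(g ` D) \<in> I"
        using D(1) gD supC[OF gD] unfolding I_def
        by (intro CollectI conjI exI[of _ "g ` D"]) auto
      ultimately show ?thesis
        by blast
    qed
  qed
  moreover have "round_filter A {\<top>\<^bsub>A\<^esub>}"
    using emb.A.DV1 by (auto simp: round_filter_def lattice_filter_def emb.A.top_le_iff)
  moreover have "{x \<in> X. \<forall>a \<in> {\<top>\<^bsub>A\<^esub>}. x \<in> U a} \<subseteq> (\<Union>a \<in> I. U a)"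
  proof safe
    fix x assume "x \<in> X"
    then obtain W where W: "W \<in> \<W>" "x \<in> W"
      using cover by auto
    then obtain c where c: "c \<in> carrier A" "x \<in> U c" "U c \<subseteq> W"
      using op openin_atom_spaceE by metis
    then obtain e where e: "e \<in> carrier A" "e \<prec>\<^bsub>A\<^esub> c" "x \<in> U e"
      using U_eq_Union[of c] by (auto simp: prec_below_iff)
    then have "e \<in> C"
      using c W by (auto simp: C_def)
    then have "e \<in> I"
      using e by (auto simp: I_def intro!: exI[of _ "{e}"])
    then show "x \<in> (\<Union>a \<in> I. U a)"
      using e by auto
  qed
  ultimately have "\<top>\<^bsub>A\<^esub> \<in> I"
    using compactD by blast
  then obtain D where D: "finite D" "D \<subseteq> C" "\<Squnion>\<^bsub>A\<^esub>D = \<top>\<^bsub>A\<^esub>"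
    using supC emb.A.top_le_iff unfolding I_def by blast
  have "\<forall>e \<in> D. \<exists>W \<in> \<W>. X - U (\<sim>\<^bsub>A\<^esub> e) \<subseteq> W"
  proof
    fix e assume "e \<in> D"
    then obtain c W where "e \<in> carrier A" "c \<in> carrier A" "W \<in> \<W>" "e \<prec>\<^bsub>A\<^esub> c" "U c \<subseteq> W"
      using D(2) unfolding C_def by blast
    then show "\<exists>W \<in> \<W>. X - U (\<sim>\<^bsub>A\<^esub> e) \<subseteq> W"
      using U_prec[of e c] by blast
  qed
  then obtain w where w: "\<And>e. e \<in> D \<Longrightarrow> w e \<in> \<W> \<and> X - U (\<sim>\<^bsub>A\<^esub> e) \<subseteq> w e"
    by metis
  have "X \<subseteq> \<Union>(w ` D)"
  proof
    fix x assume x: "x \<in> X"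
    have "x \<notin> U (\<sim>\<^bsub>A\<^esub> (\<Squnion>\<^bsub>A\<^esub>D))"
      using D(3) by simp
    then obtain e where "e \<in> D" "x \<notin> U (\<sim>\<^bsub>A\<^esub> e)"
      using in_U_complement_sup[OF D(1) _ x] D(2) C by auto
    then show "x \<in> \<Union>(w ` D)"
      using w x by auto
  qed
  then show "\<exists>\<F>. finite \<F> \<and> \<F> \<subseteq> \<W> \<and> X \<subseteq> \<Union>\<F>"
    using D(1) w by (intro exI[of _ "w ` D"]) auto
qed

end

section \<open>Morphisms of extensions and continuous maps\<close>

text \<open>The function on atoms of which \<open>\<sigma>\<close> is the preimage map. The atom \<open>y\<close> is unique because \<open>\<sigma>\<close> maps the
  atoms of \<open>B\<close> to pairwise disjoint elements with join \<open>\<top>\<close>.\<close>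

definition atom_map :: "('a, 'c) gorder_scheme \<Rightarrow> ('b, 'd) gorder_scheme \<Rightarrow> ('a \<Rightarrow> 'b) \<Rightarrow> 'b \<Rightarrow> 'a" where
  "atom_map B B' \<sigma> = (\<lambda>x \<in> atoms B'. THE y. y \<in> atoms B \<and> x \<sqsubseteq>\<^bsub>B'\<^esub> \<sigma> y)"

lemma atom_map_extensional: "atom_map B B' \<sigma> \<in> extensional (atoms B')"
  by (simp add: atom_map_def)

locale atomic_pair = B: atomic_complete_boolean_algebra B + B': atomic_complete_boolean_algebra B'
  for B :: "('a, 'c) gorder_scheme" and B' :: "('b, 'd) gorder_scheme"
begin

lemma atom_map_props:
  assumes \<sigma>: "complete_boolean_hom B B' \<sigma>" and x: "x \<in> atoms B'"
  shows "atom_map B B' \<sigma> x \<in> atoms B"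
    and "b \<in> carrier B \<Longrightarrow> x \<in> atoms_below B' (\<sigma> b) \<longleftrightarrow> atom_map B B' \<sigma> x \<in> atoms_below B b"
proof -
  have x': "x \<in> carrier B'"
    using x B'.atoms_carrier by auto
  have im: "\<sigma> ` S \<subseteq> carrier B'" if "S \<subseteq> carrier B" for S
    using complete_boolean_homE(1)[OF \<sigma>] that by (auto simp: PiE_iff)
  have sup: "x \<sqsubseteq>\<^bsub>B'\<^esub> \<sigma> b \<longleftrightarrow> (\<exists>y \<in> atoms_below B b. x \<sqsubseteq>\<^bsub>B'\<^esub> \<sigma> y)" if b: "b \<in> carrier B" for b
  proof -
    have sub: "atoms_below B b \<subseteq> carrier B"
      using atoms_below_subset B.atoms_carrier by (rule order_trans)
    have "\<sigma> b = \<Squnion>\<^bsub>B'\<^esub>(\<sigma> ` atoms_below B b)"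
      using complete_boolean_homE(2)[OF \<sigma> sub] b by (simp add: B.sup_atoms_below)
    then show ?thesis
      using B'.atom_le_sup_iff[OF x im[OF sub]] by auto
  qed
  have "\<sigma> \<top>\<^bsub>B\<^esub> = \<top>\<^bsub>B'\<^esub>" "\<sigma> \<bottom>\<^bsub>B\<^esub> = \<bottom>\<^bsub>B'\<^esub>"
    using complete_boolean_homE(2,3)[OF \<sigma>, of "{}"] by auto
  then obtain y where y: "y \<in> atoms B" "x \<sqsubseteq>\<^bsub>B'\<^esub> \<sigma> y"
    using sup[of "\<top>\<^bsub>B\<^esub>"] x' by auto
  have uniq: "z = y" if z: "z \<in> atoms B" "x \<sqsubseteq>\<^bsub>B'\<^esub> \<sigma> z" for z
  proof (rule ccontr)
    assume "z \<noteq> y"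
    have zy: "{z, y} \<subseteq> carrier B"
      using z y B.atoms_carrier by auto
    then have "z \<sqinter>\<^bsub>B\<^esub> y = \<bottom>\<^bsub>B\<^esub>"
      using B.atom_le_or_disjoint[OF z(1), of y] \<open>z \<noteq> y\<close> z y by (simp add: B.atom_le_atom_iff)
    then have "\<bottom>\<^bsub>B'\<^esub> = \<Sqinter>\<^bsub>B'\<^esub>(\<sigma> ` {z, y})"
      using complete_boolean_homE(3)[OF \<sigma> zy] \<open>\<sigma> \<bottom>\<^bsub>B\<^esub> = \<bottom>\<^bsub>B'\<^esub>\<close> by (simp add: meet_def)
    then have "x \<sqsubseteq>\<^bsub>B'\<^esub> \<bottom>\<^bsub>B'\<^esub>"
      using B'.atom_le_inf_iff[OF x' im[OF zy]] z y by auto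
    then show False
      using x x' by (auto simp: B'.le_bottom_iff atoms_def lattice_atom_def)
  qed
  have eq: "atom_map B B' \<sigma> x = y"
  proof -
    have "(THE z. z \<in> atoms B \<and> x \<sqsubseteq>\<^bsub>B'\<^esub> \<sigma> z) = y"
      by (rule the_equality) (use y uniq in blast)+
    then show ?thesis
      using x by (simp add: atom_map_def)
  qed
  show "atom_map B B' \<sigma> x \<in> atoms B"
    using eq y by simp
  show "x \<in> atoms_below B' (\<sigma> b) \<longleftrightarrow> atom_map B B' \<sigma> x \<in> atoms_below B b" if "b \<in> carrier B"
  proof -
    have "x \<in> atoms_below B' (\<sigma> b) \<longleftrightarrow> (\<exists>z \<in> atoms_below B b. x \<sqsubseteq>\<^bsub>B'\<^esub> \<sigma> z)"
      using sup[OF that] x by (simp add: atoms_below_def)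
    also have "\<dots> \<longleftrightarrow> y \<in> atoms_below B b"
    proof
      assume "\<exists>z \<in> atoms_below B b. x \<sqsubseteq>\<^bsub>B'\<^esub> \<sigma> z"
      then obtain z where z: "z \<in> atoms_below B b" "x \<sqsubseteq>\<^bsub>B'\<^esub> \<sigma> z"
        by auto
      with uniq[of z] show "y \<in> atoms_below B b"
        by (simp add: atoms_below_def)
    qed (use y(2) in blast)
    finally show ?thesis
      unfolding eq .
  qed
qed

lemma atoms_below_hom:
  assumes "complete_boolean_hom B B' \<sigma>" "b \<in> carrier B"
  shows "atoms_below B' (\<sigma> b) = {x \<in> atoms B'. atom_map B B' \<sigma> x \<in> atoms_below B b}"
  using atoms_below_subset[of B' "\<sigma> b"] by (auto simp: atom_map_props(2)[OF assms(1) _ assms(2)])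

lemma atom_map_eqI:
  assumes \<sigma>: "complete_boolean_hom B B' \<sigma>"
    and f: "f \<in> atoms B' \<rightarrow>\<^sub>E atoms B"
    and eq: "\<And>y. y \<in> atoms B \<Longrightarrow> atoms_below B' (\<sigma> y) = {x \<in> atoms B'. f x = y}"
  shows "atom_map B B' \<sigma> = f"
proof (rule extensionalityI[OF atom_map_extensional])
  show "f \<in> extensional (atoms B')"
    using f by (simp add: PiE_def)
  fix x assume x: "x \<in> atoms B'"
  then have fx: "f x \<in> atoms B" "f x \<in> carrier B"
    using f B.atoms_carrier by auto
  then have "atom_map B B' \<sigma> x \<in> atoms_below B (f x)"
    using atom_map_props(2)[OF \<sigma> x, of "f x"] eq[of "f x"] x by auto
  then show "atom_map B B' \<sigma> x = f x"
    using fx by (auto simp: atoms_below_def B.atom_le_atom_iff)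
qed

text \<open>The preimage map of a function \<open>f\<close> on atoms, read as a map from \<open>B\<close> to \<open>B'\<close>.\<close>

definition hom_of_map :: "('b \<Rightarrow> 'a) \<Rightarrow> 'a \<Rightarrow> 'b" where
  "hom_of_map f = (\<lambda>b \<in> carrier B. \<Squnion>\<^bsub>B'\<^esub>{x \<in> atoms B'. f x \<in> atoms_below B b})"

lemma hom_of_map_closed: "b \<in> carrier B \<Longrightarrow> hom_of_map f b \<in> carrier B'"
  using B'.atoms_carrier by (auto simp: hom_of_map_def intro!: B'.weak.sup_closed)

lemma atoms_below_hom_of_map:
  "b \<in> carrier B \<Longrightarrow> atoms_below B' (hom_of_map f b) = {x \<in> atoms B'. f x \<in> atoms_below B b}"
  by (simp add: hom_of_map_def B'.atoms_below_sup_atoms)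

lemma hom_of_map_complete_boolean_hom:
  assumes f: "f \<in> atoms B' \<rightarrow> atoms B"
  shows "complete_boolean_hom B B' (hom_of_map f)"
  unfolding complete_boolean_hom_def
proof (intro conjI allI ballI impI)
  show "hom_of_map f \<in> carrier B \<rightarrow>\<^sub>E carrier B'"
    using hom_of_map_closed by (auto simp: hom_of_map_def)
  have im: "hom_of_map f ` S \<subseteq> carrier B'" if "S \<subseteq> carrier B" for S
    using that hom_of_map_closed by auto
  fix S assume S: "S \<subseteq> carrier B"
  have ab: "\<And>s. s \<in> S \<Longrightarrow> atoms_below B' (hom_of_map f s) = {x \<in> atoms B'. f x \<in> atoms_below B s}"
    using S by (auto simp: atoms_below_hom_of_map)
  show "hom_of_map f (\<Squnion>\<^bsub>B\<^esub>S) = \<Squnion>\<^bsub>B'\<^esub>(hom_of_map f ` S)"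
  proof (rule B'.atoms_below_inject)
    show "atoms_below B' (hom_of_map f (\<Squnion>\<^bsub>B\<^esub>S)) = atoms_below B' (\<Squnion>\<^bsub>B'\<^esub>(hom_of_map f ` S))"
      using S im[OF S] by (auto simp: atoms_below_hom_of_map B.atoms_below_sup B'.atoms_below_sup ab)
  qed (use S im[OF S] in \<open>auto intro: hom_of_map_closed\<close>)
  show "hom_of_map f (\<Sqinter>\<^bsub>B\<^esub>S) = \<Sqinter>\<^bsub>B'\<^esub>(hom_of_map f ` S)"
  proof (rule B'.atoms_below_inject)
    show "atoms_below B' (hom_of_map f (\<Sqinter>\<^bsub>B\<^esub>S)) = atoms_below B' (\<Sqinter>\<^bsub>B'\<^esub>(hom_of_map f ` S))"
      using S im[OF S] f by (auto simp: atoms_below_hom_of_map B.atoms_below_inf B'.atoms_below_inf ab)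
  qed (use S im[OF S] in \<open>auto intro: hom_of_map_closed\<close>)
next
  fix b assume b: "b \<in> carrier B"
  show "hom_of_map f (\<sim>\<^bsub>B\<^esub> b) = (\<sim>\<^bsub>B'\<^esub> hom_of_map f b)"
  proof (rule B'.atoms_below_inject)
    show "atoms_below B' (hom_of_map f (\<sim>\<^bsub>B\<^esub> b)) = atoms_below B' (\<sim>\<^bsub>B'\<^esub> hom_of_map f b)"
      using b f by (auto simp: atoms_below_hom_of_map B.atoms_below_complement
          B'.atoms_below_complement hom_of_map_closed)
  qed (use b in \<open>simp_all add: hom_of_map_closed\<close>)
qed

lemma atom_map_hom_of_map:
  assumes f: "f \<in> atoms B' \<rightarrow>\<^sub>E atoms B"
  shows "atom_map B B' (hom_of_map f) = f"
proof (rule atom_map_eqI[OF hom_of_map_complete_boolean_hom f])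
  fix y assume y: "y \<in> atoms B"
  then have "y \<in> carrier B"
    using B.atoms_carrier by auto
  then have "atoms_below B' (hom_of_map f y) = {x \<in> atoms B'. f x \<in> atoms_below B y}"
    by (rule atoms_below_hom_of_map)
  also have "\<dots> = {x \<in> atoms B'. f x = y}"
    using f y by (auto simp: atoms_below_def B.atom_le_atom_iff)
  finally show "atoms_below B' (hom_of_map f y) = {x \<in> atoms B'. f x = y}" .
qed (use f in auto)

end

context extension
begin

text \<open>For an open set \<open>W\<close>, the set \<open>U (interior_sup W)\<close> is the interior of the closure of \<open>W\<close>.\<close>

definition interior_sup :: "'b set \<Rightarrow> 'a" where
  "interior_sup W = \<Squnion>\<^bsub>A\<^esub>{c \<in> carrier A. U c \<subseteq> W}"

lemma interior_sup_closed [simp]: "interior_sup W \<in> carrier A"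
  by (auto simp: interior_sup_def intro!: emb.A.weak.sup_closed)

lemma le_interior_sup: "\<lbrakk>c \<in> carrier A; U c \<subseteq> W\<rbrakk> \<Longrightarrow> c \<sqsubseteq>\<^bsub>A\<^esub> interior_sup W"
  by (auto simp: interior_sup_def intro!: emb.A.sup_upper)

lemma interior_sup_le:
  "\<lbrakk>a \<in> carrier A; \<And>c. \<lbrakk>c \<in> carrier A; U c \<subseteq> W\<rbrakk> \<Longrightarrow> c \<sqsubseteq>\<^bsub>A\<^esub> a\<rbrakk> \<Longrightarrow> interior_sup W \<sqsubseteq>\<^bsub>A\<^esub> a"
  unfolding interior_sup_def by (rule emb.A.sup_least) auto

lemma subset_U_interior_sup:
  assumes "openin (atom_space E) W"
  shows "W \<subseteq> U (interior_sup W)"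
proof
  fix x assume "x \<in> W"
  then obtain a where a: "a \<in> carrier A" "x \<in> U a" "U a \<subseteq> W"
    using assms openin_atom_spaceE by metis
  then have "U a \<subseteq> U (interior_sup W)"
    by (simp add: U_subset_iff le_interior_sup)
  then show "x \<in> U (interior_sup W)"
    using a by auto
qed

lemma interior_sup_U: "a \<in> carrier A \<Longrightarrow> interior_sup (U a) = a"
  by (rule emb.A.le_antisym) (auto intro: interior_sup_le le_interior_sup simp: U_subset_iff)

lemma interior_sup_Int: "interior_sup (V \<inter> W) = interior_sup V \<sqinter>\<^bsub>A\<^esub> interior_sup W"
proof (rule emb.A.le_antisym)
  show "interior_sup (V \<inter> W) \<sqsubseteq>\<^bsub>A\<^esub> interior_sup V \<sqinter>\<^bsub>A\<^esub> interior_sup W"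
    by (intro interior_sup_le emb.A.meet_le le_interior_sup) auto
  show "interior_sup V \<sqinter>\<^bsub>A\<^esub> interior_sup W \<sqsubseteq>\<^bsub>A\<^esub> interior_sup (V \<inter> W)"
    unfolding interior_sup_def[of V] interior_sup_def[of W]
  proof (rule emb.A.sup_meet_sup_le)
    fix c d
    assume "c \<in> {c \<in> carrier A. U c \<subseteq> V}" "d \<in> {c \<in> carrier A. U c \<subseteq> W}"
    then show "c \<sqinter>\<^bsub>A\<^esub> d \<sqsubseteq>\<^bsub>A\<^esub> interior_sup (V \<inter> W)"
      by (intro le_interior_sup) (auto simp: U_meet)
  qed auto
qed auto

end

locale extension_pair = E: extension E + E': extension E'
  for E :: "('a, 'b) extension" and E' :: "('c, 'd) extension"
begin

sublocale atomic_pair E.B E'.B ..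

text \<open>The equation \<open>\<sigma> \<circ> \<alpha> = \<alpha>' \<star> \<rho>\<close>, read on atoms.\<close>

lemma preimage_U:
  assumes "extension_morphism E E' \<rho> \<sigma>" "a \<in> carrier E.A"
  shows "{x \<in> E'.X. atom_map E.B E'.B \<sigma> x \<in> E.U a} = (\<Union>c \<in> prec_below E.A a. E'.U (\<rho> c))"
proof -
  interpret r: devries_hom E.A E'.A \<rho>
    by unfold_locales (use assms in \<open>simp add: extension_morphism_def\<close>)
  have \<sigma>: "complete_boolean_hom E.B E'.B \<sigma>"
    using assms by (simp add: extension_morphism_def)
  have "\<sigma> (E.\<alpha> a) = devries_comp E.A E'.B E'.\<alpha> \<rho> a"
    using assms unfolding extension_morphism_def by (metis compose_eq)
  also have "\<dots> = \<Squnion>\<^bsub>E'.B\<^esub>((\<lambda>c. E'.\<alpha> (\<rho> c)) ` prec_below E.A a)"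
    using assms by (simp add: devries_comp_apply)
  finally have \<sigma>\<alpha>: "\<sigma> (E.\<alpha> a) = \<Squnion>\<^bsub>E'.B\<^esub>((\<lambda>c. E'.\<alpha> (\<rho> c)) ` prec_below E.A a)" .
  have sub: "(\<lambda>c. E'.\<alpha> (\<rho> c)) ` prec_below E.A a \<subseteq> carrier E'.B"
    by (auto simp: prec_below_iff)
  have "atoms_below E'.B (\<sigma> (E.\<alpha> a)) = (\<Union>c \<in> prec_below E.A a. E'.U (\<rho> c))"
    unfolding \<sigma>\<alpha> E'.emb.B.atoms_below_sup[OF sub] by (simp add: basic_open_def)
  then show ?thesis
    using atoms_below_hom[OF \<sigma>, of "E.\<alpha> a"] assms by (simp add: basic_open_def)
qed

lemma continuous_atom_map:
  assumes "extension_morphism E E' \<rho> \<sigma>"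
  shows "continuous_map (atom_space E') (atom_space E) (atom_map E.B E'.B \<sigma>)"
proof -
  interpret r: devries_hom E.A E'.A \<rho>
    by unfold_locales (use assms in \<open>simp add: extension_morphism_def\<close>)
  have \<sigma>: "complete_boolean_hom E.B E'.B \<sigma>"
    using assms by (simp add: extension_morphism_def)
  show ?thesis
    unfolding continuous_map_def E.topspace_atom_space E'.topspace_atom_space
  proof (intro conjI allI impI)
    show "atom_map E.B E'.B \<sigma> \<in> E'.X \<rightarrow> E.X"
      using atom_map_props(1)[OF \<sigma>] by auto
    fix W assume W: "openin (atom_space E) W"
    show "openin (atom_space E') {x \<in> E'.X. atom_map E.B E'.B \<sigma> x \<in> W}"
    proof (subst openin_subopen, safe)
      fix x assume x: "x \<in> E'.X" "atom_map E.B E'.B \<sigma> x \<in> W"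
      then obtain a where a: "a \<in> carrier E.A" "atom_map E.B E'.B \<sigma> x \<in> E.U a" "E.U a \<subseteq> W"
        using W E.openin_atom_spaceE by metis
      have "openin (atom_space E') (\<Union>c \<in> prec_below E.A a. E'.U (\<rho> c))"
        by (auto simp: prec_below_iff intro!: E'.openin_U)
      then have "openin (atom_space E') {x \<in> E'.X. atom_map E.B E'.B \<sigma> x \<in> E.U a}"
        by (simp only: preimage_U[OF assms a(1)])
      then show "\<exists>T. openin (atom_space E') T \<and> x \<in> T \<and> T \<subseteq> {x \<in> E'.X. atom_map E.B E'.B \<sigma> x \<in> W}"
        using a x by (intro exI[of _ "{x \<in> E'.X. atom_map E.B E'.B \<sigma> x \<in> E.U a}"]) auto
    qed
  qed
qed

text \<open>By (M4), \<open>\<rho> a\<close> is the join of the elements \<open>\<rho> c\<close> with \<open>c \<prec> a\<close>, and all sets \<open>U' (\<rho> c)\<close> lie in the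
  preimage of \<open>U a\<close>. Conversely, if \<open>U' c\<close> lies in this preimage, it lies in \<open>U' (\<rho> a)\<close>.\<close>

lemma morphism_eq_interior_sup:
  assumes "extension_morphism E E' \<rho> \<sigma>" "a \<in> carrier E.A"
  shows "\<rho> a = E'.interior_sup {x \<in> E'.X. atom_map E.B E'.B \<sigma> x \<in> E.U a}"
proof -
  interpret r: devries_hom E.A E'.A \<rho>
    by unfold_locales (use assms in \<open>simp add: extension_morphism_def\<close>)
  show ?thesis
  proof (rule E'.emb.A.le_antisym)
    have "\<Squnion>\<^bsub>E'.A\<^esub>(\<rho> ` prec_below E.A a) \<sqsubseteq>\<^bsub>E'.A\<^esub> E'.interior_sup (\<Union>c \<in> prec_below E.A a. E'.U (\<rho> c))"
      using r.image_subset by (intro E'.emb.A.sup_least) (auto simp: prec_below_iff intro!: E'.le_interior_sup)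
    then show "\<rho> a \<sqsubseteq>\<^bsub>E'.A\<^esub> E'.interior_sup {x \<in> E'.X. atom_map E.B E'.B \<sigma> x \<in> E.U a}"
      using assms by (simp add: preimage_U r.map_eq_sup[of a])
    show "E'.interior_sup {x \<in> E'.X. atom_map E.B E'.B \<sigma> x \<in> E.U a} \<sqsubseteq>\<^bsub>E'.A\<^esub> \<rho> a"
      unfolding preimage_U[OF assms]
    proof (rule E'.interior_sup_le)
      fix c assume c: "c \<in> carrier E'.A" "E'.U c \<subseteq> (\<Union>c \<in> prec_below E.A a. E'.U (\<rho> c))"
      have "E'.U (\<rho> d) \<subseteq> E'.U (\<rho> a)" if "d \<in> prec_below E.A a" for d
        using that assms(2) by (simp add: prec_below_iff E'.U_subset_iff r.map_mono E.emb.A.prec_le)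
      then have "E'.U c \<subseteq> E'.U (\<rho> a)"
        using c(2) by blast
      then show "c \<sqsubseteq>\<^bsub>E'.A\<^esub> \<rho> a"
        using c(1) assms(2) by (simp add: E'.U_subset_iff)
    qed (use assms in auto)
  qed (use assms in auto)
qed

lemma atom_map_faithful:
  assumes 1: "extension_morphism E E' \<rho>\<^sub>1 \<sigma>\<^sub>1" and 2: "extension_morphism E E' \<rho>\<^sub>2 \<sigma>\<^sub>2"
    and eq: "atom_map E.B E'.B \<sigma>\<^sub>1 = atom_map E.B E'.B \<sigma>\<^sub>2"
  shows "\<rho>\<^sub>1 = \<rho>\<^sub>2" "\<sigma>\<^sub>1 = \<sigma>\<^sub>2"
proof -
  have \<rho>: "\<rho>\<^sub>1 \<in> carrier E.A \<rightarrow>\<^sub>E carrier E'.A" "\<rho>\<^sub>2 \<in> carrier E.A \<rightarrow>\<^sub>E carrier E'.A"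
    using 1 2 by (auto simp: extension_morphism_def devries_morphism_def)
  have \<sigma>: "complete_boolean_hom E.B E'.B \<sigma>\<^sub>1" "complete_boolean_hom E.B E'.B \<sigma>\<^sub>2"
    using 1 2 by (auto simp: extension_morphism_def)
  note \<sigma>' = \<sigma>[THEN complete_boolean_homE(1)]
  show "\<rho>\<^sub>1 = \<rho>\<^sub>2"
    using \<rho> morphism_eq_interior_sup[OF 1] morphism_eq_interior_sup[OF 2] eq
    by (intro extensionalityI[of _ "carrier E.A"]) (auto simp: PiE_def)
  show "\<sigma>\<^sub>1 = \<sigma>\<^sub>2"
  proof (rule PiE_ext[OF \<sigma>'])
    fix b assume b: "b \<in> carrier E.B"
    show "\<sigma>\<^sub>1 b = \<sigma>\<^sub>2 b"
    proof (rule E'.B.atoms_below_inject)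
      show "atoms_below E'.B (\<sigma>\<^sub>1 b) = atoms_below E'.B (\<sigma>\<^sub>2 b)"
        using b eq \<sigma> by (simp add: atoms_below_hom)
    qed (use b \<sigma>' in auto)
  qed
qed

end

text \<open>Every continuous map \<open>f\<close> comes from a morphism. The formula for its first component is forced by
  \<open>morphism_eq_interior_sup\<close>.\<close>

locale extension_map = E: extension E + E': compact_devries_extension E'
  for E :: "('a, 'b) extension" and E' :: "('c, 'd) extension" +
  fixes f :: "'d \<Rightarrow> 'b"
  assumes continuous: "continuous_map (atom_space E') (atom_space E) f"
begin

sublocale extension_pair E E' ..

abbreviation preimage where "preimage a \<equiv> {x \<in> E'.X. f x \<in> E.U a}"

lemma f_closed: "x \<in> E'.X \<Longrightarrow> f x \<in> E.X"
  using continuous continuous_map_image_subset_topspace[of "atom_space E'" "atom_space E" f]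
  by (auto simp: E.topspace_atom_space E'.topspace_atom_space)

lemma openin_preimage: "a \<in> carrier E.A \<Longrightarrow> openin (atom_space E') (preimage a)"
  using openin_continuous_map_preimage[OF continuous E.openin_U[of a]]
  by (simp add: E'.topspace_atom_space)

definition dual_morphism :: "'a \<Rightarrow> 'c" where
  "dual_morphism = (\<lambda>a \<in> carrier E.A. E'.interior_sup (preimage a))"

lemma dual_morphism_closed [simp]: "a \<in> carrier E.A \<Longrightarrow> dual_morphism a \<in> carrier E'.A"
  by (simp add: dual_morphism_def)

lemma preimage_subset: "a \<in> carrier E.A \<Longrightarrow> preimage a \<subseteq> E'.U (dual_morphism a)"
  using E'.subset_U_interior_sup[OF openin_preimage] by (simp add: dual_morphism_def)

lemma dual_morphism_bottom: "dual_morphism \<bottom>\<^bsub>E.A\<^esub> = \<bottom>\<^bsub>E'.A\<^esub>"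
  using E'.interior_sup_U[of "\<bottom>\<^bsub>E'.A\<^esub>"] by (simp add: dual_morphism_def)

lemma dual_morphism_meet:
  assumes "a \<in> carrier E.A" "b \<in> carrier E.A"
  shows "dual_morphism (a \<sqinter>\<^bsub>E.A\<^esub> b) = dual_morphism a \<sqinter>\<^bsub>E'.A\<^esub> dual_morphism b"
proof -
  have "preimage (a \<sqinter>\<^bsub>E.A\<^esub> b) = preimage a \<inter> preimage b"
    using assms by (auto simp: E.U_meet)
  then show ?thesis
    using assms by (simp add: dual_morphism_def E'.interior_sup_Int)
qed

text \<open>The sets given by the images of \<open>a\<close> and \<open>\<sim> a\<close> are disjoint, and the second contains the preimage of
  \<open>U (\<sim> a)\<close>. So the first lies in the preimage of the closure of \<open>U a\<close>.\<close>

lemma U_dual_morphism_subset: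
  assumes "a \<prec>\<^bsub>E.A\<^esub> b" "a \<in> carrier E.A" "b \<in> carrier E.A"
  shows "E'.U (dual_morphism a) \<subseteq> preimage b"
proof
  fix x assume x: "x \<in> E'.U (dual_morphism a)"
  then have X: "x \<in> E'.X"
    using E'.U_subset by auto
  have "dual_morphism a \<sqinter>\<^bsub>E'.A\<^esub> dual_morphism (\<sim>\<^bsub>E.A\<^esub> a) = \<bottom>\<^bsub>E'.A\<^esub>"
    using assms dual_morphism_meet[of a "\<sim>\<^bsub>E.A\<^esub> a"]
    by (simp add: E.emb.A.meet_complement dual_morphism_bottom)
  then have "E'.U (dual_morphism a) \<inter> E'.U (dual_morphism (\<sim>\<^bsub>E.A\<^esub> a)) = {}"
    using assms by (simp add: E'.U_disjoint_iff)
  then have "x \<notin> preimage (\<sim>\<^bsub>E.A\<^esub> a)"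
    using x preimage_subset[of "\<sim>\<^bsub>E.A\<^esub> a"] assms by auto
  then have "f x \<in> E.X - E.U (\<sim>\<^bsub>E.A\<^esub> a)"
    using X f_closed by auto
  then show "x \<in> preimage b"
    using X E.U_prec[OF assms] by auto
qed

lemma preimage_eq_Union:
  assumes "b \<in> carrier E.A"
  shows "preimage b = (\<Union>a \<in> prec_below E.A b. E'.U (dual_morphism a))"
proof
  show "preimage b \<subseteq> (\<Union>a \<in> prec_below E.A b. E'.U (dual_morphism a))"
  proof
    fix x assume "x \<in> preimage b"
    then obtain a where "x \<in> preimage a" "a \<in> prec_below E.A b"
      using E.U_eq_Union[OF assms] by auto
    then show "x \<in> (\<Union>a \<in> prec_below E.A b. E'.U (dual_morphism a))"
      using preimage_subset[of a] by (auto simp: prec_below_iff)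
  qed
  show "(\<Union>a \<in> prec_below E.A b. E'.U (dual_morphism a)) \<subseteq> preimage b"
    using U_dual_morphism_subset[OF _ _ assms] by (intro UN_least) (simp add: prec_below_iff)
qed

text \<open>The required inclusion of a closure in an open set comes from the preimage of the inclusion
  \<open>U_prec\<close>; compactness of \<open>E'\<close> turns it into the relation \<open>\<prec>\<close>.\<close>

lemma dual_morphism_prec:
  assumes "a \<prec>\<^bsub>E.A\<^esub> b" "a \<in> carrier E.A" "b \<in> carrier E.A"
  shows "(\<sim>\<^bsub>E'.A\<^esub> dual_morphism (\<sim>\<^bsub>E.A\<^esub> a)) \<prec>\<^bsub>E'.A\<^esub> dual_morphism b"
proof (subst E'.prec_iff)
  have "E'.X - E'.U (dual_morphism (\<sim>\<^bsub>E.A\<^esub> a)) \<subseteq> E'.X - preimage (\<sim>\<^bsub>E.A\<^esub> a)"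
    using preimage_subset[of "\<sim>\<^bsub>E.A\<^esub> a"] assms by auto
  also have "\<dots> \<subseteq> preimage b"
    using E.U_prec[OF assms] f_closed by auto
  also have "\<dots> \<subseteq> E'.U (dual_morphism b)"
    using assms by (intro preimage_subset)
  finally show "E'.X - E'.U (\<sim>\<^bsub>E'.A\<^esub> (\<sim>\<^bsub>E'.A\<^esub> dual_morphism (\<sim>\<^bsub>E.A\<^esub> a))) \<subseteq> E'.U (dual_morphism b)"
    using assms by simp
qed (use assms in auto)

lemma dual_morphism_eq_sup:
  assumes b: "b \<in> carrier E.A"
  shows "dual_morphism b = \<Squnion>\<^bsub>E'.A\<^esub>(dual_morphism ` prec_below E.A b)"
proof -
  have sub: "dual_morphism ` prec_below E.A b \<subseteq> carrier E'.A"
    by (auto simp: prec_below_iff)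
  let ?s = "\<Squnion>\<^bsub>E'.A\<^esub>(dual_morphism ` prec_below E.A b)"
  have s: "?s \<in> carrier E'.A"
    using sub by simp
  show ?thesis
  proof (rule E'.emb.A.le_antisym)
    have "E'.U (dual_morphism a) \<subseteq> E'.U ?s" if "a \<in> prec_below E.A b" for a
    proof -
      have "dual_morphism a \<sqsubseteq>\<^bsub>E'.A\<^esub> ?s"
        using sub that by (intro E'.emb.A.sup_upper) auto
      then show ?thesis
        using that s by (simp add: E'.U_subset_iff prec_below_iff)
    qed
    then have "preimage b \<subseteq> E'.U ?s"
      unfolding preimage_eq_Union[OF b] by blast
    then have "E'.interior_sup (preimage b) \<sqsubseteq>\<^bsub>E'.A\<^esub> ?s"
      using s by (intro E'.interior_sup_le) (auto simp flip: E'.U_subset_iff)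
    then show "dual_morphism b \<sqsubseteq>\<^bsub>E'.A\<^esub> ?s"
      using b by (simp add: dual_morphism_def)
    show "?s \<sqsubseteq>\<^bsub>E'.A\<^esub> dual_morphism b"
    proof (rule E'.emb.A.sup_least[OF sub])
      fix c assume "c \<in> dual_morphism ` prec_below E.A b"
      then obtain a where a: "a \<in> carrier E.A" "a \<prec>\<^bsub>E.A\<^esub> b" "c = dual_morphism a"
        by (auto simp: prec_below_iff)
      then have "E'.U c \<subseteq> preimage b"
        using U_dual_morphism_subset b by simp
      then show "c \<sqsubseteq>\<^bsub>E'.A\<^esub> dual_morphism b"
        using a b by (simp add: dual_morphism_def[THEN fun_cong, of b] E'.le_interior_sup)
    qed (use b in simp)
  qed (use b s in auto)
qed

lemma extension_morphism_dual: "extension_morphism E E' dual_morphism (hom_of_map f)"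
  unfolding extension_morphism_def
proof (intro conjI)
  show "devries_morphism E.A E'.A dual_morphism"
  proof (rule devries_morphismI)
    show "dual_morphism \<in> carrier E.A \<rightarrow>\<^sub>E carrier E'.A"
      by (auto simp: dual_morphism_def)
  qed (use dual_morphism_bottom dual_morphism_meet dual_morphism_prec dual_morphism_eq_sup in simp_all)
  show "complete_boolean_hom E.B E'.B (hom_of_map f)"
    using f_closed by (intro hom_of_map_complete_boolean_hom) auto
  show "compose (carrier E.A) (hom_of_map f) E.\<alpha> = devries_comp E.A E'.B E'.\<alpha> dual_morphism"
  proof (rule extensionalityI[OF compose_extensional devries_comp_extensional])
    fix a assume a: "a \<in> carrier E.A"
    have sub: "(\<lambda>c. E'.\<alpha> (dual_morphism c)) ` prec_below E.A a \<subseteq> carrier E'.B"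
      by (auto simp: prec_below_iff)
    have "hom_of_map f (E.\<alpha> a) = \<Squnion>\<^bsub>E'.B\<^esub>((\<lambda>c. E'.\<alpha> (dual_morphism c)) ` prec_below E.A a)"
    proof (rule E'.B.atoms_below_inject)
      show "atoms_below E'.B (hom_of_map f (E.\<alpha> a)) =
          atoms_below E'.B (\<Squnion>\<^bsub>E'.B\<^esub>((\<lambda>c. E'.\<alpha> (dual_morphism c)) ` prec_below E.A a))"
        using a preimage_eq_Union[OF a]
        by (simp add: atoms_below_hom_of_map E'.emb.B.atoms_below_sup[OF sub] basic_open_def)
    qed (use a sub in \<open>auto intro: hom_of_map_closed\<close>)
    then show "compose (carrier E.A) (hom_of_map f) E.\<alpha> a = devries_comp E.A E'.B E'.\<alpha> dual_morphism a"
      using a by (simp add: compose_eq devries_comp_apply)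
  qed
qed

end

section \<open>De Vries algebras of regular open sets\<close>

text \<open>The open sets fixed by this operator are the regular open ones. On open sets it is a closure
  operator.\<close>

definition regularize :: "'a topology \<Rightarrow> 'a set \<Rightarrow> 'a set" where
  "regularize X S = X interior_of (X closure_of S)"

definition regular_opens :: "'a topology \<Rightarrow> 'a set set" where
  "regular_opens X = {V. regularize X V = V}"

lemma regularize_mono: "S \<subseteq> T \<Longrightarrow> regularize X S \<subseteq> regularize X T"
  by (simp add: regularize_def closure_of_mono interior_of_mono)

lemma openin_regularize: "openin X (regularize X S)"
  by (simp add: regularize_def)

lemma subset_regularize: "openin X V \<Longrightarrow> V \<subseteq> regularize X V"
  by (simp add: regularize_def interior_of_maximal closure_of_subset openin_subset)

lemma closure_of_regularize_subset: "X closure_of (regularize X S) \<subseteq> X closure_of S"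
  unfolding regularize_def by (intro closure_of_minimal interior_of_subset closedin_closure_of)

lemma regularize_regularize [simp]: "regularize X (regularize X S) = regularize X S"
proof
  show "regularize X (regularize X S) \<subseteq> regularize X S"
    using interior_of_mono[OF closure_of_regularize_subset[of X S]] by (simp add: regularize_def)
qed (rule subset_regularize[OF openin_regularize])

lemma regularize_in [simp]: "regularize X S \<in> regular_opens X"
  by (simp add: regular_opens_def)

lemma regular_opens_openin: "V \<in> regular_opens X \<Longrightarrow> openin X V"
  using openin_regularize[of X V] by (simp add: regular_opens_def)

lemma regular_opens_subset: "V \<in> regular_opens X \<Longrightarrow> V \<subseteq> topspace X"
  by (rule openin_subset[OF regular_opens_openin])

lemma regularize_le: "\<lbrakk>S \<subseteq> V; V \<in> regular_opens X\<rbrakk> \<Longrightarrow> regularize X S \<subseteq> V"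
  using regularize_mono[of S V X] by (simp add: regular_opens_def)

lemma regular_opensI: "\<lbrakk>openin X V; regularize X V \<subseteq> V\<rbrakk> \<Longrightarrow> V \<in> regular_opens X"
  using subset_regularize[of X V] by (auto simp: regular_opens_def)

lemma Int_regular_opens: "\<lbrakk>V \<in> regular_opens X; W \<in> regular_opens X\<rbrakk> \<Longrightarrow> V \<inter> W \<in> regular_opens X"
  by (intro regular_opensI) (auto simp: regular_opens_openin dest: regularize_le[rotated])

lemma topspace_regular_opens: "topspace X \<in> regular_opens X"
  by (rule regular_opensI) (auto simp: openin_subset openin_regularize)

lemma empty_regular_opens: "{} \<in> regular_opens X"
  by (simp add: regular_opens_def regularize_def)

lemma Diff_closure_regular_opens: "V \<in> regular_opens X \<Longrightarrow> topspace X - X closure_of V \<in> regular_opens X"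
  by (simp add: regular_opens_def regularize_def closure_of_complement interior_of_complement)

lemma regular_opens_discrete [simp]: "regular_opens (discrete_topology T) = Pow T"
  by (auto simp: regular_opens_def regularize_def discrete_topology_closure_of)

text \<open>The algebra of regular open sets is copied into a given type by an encoding \<open>k\<close> of the subsets of
  the space. Normality is used for (DV6) and (DV7). The discrete topology on a set is also covered, and
  yields its power set.\<close>

locale encoded_space =
  fixes X :: "'a topology" and k :: "'a set \<Rightarrow> 'b"
  assumes inj: "inj_on k (Pow (topspace X))"
    and normal: "normal_space X" and Hausdorff: "Hausdorff_space X"
begin

abbreviation T where "T \<equiv> topspace X"

definition decode :: "'b \<Rightarrow> 'a set" where
  "decode = the_inv_into (Pow T) k"

lemma decode_encode [simp]: "V \<subseteq> T \<Longrightarrow> decode (k V) = V"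
  unfolding decode_def using inj by (intro the_inv_into_f_f) auto

text \<open>The normality of the space provides an open neighbourhood of \<open>x\<close> with closure in \<open>W\<close>, and
  regularizing it does not enlarge the closure.\<close>

lemma regular_opens_base:
  assumes "openin X W" "x \<in> W"
  obtains V where "V \<in> regular_opens X" "x \<in> V" "X closure_of V \<subseteq> W"
proof -
  have "closedin X {x}"
    using assms openin_subset by (intro closedin_Hausdorff_singleton[OF Hausdorff]) auto
  then obtain V where V: "openin X V" "{x} \<subseteq> V" "X closure_of V \<subseteq> W"
    using normal[unfolded normal_space_alt, rule_format, of "{x}" W] assms by auto
  show thesis
  proof (rule that[of "regularize X V"])
    show "x \<in> regularize X V"
      using V subset_regularize[of X V] by auto
    show "X closure_of (regularize X V) \<subseteq> W"
      by (rule order_trans[OF closure_of_regularize_subset V(3)])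
  qed simp
qed

definition regular_algebra :: "'b devries_structure" where
  "regular_algebra = \<lparr>carrier = k ` regular_opens X, eq = (=),
     gorder.le = (\<lambda>a b. decode a \<subseteq> decode b), prec = (\<lambda>a b. X closure_of (decode a) \<subseteq> decode b)\<rparr>"

abbreviation R where "R \<equiv> regular_algebra"

lemma carrier_R: "carrier R = k ` regular_opens X"
  by (simp add: regular_algebra_def)

lemma k_carrier [simp]: "V \<in> regular_opens X \<Longrightarrow> k V \<in> carrier R"
  by (simp add: carrier_R)

lemma dec [simp]: "V \<in> regular_opens X \<Longrightarrow> decode (k V) = V"
  by (simp add: regular_opens_subset)

lemma le_iff: "\<lbrakk>V \<in> regular_opens X; W \<in> regular_opens X\<rbrakk> \<Longrightarrow> k V \<sqsubseteq>\<^bsub>R\<^esub> k W \<longleftrightarrow> V \<subseteq> W"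
  by (simp add: regular_algebra_def)

lemma prec_iff: "\<lbrakk>V \<in> regular_opens X; W \<in> regular_opens X\<rbrakk> \<Longrightarrow> k V \<prec>\<^bsub>R\<^esub> k W \<longleftrightarrow> X closure_of V \<subseteq> W"
  by (simp add: regular_algebra_def)

lemma k_eq_iff:
  assumes "V \<in> regular_opens X" "W \<in> regular_opens X"
  shows "k V = k W \<longleftrightarrow> V = W"
proof
  assume "k V = k W"
  then have "decode (k V) = decode (k W)"
    by (rule arg_cong)
  then show "V = W"
    using assms by simp
qed simp

lemma partial_order_R: "partial_order R"
proof
  show "(.=\<^bsub>R\<^esub>) = (=)"
    by (simp add: regular_algebra_def)
qed (auto simp: regular_algebra_def k_eq_iff)

lemma least_R:
  assumes "\<S> \<subseteq> regular_opens X"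
  shows "least R (k (regularize X (\<Union>\<S>))) (Upper R (k ` \<S>))"
proof -
  interpret partial_order R by (rule partial_order_R)
  show ?thesis
  proof (rule least_UpperI)
    fix a assume "a \<in> k ` \<S>"
    then obtain V where "V \<in> \<S>" "a = k V"
      by auto
    moreover have "V \<subseteq> regularize X (\<Union>\<S>)"
      using \<open>V \<in> \<S>\<close> assms regularize_mono[of V "\<Union>\<S>" X] by (auto simp: regular_opens_def)
    ultimately show "a \<sqsubseteq>\<^bsub>R\<^esub> k (regularize X (\<Union>\<S>))"
      using assms by (auto simp: le_iff)
  next
    fix b assume b: "b \<in> Upper R (k ` \<S>)"
    then obtain W where W: "W \<in> regular_opens X" "b = k W"
      by (auto simp: Upper_def carrier_R)
    have "V \<subseteq> W" if "V \<in> \<S>" for V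
    proof -
      have "k V \<sqsubseteq>\<^bsub>R\<^esub> k W"
        using b that assms W by (intro Upper_memD[THEN conjunct1]) auto
      then show ?thesis
        using that assms W(1) le_iff by (meson subsetD)
    qed
    then have "regularize X (\<Union>\<S>) \<subseteq> W"
      using W(1) by (intro regularize_le Union_least)
    then show "k (regularize X (\<Union>\<S>)) \<sqsubseteq>\<^bsub>R\<^esub> b"
      using W by (simp add: le_iff)
  qed (use assms in auto)
qed

lemma greatest_R:
  assumes "\<S> \<subseteq> regular_opens X"
  shows "greatest R (k (regularize X (T \<inter> \<Inter>\<S>))) (Lower R (k ` \<S>))"
proof -
  interpret partial_order R by (rule partial_order_R)
  show ?thesis
  proof (rule greatest_LowerI)
    fix a assume "a \<in> k ` \<S>"
    then obtain V where "V \<in> \<S>" "a = k V"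
      by auto
    moreover have "regularize X (T \<inter> \<Inter>\<S>) \<subseteq> V"
      using \<open>V \<in> \<S>\<close> assms by (intro regularize_le) auto
    ultimately show "k (regularize X (T \<inter> \<Inter>\<S>)) \<sqsubseteq>\<^bsub>R\<^esub> a"
      using assms by (auto simp: le_iff)
  next
    fix b assume b: "b \<in> Lower R (k ` \<S>)"
    then obtain W where W: "W \<in> regular_opens X" "b = k W"
      by (auto simp: Lower_def carrier_R)
    have "W \<subseteq> V" if "V \<in> \<S>" for V
    proof -
      have "k W \<sqsubseteq>\<^bsub>R\<^esub> k V"
        using b that assms W by (intro Lower_memD[THEN conjunct1]) auto
      then show ?thesis
        using that assms W(1) le_iff by (meson subsetD)
    qed
    then have "regularize X W \<subseteq> regularize X (T \<inter> \<Inter>\<S>)"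
      using regular_opens_subset[OF W(1)] by (intro regularize_mono) auto
    then show "b \<sqsubseteq>\<^bsub>R\<^esub> k (regularize X (T \<inter> \<Inter>\<S>))"
      using W by (simp add: le_iff) (simp add: regular_opens_def)
  qed (use assms in auto)
qed

lemma subset_carrierE:
  assumes "S \<subseteq> carrier R"
  obtains \<S> where "\<S> \<subseteq> regular_opens X" "S = k ` \<S>"
  using assms unfolding carrier_R by (meson subset_imageE)

sublocale lat: complete_lattice R
proof -
  interpret partial_order R by (rule partial_order_R)
  show "complete_lattice R"
  proof
    fix S assume "S \<subseteq> carrier R"
    then obtain \<S> where "\<S> \<subseteq> regular_opens X" "S = k ` \<S>"
      by (rule subset_carrierE)
    then show "\<exists>s. least R s (Upper R S)" "\<exists>s. greatest R s (Lower R S)"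
      using least_R[of \<S>] greatest_R[of \<S>] by auto
  qed
qed

lemma sup_R:
  assumes "\<S> \<subseteq> regular_opens X"
  shows "\<Squnion>\<^bsub>R\<^esub>(k ` \<S>) = k (regularize X (\<Union>\<S>))"
proof -
  have "least R (\<Squnion>\<^bsub>R\<^esub>(k ` \<S>)) (Upper R (k ` \<S>))"
    using assms by (intro lat.weak.sup_lub) (auto simp: carrier_R)
  then show ?thesis
    using least_R[OF assms] by (rule lat.least_unique)
qed

lemma inf_R:
  assumes "\<S> \<subseteq> regular_opens X"
  shows "\<Sqinter>\<^bsub>R\<^esub>(k ` \<S>) = k (regularize X (T \<inter> \<Inter>\<S>))"
proof -
  have "greatest R (\<Sqinter>\<^bsub>R\<^esub>(k ` \<S>)) (Lower R (k ` \<S>))"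
    using assms by (intro lat.weak.inf_glb) (auto simp: carrier_R)
  then show ?thesis
    using greatest_R[OF assms] by (rule lat.greatest_unique)
qed

lemma meet_R:
  assumes "V \<in> regular_opens X" "W \<in> regular_opens X"
  shows "k V \<sqinter>\<^bsub>R\<^esub> k W = k (V \<inter> W)"
proof -
  have "T \<inter> \<Inter>{V, W} = V \<inter> W"
    using assms regular_opens_subset by auto
  then show ?thesis
    using inf_R[of "{V, W}"] Int_regular_opens[OF assms] assms
    by (simp add: meet_def) (simp add: regular_opens_def)
qed

lemma join_R:
  assumes "V \<in> regular_opens X" "W \<in> regular_opens X"
  shows "k V \<squnion>\<^bsub>R\<^esub> k W = k (regularize X (V \<union> W))"
  using sup_R[of "{V, W}"] assms by (simp add: join_def)

lemma bottom_R: "\<bottom>\<^bsub>R\<^esub> = k {}"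
proof (rule lat.le_antisym)
  show "\<bottom>\<^bsub>R\<^esub> \<sqsubseteq>\<^bsub>R\<^esub> k {}"
    by (intro lat.weak.bottom_lower k_carrier empty_regular_opens)
  obtain V where "V \<in> regular_opens X" "\<bottom>\<^bsub>R\<^esub> = k V"
    using lat.weak.bottom_closed by (auto simp: carrier_R)
  then show "k {} \<sqsubseteq>\<^bsub>R\<^esub> \<bottom>\<^bsub>R\<^esub>"
    by (simp add: le_iff empty_regular_opens)
qed (auto simp: empty_regular_opens)

lemma top_R: "\<top>\<^bsub>R\<^esub> = k T"
proof (rule lat.le_antisym)
  show "k T \<sqsubseteq>\<^bsub>R\<^esub> \<top>\<^bsub>R\<^esub>"
    by (intro lat.weak.top_higher k_carrier topspace_regular_opens)
  obtain V where "V \<in> regular_opens X" "\<top>\<^bsub>R\<^esub> = k V"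
    using lat.weak.top_closed by (auto simp: carrier_R)
  then show "\<top>\<^bsub>R\<^esub> \<sqsubseteq>\<^bsub>R\<^esub> k T"
    by (simp add: le_iff topspace_regular_opens regular_opens_subset)
qed (auto simp: topspace_regular_opens)

lemma Int_regularize_subset:
  assumes "openin X V"
  shows "V \<inter> regularize X S \<subseteq> regularize X (V \<inter> S)"
  unfolding regularize_def
proof (rule interior_of_maximal)
  have "V \<inter> X interior_of (X closure_of S) \<subseteq> V \<inter> X closure_of S"
    using interior_of_subset[of X "X closure_of S"] by auto
  also have "\<dots> \<subseteq> X closure_of (V \<inter> S)"
    by (rule openin_Int_closure_of_subset[OF assms])
  finally show "V \<inter> X interior_of (X closure_of S) \<subseteq> X closure_of (V \<inter> S)" .
qed (use assms in auto)

lemma join_Diff_closure: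
  assumes "V \<in> regular_opens X"
  shows "regularize X (V \<union> (T - X closure_of V)) = T"
proof -
  have "T - X closure_of V \<subseteq> X closure_of (T - X closure_of V)"
    by (rule closure_of_subset) auto
  then have "T \<subseteq> X closure_of (V \<union> (T - X closure_of V))"
    by (auto simp: closure_of_Un)
  then have "X closure_of (V \<union> (T - X closure_of V)) = T"
    by (intro equalityI closure_of_subset_topspace)
  then show ?thesis
    by (simp add: regularize_def)
qed

sublocale cba: complete_boolean_algebra R
proof
  fix x y z assume "x \<in> carrier R" "y \<in> carrier R" "z \<in> carrier R"
  then obtain U V W where V: "U \<in> regular_opens X" "V \<in> regular_opens X" "W \<in> regular_opens X"
    "x = k U" "y = k V" "z = k W"
    by (auto simp: carrier_R)
  have "U \<inter> regularize X (V \<union> W) = regularize X (U \<inter> V \<union> U \<inter> W)"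
  proof
    show "U \<inter> regularize X (V \<union> W) \<subseteq> regularize X (U \<inter> V \<union> U \<inter> W)"
      using Int_regularize_subset[OF regular_opens_openin[OF V(1)], of "V \<union> W"] by (simp add: Int_Un_distrib)
    show "regularize X (U \<inter> V \<union> U \<inter> W) \<subseteq> U \<inter> regularize X (V \<union> W)"
      using V(1) regularize_le[of "U \<inter> V \<union> U \<inter> W" U X] regularize_mono[of "U \<inter> V \<union> U \<inter> W" "V \<union> W" X]
      by auto
  qed
  then show "x \<sqinter>\<^bsub>R\<^esub> (y \<squnion>\<^bsub>R\<^esub> z) = (x \<sqinter>\<^bsub>R\<^esub> y) \<squnion>\<^bsub>R\<^esub> (x \<sqinter>\<^bsub>R\<^esub> z)"
    using V by (simp add: join_R meet_R Int_regular_opens)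
next
  fix x assume "x \<in> carrier R"
  then obtain V where V: "V \<in> regular_opens X" "x = k V"
    by (auto simp: carrier_R)
  have "V \<inter> (T - X closure_of V) = {}"
    using closure_of_subset[OF regular_opens_subset[OF V(1)]] by auto
  then show "\<exists>y \<in> carrier R. x \<sqinter>\<^bsub>R\<^esub> y = \<bottom>\<^bsub>R\<^esub> \<and> x \<squnion>\<^bsub>R\<^esub> y = \<top>\<^bsub>R\<^esub>"
    using V Diff_closure_regular_opens[OF V(1)]
    by (intro bexI[of _ "k (T - X closure_of V)"])
      (simp_all add: meet_R join_R bottom_R top_R join_Diff_closure)
qed

lemma complement_R:
  assumes "V \<in> regular_opens X"
  shows "(\<sim>\<^bsub>R\<^esub> k V) = k (T - X closure_of V)"
proof (rule cba.complementI)
  have "V \<inter> (T - X closure_of V) = {}"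
    using closure_of_subset[OF regular_opens_subset[OF assms]] by auto
  then show "k V \<sqinter>\<^bsub>R\<^esub> k (T - X closure_of V) = \<bottom>\<^bsub>R\<^esub>"
    using assms Diff_closure_regular_opens[OF assms] by (simp add: meet_R bottom_R)
  show "k V \<squnion>\<^bsub>R\<^esub> k (T - X closure_of V) = \<top>\<^bsub>R\<^esub>"
    using assms Diff_closure_regular_opens[OF assms] by (simp add: join_R top_R join_Diff_closure)
qed (use assms Diff_closure_regular_opens[OF assms] in auto)

lemma prec_below_R:
  assumes "W \<in> regular_opens X"
  shows "prec_below R (k W) = k ` {V \<in> regular_opens X. (X closure_of V) \<subseteq> W}"
  using assms by (auto simp: prec_below_iff carrier_R prec_iff)

lemma Union_well_inside:
  assumes "W \<in> regular_opens X"
  shows "\<Union>{V \<in> regular_opens X. (X closure_of V) \<subseteq> W} = W"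
proof
  show "\<Union>{V \<in> regular_opens X. (X closure_of V) \<subseteq> W} \<subseteq> W"
  proof (rule Union_least)
    fix V assume "V \<in> {V \<in> regular_opens X. (X closure_of V) \<subseteq> W}"
    then show "V \<subseteq> W"
      using closure_of_subset[OF regular_opens_subset[of V X]] by auto
  qed
  show "W \<subseteq> \<Union>{V \<in> regular_opens X. (X closure_of V) \<subseteq> W}"
  proof
    fix x assume "x \<in> W"
    then obtain V where "V \<in> regular_opens X" "x \<in> V" "X closure_of V \<subseteq> W"
      using regular_opens_base[OF regular_opens_openin[OF assms]] by auto
    then show "x \<in> \<Union>{V \<in> regular_opens X. (X closure_of V) \<subseteq> W}"
      by auto
  qed
qed

text \<open>Interpolation (DV6) is normality, and (DV7) holds by \<open>regular_opens_base\<close>.\<close>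

lemma devries_algebra_R: "devries_algebra R"
proof
  show "\<top>\<^bsub>R\<^esub> \<prec>\<^bsub>R\<^esub> \<top>\<^bsub>R\<^esub>"
    by (simp add: top_R prec_iff topspace_regular_opens)
next
  fix a b assume "a \<in> carrier R" "b \<in> carrier R" "a \<prec>\<^bsub>R\<^esub> b"
  then obtain V W where V: "V \<in> regular_opens X" "W \<in> regular_opens X" "a = k V" "b = k W"
      "X closure_of V \<subseteq> W"
    by (auto simp: carrier_R prec_iff)
  then show "a \<sqsubseteq>\<^bsub>R\<^esub> b"
    using closure_of_subset[OF regular_opens_subset[OF V(1)]] by (simp add: le_iff)
  have "closedin X (T - W)"
    using regular_opens_openin[OF V(2)] by (intro closedin_diff) auto
  then have "X closure_of (T - X closure_of W) \<subseteq> T - W"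
    using closure_of_subset[OF regular_opens_subset[OF V(2)]] by (intro closure_of_minimal) auto
  also have "\<dots> \<subseteq> T - X closure_of V"
    using V by auto
  finally show "(\<sim>\<^bsub>R\<^esub> b) \<prec>\<^bsub>R\<^esub> (\<sim>\<^bsub>R\<^esub> a)"
    using V by (simp add: complement_R prec_iff Diff_closure_regular_opens)
  obtain G where G: "openin X G" "X closure_of V \<subseteq> G" "X closure_of G \<subseteq> W"
    using normal V regular_opens_openin[OF V(2)] unfolding normal_space_alt
    by (meson closedin_closure_of)
  then show "\<exists>c \<in> carrier R. a \<prec>\<^bsub>R\<^esub> c \<and> c \<prec>\<^bsub>R\<^esub> b"
    using V subset_regularize[of X G] closure_of_regularize_subset[of X G]
    by (intro bexI[of _ "k (regularize X G)"]) (auto simp: prec_iff)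
next
  fix a b c d
  assume "a \<in> carrier R" "b \<in> carrier R" "c \<in> carrier R" "d \<in> carrier R"
    "a \<sqsubseteq>\<^bsub>R\<^esub> b" "b \<prec>\<^bsub>R\<^esub> c" "c \<sqsubseteq>\<^bsub>R\<^esub> d"
  then obtain U V W Z where "U \<in> regular_opens X" "V \<in> regular_opens X" "W \<in> regular_opens X"
      "Z \<in> regular_opens X" "a = k U" "b = k V" "c = k W" "d = k Z"
      "U \<subseteq> V" "X closure_of V \<subseteq> W" "W \<subseteq> Z"
    by (auto simp: carrier_R le_iff prec_iff)
  then show "a \<prec>\<^bsub>R\<^esub> d"
    using closure_of_mono[of U V X] by (auto simp: prec_iff)
next
  fix a b c
  assume "a \<in> carrier R" "b \<in> carrier R" "c \<in> carrier R" "a \<prec>\<^bsub>R\<^esub> b" "a \<prec>\<^bsub>R\<^esub> c"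
  then show "a \<prec>\<^bsub>R\<^esub> b \<sqinter>\<^bsub>R\<^esub> c"
    by (auto simp: carrier_R meet_R prec_iff Int_regular_opens)
next
  fix b assume "b \<in> carrier R"
  then obtain W where W: "W \<in> regular_opens X" "b = k W"
    by (auto simp: carrier_R)
  have "\<Squnion>\<^bsub>R\<^esub>(prec_below R b) = k (regularize X W)"
    using W by (simp add: prec_below_R sup_R Union_well_inside)
  then show "b = \<Squnion>\<^bsub>R\<^esub>{a \<in> carrier R. a \<prec>\<^bsub>R\<^esub> b}"
    using W by (simp add: prec_below_def regular_opens_def)
qed

end

section \<open>The extension of a compact Hausdorff space\<close>

context complete_boolean_algebra
begin

lemma filter_finite_lower_bound:
  assumes F: "lattice_filter L F" and "finite S" "S \<subseteq> F"
  shows "\<exists>a \<in> F. \<forall>s \<in> S. a \<sqsubseteq> s"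
  using assms(2,3)
proof (induction S)
  case empty
  then show ?case
    using F by (auto simp: lattice_filter_def)
next
  case (insert x S)
  have car: "F \<subseteq> carrier L"
    using F by (simp add: lattice_filter_def)
  obtain a where a: "a \<in> F" "\<forall>s \<in> S. a \<sqsubseteq> s"
    using insert by auto
  have "x \<sqinter> a \<in> F"
    using F a(1) insert(4) by (auto simp: lattice_filter_def)
  moreover have "x \<sqinter> a \<sqsubseteq> s" if "s \<in> insert x S" for s
  proof -
    have *: "x \<in> carrier L" "a \<in> carrier L" "s \<in> carrier L"
      using car insert(4) a(1) that by auto
    show ?thesis
    proof (cases "s = x")
      case True
      then show ?thesis using * by (simp add: meet_left)
    next
      case False
      then have "a \<sqsubseteq> s"
        using that a(2) by auto
      then show ?thesis
        using le_trans[OF meet_right[of x a]] * by simp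
    qed
  qed
  ultimately show ?case
    by blast
qed

lemma ideal_finite_upper_bound:
  assumes I: "lattice_ideal L I" and "finite S" "S \<subseteq> I"
  shows "\<exists>b \<in> I. \<forall>s \<in> S. s \<sqsubseteq> b"
  using assms(2,3)
proof (induction S)
  case empty
  then show ?case
    using I by (auto simp: lattice_ideal_def)
next
  case (insert x S)
  have car: "I \<subseteq> carrier L"
    using I by (simp add: lattice_ideal_def)
  obtain b where b: "b \<in> I" "\<forall>s \<in> S. s \<sqsubseteq> b"
    using insert by auto
  have "x \<squnion> b \<in> I"
    using I b(1) insert(4) by (auto simp: lattice_ideal_def)
  moreover have "s \<sqsubseteq> x \<squnion> b" if "s \<in> insert x S" for s
  proof -
    have *: "x \<in> carrier L" "b \<in> carrier L" "s \<in> carrier L"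
      using car insert(4) b(1) that by auto
    show ?thesis
    proof (cases "s = x")
      case True
      then show ?thesis using * by (simp add: join_left)
    next
      case False
      then have "s \<sqsubseteq> b"
        using that b(2) by auto
      then show ?thesis
        using le_trans[OF _ join_right[of x b]] * by simp
    qed
  qed
  ultimately show ?case
    by blast
qed

end

locale compact_encoded_space = encoded_space +
  assumes compact: "compact_space X"
begin

text \<open>All subsets of a discrete space are regular open and equal to their closures. Hence \<open>D.R\<close> is a copy of
  the power set of \<open>T\<close> in which \<open>\<prec>\<close> is the inclusion, and the carrier of \<open>R\<close> is a part of it.\<close>

sublocale D: encoded_space "discrete_topology T" k
  using inj by unfold_locales (auto simp: normal_space_discrete_topology)

definition space_extension :: "('b, 'b) extension" where
  "space_extension = \<lparr>src = R, tgt = D.R, emb = restrict id (carrier R)\<rparr>"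

lemma space_extension_simps [simp]:
  "src space_extension = R" "tgt space_extension = D.R"
  "V \<in> regular_opens X \<Longrightarrow> emb space_extension (k V) = k V"
  by (simp_all add: space_extension_def)

lemma carrier_P: "carrier D.R = k ` Pow T"
  by (simp add: D.carrier_R)

lemma sup_P:
  assumes "\<S> \<subseteq> Pow T"
  shows "\<Squnion>\<^bsub>D.R\<^esub>(k ` \<S>) = k (\<Union>\<S>)"
proof -
  have "T \<inter> \<Union>\<S> = \<Union>\<S>"
    using assms by auto
  then show ?thesis
    using D.sup_R[of \<S>] assms by (simp add: regularize_def discrete_topology_closure_of)
qed

lemma inf_P: "\<S> \<subseteq> Pow T \<Longrightarrow> \<Sqinter>\<^bsub>D.R\<^esub>(k ` \<S>) = k (T \<inter> \<Inter>\<S>)"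
  using D.inf_R[of \<S>] by (simp add: regularize_def discrete_topology_closure_of)

lemma le_P_iff: "\<lbrakk>V \<subseteq> T; W \<subseteq> T\<rbrakk> \<Longrightarrow> k V \<sqsubseteq>\<^bsub>D.R\<^esub> k W \<longleftrightarrow> V \<subseteq> W"
  using D.le_iff[of V W] by simp

lemma prec_P_iff: "\<lbrakk>V \<subseteq> T; W \<subseteq> T\<rbrakk> \<Longrightarrow> k V \<prec>\<^bsub>D.R\<^esub> k W \<longleftrightarrow> V \<subseteq> W"
  using D.prec_iff[of V W] by (simp add: discrete_topology_closure_of Int_absorb1)

lemma complement_P: "V \<subseteq> T \<Longrightarrow> (\<sim>\<^bsub>D.R\<^esub> k V) = k (T - V)"
  using D.complement_R[of V] by (simp add: discrete_topology_closure_of Int_absorb1)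

lemma k_eq_P_iff: "\<lbrakk>V \<subseteq> T; W \<subseteq> T\<rbrakk> \<Longrightarrow> k V = k W \<longleftrightarrow> V = W"
  using D.k_eq_iff[of V W] by simp

lemma atom_P: "lattice_atom D.R a \<longleftrightarrow> (\<exists>x \<in> T. a = k {x})"
proof
  assume a: "lattice_atom D.R a"
  then obtain V where V: "V \<subseteq> T" "a = k V"
    by (auto simp: lattice_atom_def carrier_P)
  have "V \<noteq> {}"
    using a V by (auto simp: lattice_atom_def D.bottom_R)
  then obtain x where x: "x \<in> V"
    by auto
  then have "x \<in> T"
    using V by auto
  then have "k {x} \<sqsubseteq>\<^bsub>D.R\<^esub> k V" "k {x} \<in> carrier D.R" "k {x} \<noteq> \<bottom>\<^bsub>D.R\<^esub>"
    using V x by (auto simp: le_P_iff carrier_P D.bottom_R k_eq_P_iff)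
  then have "k {x} = a"
    using a V by (auto simp: lattice_atom_def)
  then show "\<exists>x \<in> T. a = k {x}"
    using \<open>x \<in> T\<close> by auto
next
  assume "\<exists>x \<in> T. a = k {x}"
  then obtain x where x: "x \<in> T" "a = k {x}"
    by auto
  show "lattice_atom D.R a"
    unfolding lattice_atom_def
  proof (intro conjI ballI impI)
    show "a \<in> carrier D.R" "a \<noteq> \<bottom>\<^bsub>D.R\<^esub>"
      using x by (auto simp: carrier_P D.bottom_R k_eq_P_iff)
    fix y assume "y \<in> carrier D.R" "y \<sqsubseteq>\<^bsub>D.R\<^esub> a"
    then obtain W where "W \<subseteq> {x}" "y = k W"
      using x by (auto simp: carrier_P le_P_iff)
    then show "y = \<bottom>\<^bsub>D.R\<^esub> \<or> y = a"
      using x by (auto simp: D.bottom_R subset_singleton_iff)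
  qed
qed

lemma atoms_P: "atoms D.R = (\<lambda>x. k {x}) ` T"
  by (auto simp: atoms_def atom_P)

lemma space_extension_morphism: "devries_morphism R D.R (emb space_extension)"
proof (rule devries_morphismI)
  show "emb space_extension \<in> carrier R \<rightarrow>\<^sub>E carrier D.R"
    by (auto simp: space_extension_def carrier_R carrier_P intro!: imageI dest: regular_opens_subset)
  show "emb space_extension \<bottom>\<^bsub>R\<^esub> = \<bottom>\<^bsub>D.R\<^esub>"
    by (simp add: bottom_R D.bottom_R empty_regular_opens)
next
  fix a b assume "a \<in> carrier R" "b \<in> carrier R"
  then obtain V W where V: "V \<in> regular_opens X" "W \<in> regular_opens X" "a = k V" "b = k W"
    by (auto simp: carrier_R)
  have "k V \<sqinter>\<^bsub>D.R\<^esub> k W = k (V \<inter> W)"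
    using V regular_opens_subset by (intro D.meet_R) auto
  then show "emb space_extension (a \<sqinter>\<^bsub>R\<^esub> b) = emb space_extension a \<sqinter>\<^bsub>D.R\<^esub> emb space_extension b"
    using V by (simp add: meet_R Int_regular_opens)
  assume "a \<prec>\<^bsub>R\<^esub> b"
  then have "X closure_of V \<subseteq> W"
    using V by (simp add: prec_iff)
  moreover have "T - (T - X closure_of V) = X closure_of V"
    using closure_of_subset_topspace[of X V] by auto
  ultimately show "(\<sim>\<^bsub>D.R\<^esub> emb space_extension (\<sim>\<^bsub>R\<^esub> a)) \<prec>\<^bsub>D.R\<^esub> emb space_extension b"
    using V closure_of_subset_topspace[of X V] regular_opens_subset[OF V(2)]
    by (simp add: complement_R Diff_closure_regular_opens complement_P prec_P_iff)
next
  fix b assume "b \<in> carrier R"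
  then obtain W where W: "W \<in> regular_opens X" "b = k W"
    by (auto simp: carrier_R)
  let ?\<S> = "{V \<in> regular_opens X. (X closure_of V) \<subseteq> W}"
  have "emb space_extension ` prec_below R b = k ` ?\<S>"
    unfolding W(2) prec_below_R[OF W(1)] image_image by (intro image_cong) auto
  moreover have "\<Squnion>\<^bsub>D.R\<^esub>(k ` ?\<S>) = k W"
    using sup_P[of ?\<S>] regular_opens_subset by (auto simp: Union_well_inside[OF W(1)])
  ultimately show "emb space_extension b = \<Squnion>\<^bsub>D.R\<^esub>(emb space_extension ` prec_below R b)"
    using W by simp
qed

text \<open>This makes every subset of \<open>T\<close> a union of intersections of regular open sets.\<close>

lemma singleton_eq_Inter:
  assumes "x \<in> T"
  shows "T \<inter> \<Inter>{V \<in> regular_opens X. x \<in> V} = {x}"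
proof -
  have "y \<notin> \<Inter>{V \<in> regular_opens X. x \<in> V}" if "y \<in> T" "y \<noteq> x" for y
  proof -
    have "closedin X {y}"
      using that by (intro closedin_Hausdorff_singleton[OF Hausdorff])
    then have "openin X (T - {y})"
      by blast
    moreover have "x \<in> T - {y}"
      using that assms by auto
    ultimately obtain V where "V \<in> regular_opens X" "x \<in> V" "X closure_of V \<subseteq> T - {y}"
      by (rule regular_opens_base)
    then show ?thesis
      using closure_of_subset[OF regular_opens_subset[of V X]] by auto
  qed
  then show ?thesis
    using assms by auto
qed

lemma devries_extension_space: "devries_extension space_extension"
  unfolding devries_extension_def space_extension_simps
proof (intro conjI ballI)
  show "inj_on (emb space_extension) (carrier R)"
    by (auto simp: space_extension_def inj_on_def)
  show "atomic_lattice D.R"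
    unfolding atomic_lattice_def
  proof (intro ballI impI)
    fix b assume "b \<in> carrier D.R" "b \<noteq> \<bottom>\<^bsub>D.R\<^esub>"
    then obtain V where V: "V \<subseteq> T" "b = k V" "V \<noteq> {}"
      by (auto simp: carrier_P D.bottom_R)
    then obtain x where "x \<in> V" "x \<in> T"
      by auto
    then show "\<exists>x. lattice_atom D.R x \<and> x \<sqsubseteq>\<^bsub>D.R\<^esub> b"
      using V by (intro exI[of _ "k {x}"]) (auto simp: atom_P le_P_iff)
  qed
  show "extremally_disconnected D.R"
    by (auto simp: extremally_disconnected_def carrier_P le_P_iff prec_P_iff)
  fix b assume "b \<in> carrier D.R"
  then obtain S where S: "S \<subseteq> T" "b = k S"
    by (auto simp: carrier_P)
  define N where "N x = {V \<in> regular_opens X. x \<in> V}" for x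
  have "(\<lambda>U. \<Sqinter>\<^bsub>D.R\<^esub>U) ` ((\<lambda>x. k ` N x) ` S) = k ` (\<lambda>x. {x}) ` S"
    unfolding image_image
  proof (rule image_cong)
    fix x assume "x \<in> S"
    then have "T \<inter> \<Inter>(N x) = {x}"
      using S singleton_eq_Inter[of x] by (auto simp: N_def)
    moreover have "N x \<subseteq> Pow T"
      by (auto simp: N_def dest: regular_opens_subset)
    ultimately show "\<Sqinter>\<^bsub>D.R\<^esub>(k ` N x) = k {x}"
      by (simp add: inf_P)
  qed simp
  moreover have "\<Squnion>\<^bsub>D.R\<^esub>(k ` (\<lambda>x. {x}) ` S) = k S"
    using S by (subst sup_P) auto
  moreover have "k ` N x \<subseteq> emb space_extension ` carrier R" for x
    by (auto simp: N_def carrier_R image_iff intro!: bexI)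
  ultimately show "\<exists>\<S>. (\<forall>U \<in> \<S>. U \<subseteq> emb space_extension ` carrier R) \<and> b = \<Squnion>\<^bsub>D.R\<^esub>((\<lambda>S. \<Sqinter>\<^bsub>D.R\<^esub>S) ` \<S>)"
    using S by (intro exI[of _ "(\<lambda>x. k ` N x) ` S"]) auto
qed (fact devries_algebra_R D.devries_algebra_R space_extension_morphism)+

text \<open>Let \<open>\<F>\<close> and \<open>\<I>\<close> be the decoded filter and ideal. As \<open>\<F>\<close> is round, its intersection is the
  intersection of the closures of its members. So the sets \<open>(T - X closure_of V) \<union> W\<close> with \<open>V \<in> \<F>\<close> and
  \<open>W \<in> \<I>\<close> form an open cover. For a finite subcover, a lower bound in \<open>\<F>\<close> of all \<open>V\<close> that occur is
  contained in an upper bound in \<open>\<I>\<close> of all \<open>W\<close> that occur, which therefore lies in \<open>\<F>\<close> as well.\<close>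

lemma compact_extension_space: "compact_extension space_extension"
  unfolding compact_extension_def space_extension_simps
proof (intro allI impI)
  fix F I
  assume *: "round_filter R F \<and> round_ideal R I \<and>
    \<Sqinter>\<^bsub>D.R\<^esub>(emb space_extension ` F) \<sqsubseteq>\<^bsub>D.R\<^esub> \<Squnion>\<^bsub>D.R\<^esub>(emb space_extension ` I)"
  then have F: "lattice_filter R F" and I: "lattice_ideal R I"
    by (auto simp: round_filter_def round_ideal_def)
  obtain \<F> where \<F>: "\<F> \<subseteq> regular_opens X" "F = k ` \<F>"
    using F subset_carrierE by (auto simp: lattice_filter_def)
  obtain \<I> where \<I>: "\<I> \<subseteq> regular_opens X" "I = k ` \<I>"
    using I subset_carrierE by (auto simp: lattice_ideal_def)
  have sub: "\<F> \<subseteq> Pow T" "\<I> \<subseteq> Pow T"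
    using \<F>(1) \<I>(1) by (blast dest: regular_opens_subset)+
  have "emb space_extension ` F = k ` \<F>" "emb space_extension ` I = k ` \<I>"
    using \<F> \<I> by (auto simp: image_image subset_iff)
  then have "k (T \<inter> \<Inter>\<F>) \<sqsubseteq>\<^bsub>D.R\<^esub> k (\<Union>\<I>)"
    using * by (simp add: sup_P[OF sub(2)] inf_P[OF sub(1)])
  moreover have "\<Union>\<I> \<subseteq> T"
    using sub(2) by auto
  ultimately have FI: "T \<inter> \<Inter>\<F> \<subseteq> \<Union>\<I>"
    by (simp add: le_P_iff)
  define \<C> where "\<C> = {(T - X closure_of V) \<union> W | V W. V \<in> \<F> \<and> W \<in> \<I>}"
  have "openin X C" if "C \<in> \<C>" for C
    using that \<I>(1) by (auto simp: \<C>_def intro!: openin_Un openin_diff intro: regular_opens_openin)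
  moreover have "T \<subseteq> \<Union>\<C>"
  proof
    fix x assume x: "x \<in> T"
    obtain V\<^sub>0 W\<^sub>0 where V\<^sub>0: "V\<^sub>0 \<in> \<F>" "W\<^sub>0 \<in> \<I>"
      using F I \<F> \<I> by (auto simp: lattice_filter_def lattice_ideal_def)
    show "x \<in> \<Union>\<C>"
    proof (cases "\<exists>V \<in> \<F>. x \<notin> X closure_of V")
      case True
      then show ?thesis
        using x V\<^sub>0 by (auto simp: \<C>_def)
    next
      case False
      have "x \<in> V" if "V \<in> \<F>" for V
      proof -
        have "\<exists>a \<in> F. a \<prec>\<^bsub>R\<^esub> k V"
          using * \<F>(2) that unfolding round_filter_def by blast
        then obtain V' where "V' \<in> \<F>" "k V' \<prec>\<^bsub>R\<^esub> k V"
          unfolding \<F>(2) by auto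
        then show ?thesis
          using False \<F>(1) that by (auto simp: prec_iff subset_iff)
      qed
      then obtain W where "W \<in> \<I>" "x \<in> W"
        using FI x by auto
      then show ?thesis
        using V\<^sub>0 by (auto simp: \<C>_def)
    qed
  qed
  ultimately obtain \<D> where \<D>: "finite \<D>" "\<D> \<subseteq> \<C>" "T \<subseteq> \<Union>\<D>"
    using compact unfolding compact_space_alt by metis
  have "\<forall>C \<in> \<D>. \<exists>p. fst p \<in> \<F> \<and> snd p \<in> \<I> \<and> C = (T - X closure_of fst p) \<union> snd p"
    using \<D>(2) by (fastforce simp: \<C>_def)
  then obtain p where p: "\<And>C. C \<in> \<D> \<Longrightarrow> fst (p C) \<in> \<F> \<and> snd (p C) \<in> \<I> \<and>
      C = (T - X closure_of fst (p C)) \<union> snd (p C)"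
    by metis
  have "\<exists>a \<in> F. \<forall>s \<in> (\<lambda>C. k (fst (p C))) ` \<D>. a \<sqsubseteq>\<^bsub>R\<^esub> s"
    using \<D>(1) p \<F>(2) by (intro cba.filter_finite_lower_bound[OF F]) auto
  then obtain V where V: "V \<in> \<F>" "\<And>C. C \<in> \<D> \<Longrightarrow> k V \<sqsubseteq>\<^bsub>R\<^esub> k (fst (p C))"
    using \<F>(2) by auto
  have "\<exists>b \<in> I. \<forall>s \<in> (\<lambda>C. k (snd (p C))) ` \<D>. s \<sqsubseteq>\<^bsub>R\<^esub> b"
    using \<D>(1) p \<I>(2) by (intro cba.ideal_finite_upper_bound[OF I]) auto
  then obtain W where W: "W \<in> \<I>" "\<And>C. C \<in> \<D> \<Longrightarrow> k (snd (p C)) \<sqsubseteq>\<^bsub>R\<^esub> k W"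
    using \<I>(2) by auto
  have "V \<subseteq> W"
  proof
    fix x assume x: "x \<in> V"
    then have "x \<in> T"
      using V(1) sub by auto
    then obtain C where C: "C \<in> \<D>" "x \<in> C"
      using \<D>(3) by auto
    have fp: "fst (p C) \<in> regular_opens X" "snd (p C) \<in> regular_opens X" "V \<in> regular_opens X" "W \<in> regular_opens X"
      using p[OF C(1)] \<F>(1) \<I>(1) V(1) W(1) by auto
    then have "V \<subseteq> fst (p C)" "snd (p C) \<subseteq> W"
      using V(2)[OF C(1)] W(2)[OF C(1)] by (simp_all add: le_iff)
    moreover have "x \<in> (T - X closure_of fst (p C)) \<union> snd (p C)"
      using p[OF C(1)] C(2) by blast
    ultimately show "x \<in> W"
      using x closure_of_subset[OF regular_opens_subset[OF fp(1)]] by auto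
  qed
  then have "k V \<sqsubseteq>\<^bsub>R\<^esub> k W" "k W \<in> carrier R"
    using V(1) W(1) \<F>(1) \<I>(1) by (auto simp: le_iff subset_iff)
  then have "k W \<in> F"
    using F V(1) \<F>(2) unfolding lattice_filter_def by blast
  then show "F \<inter> I \<noteq> {}"
    using W(1) \<I>(2) by auto
qed

sublocale E: compact_devries_extension space_extension
  by unfold_locales (fact devries_extension_space compact_extension_space)+

lemma topspace_dual: "topspace (atom_space space_extension) = (\<lambda>x. k {x}) ` T"
  by (simp add: E.topspace_atom_space atoms_P)

lemma basic_open_space:
  assumes "V \<in> regular_opens X"
  shows "basic_open space_extension (k V) = (\<lambda>x. k {x}) ` V"
  using assms regular_opens_subset[OF assms]
  by (auto simp: basic_open_def atoms_below_def atoms_P le_P_iff subset_iff)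

lemma k_singleton_eq_iff: "\<lbrakk>x \<in> T; y \<in> T\<rbrakk> \<Longrightarrow> k {x} = k {y} \<longleftrightarrow> x = y"
  by (simp add: k_eq_P_iff)

lemma continuous_point_atom: "continuous_map X (atom_space space_extension) (\<lambda>x. k {x})"
  unfolding continuous_map_def topspace_dual
proof (intro conjI allI impI)
  fix W assume W: "openin (atom_space space_extension) W"
  show "openin X {x \<in> T. k {x} \<in> W}"
  proof (subst openin_subopen, safe)
    fix x assume x: "x \<in> T" "k {x} \<in> W"
    then obtain a where "a \<in> carrier R" "k {x} \<in> basic_open space_extension a"
        "basic_open space_extension a \<subseteq> W"
      using E.openin_atom_spaceE[OF W x(2)] by auto
    then obtain V where V: "V \<in> regular_opens X" "k {x} \<in> (\<lambda>x. k {x}) ` V" "(\<lambda>x. k {x}) ` V \<subseteq> W"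
      by (auto simp: carrier_R basic_open_space)
    then have "x \<in> V"
      using x regular_opens_subset[OF V(1)] by (auto simp: k_singleton_eq_iff subset_iff)
    then show "\<exists>V. openin X V \<and> x \<in> V \<and> V \<subseteq> {x \<in> T. k {x} \<in> W}"
      using V regular_opens_openin[OF V(1)] regular_opens_subset[OF V(1)] by blast
  qed
qed auto

lemma continuous_the_point:
  "continuous_map (atom_space space_extension) X (the_inv_into T (\<lambda>x. k {x}))"
proof -
  have inj: "inj_on (\<lambda>x. k {x}) T"
    by (auto simp: inj_on_def k_singleton_eq_iff)
  note inv = the_inv_into_f_f[OF inj]
  show ?thesis
    unfolding continuous_map_def topspace_dual
  proof (intro conjI allI impI)
    show "the_inv_into T (\<lambda>x. k {x}) \<in> (\<lambda>x. k {x}) ` T \<rightarrow> T"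
      by (auto simp: inv)
    fix G assume G: "openin X G"
    have "{y \<in> (\<lambda>x. k {x}) ` T. the_inv_into T (\<lambda>x. k {x}) y \<in> G} = (\<lambda>x. k {x}) ` G"
      using openin_subset[OF G] by (auto simp: inv)
    moreover have "openin (atom_space space_extension) ((\<lambda>x. k {x}) ` G)"
    proof (subst openin_subopen, safe)
      fix x assume "x \<in> G"
      then obtain V where V: "V \<in> regular_opens X" "x \<in> V" "X closure_of V \<subseteq> G"
        using regular_opens_base[OF G] by auto
      then have "V \<subseteq> G"
        using closure_of_subset[OF regular_opens_subset[OF V(1)]] by auto
      moreover have "openin (atom_space space_extension) ((\<lambda>x. k {x}) ` V)"
        using E.openin_U[of "k V"] V(1) by (simp add: basic_open_space)
      ultimately show "\<exists>W. openin (atom_space space_extension) W \<and> k {x} \<in> W \<and> W \<subseteq> (\<lambda>x. k {x}) ` G"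
        using V(2) by blast
    qed
    ultimately show "openin (atom_space space_extension)
        {y \<in> (\<lambda>x. k {x}) ` T. the_inv_into T (\<lambda>x. k {x}) y \<in> G}"
      by simp
  qed
qed

lemma homeomorphic_dual: "atom_space space_extension homeomorphic_space X"
  unfolding homeomorphic_space_def homeomorphic_maps_def
proof (intro exI conjI)
  have inj: "inj_on (\<lambda>x. k {x}) T"
    by (auto simp: inj_on_def k_singleton_eq_iff)
  show "\<forall>y \<in> topspace (atom_space space_extension). k {the_inv_into T (\<lambda>x. k {x}) y} = y"
    by (auto simp: topspace_dual the_inv_into_f_f[OF inj])
  show "\<forall>x \<in> T. the_inv_into T (\<lambda>x. k {x}) (k {x}) = x"
    by (auto simp: the_inv_into_f_f[OF inj])
qed (fact continuous_point_atom continuous_the_point)+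

end

section \<open>The duality\<close>

lemma isomorphism_KHausI:
  assumes "X homeomorphic_space Y"
  shows "\<exists>e. isomorphism KHaus X Y e"
proof -
  obtain f g where fg: "homeomorphic_maps X Y f g"
    using assms by (auto simp: homeomorphic_space_def)
  let ?f = "restrict f (topspace X)" and ?g = "restrict g (topspace Y)"
  have f: "f \<in> topspace X \<rightarrow> topspace Y" and g: "g \<in> topspace Y \<rightarrow> topspace X"
    using fg by (auto simp: homeomorphic_maps_def continuous_map_def)
  have "continuous_map X Y ?f" "continuous_map Y X ?g"
    using fg by (auto simp: homeomorphic_maps_def intro: continuous_map_eq)
  moreover have "compose (topspace X) ?g ?f = restrict id (topspace X)"
    "compose (topspace Y) ?f ?g = restrict id (topspace Y)"
    using fg f g by (auto simp: homeomorphic_maps_def compose_def fun_eq_iff restrict_def)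
  ultimately show ?thesis
    unfolding isomorphism_def KHaus_def by (intro exI[of _ ?f]) auto
qed

text \<open>A morphism from \<open>E'\<close> to \<open>E\<close> in the opposite category is a morphism \<open>(\<rho>, \<sigma>)\<close> from \<open>E\<close> to \<open>E'\<close>.\<close>

definition dual_map :: "('a, 'b) extension \<Rightarrow> ('c, 'd) extension \<Rightarrow> ('c \<Rightarrow> 'a) \<times> ('d \<Rightarrow> 'b) \<Rightarrow> 'b \<Rightarrow> 'd" where
  "dual_map E' E f = atom_map (tgt E) (tgt E') (snd f)"

lemma Ob_CDeVe: "E \<in> Ob CDeVe \<longleftrightarrow> compact_devries_extension E"
  by (simp add: CDeVe_def full_subcategory_def Ob_DeVe compact_devries_extension_def extension_def
      compact_devries_extension_axioms_def)

lemma Hom_CDeVe: "(\<rho>, \<sigma>) \<in> Hom CDeVe E E' \<longleftrightarrow> extension_morphism E E' \<rho> \<sigma>"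
  by (simp add: CDeVe_def full_subcategory_def Hom_DeVe)

lemma atom_space_KHaus:
  assumes "compact_devries_extension E"
  shows "atom_space E \<in> Ob KHaus"
proof -
  interpret compact_devries_extension E by fact
  show ?thesis
    using compact_atom_space Hausdorff_atom_space small_atoms
    by (simp add: KHaus_def small_def topspace_atom_space)
qed

lemma cat_functor_dual:
  "cat_functor (opposite (CDeVe :: (('a, 'b) extension, ('a \<Rightarrow> 'a) \<times> ('b \<Rightarrow> 'b)) category))
    KHaus atom_space dual_map"
proof -
  have CD: "category (CDeVe :: (('a, 'b) extension, ('a \<Rightarrow> 'a) \<times> ('b \<Rightarrow> 'b)) category)"
    unfolding CDeVe_def by (intro category_full_subcategory category_DeVe)
  interpret source: category "opposite (CDeVe :: (('a, 'b) extension, ('a \<Rightarrow> 'a) \<times> ('b \<Rightarrow> 'b)) category)"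
    by (rule category_opposite[OF CD])
  interpret target: category "KHaus :: ('b topology, 'b \<Rightarrow> 'b) category"
    by (rule category_KHaus)
  show ?thesis
  proof unfold_locales
    fix E :: "('a, 'b) extension"
    assume "E \<in> Ob (opposite CDeVe)"
    then interpret compact_devries_extension E
      by (simp add: opposite_def Ob_CDeVe)
    interpret atomic_pair B B ..
    show "atom_space E \<in> Ob KHaus"
      by (rule atom_space_KHaus) unfold_locales
    have "atom_map B B (restrict id (carrier B)) = restrict id X"
      using emb.B.atoms_carrier
      by (intro atom_map_eqI complete_boolean_hom_id emb.B.complete_boolean_algebra_axioms)
        (auto simp: atoms_below_def emb.B.atom_le_atom_iff subset_iff)
    then show "dual_map E E (Id (opposite CDeVe) E) = Id KHaus (atom_space E)"
      by (simp add: dual_map_def opposite_def CDeVe_def full_subcategory_def Id_DeVe KHaus_def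
          topspace_atom_space)
  next
    fix E' E :: "('a, 'b) extension" and h
    assume *: "E' \<in> Ob (opposite CDeVe)" "E \<in> Ob (opposite CDeVe)" "h \<in> Hom (opposite CDeVe) E' E"
    obtain \<rho> \<sigma> where h: "h = (\<rho>, \<sigma>)"
      by fastforce
    interpret E': compact_devries_extension E' using * by (simp add: opposite_def Ob_CDeVe)
    interpret E: compact_devries_extension E using * by (simp add: opposite_def Ob_CDeVe)
    interpret extension_pair E E' ..
    have "extension_morphism E E' \<rho> \<sigma>"
      using * h by (simp add: opposite_def Hom_CDeVe)
    then show "dual_map E' E h \<in> Hom KHaus (atom_space E') (atom_space E)"
      using continuous_atom_map atom_map_extensional
      by (simp add: dual_map_def KHaus_def h E'.topspace_atom_space)
  next
    fix E\<^sub>3 E\<^sub>2 E\<^sub>1 :: "('a, 'b) extension" and f g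
    assume *: "E\<^sub>3 \<in> Ob (opposite CDeVe)" "E\<^sub>2 \<in> Ob (opposite CDeVe)" "E\<^sub>1 \<in> Ob (opposite CDeVe)"
      "f \<in> Hom (opposite CDeVe) E\<^sub>3 E\<^sub>2" "g \<in> Hom (opposite CDeVe) E\<^sub>2 E\<^sub>1"
    obtain \<rho>\<^sub>1 \<sigma>\<^sub>1 \<rho>\<^sub>2 \<sigma>\<^sub>2 where fg: "g = (\<rho>\<^sub>1, \<sigma>\<^sub>1)" "f = (\<rho>\<^sub>2, \<sigma>\<^sub>2)"
      by (metis surj_pair)
    interpret E1: compact_devries_extension E\<^sub>1 using * by (simp add: opposite_def Ob_CDeVe)
    interpret E2: compact_devries_extension E\<^sub>2 using * by (simp add: opposite_def Ob_CDeVe)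
    interpret E3: compact_devries_extension E\<^sub>3 using * by (simp add: opposite_def Ob_CDeVe)
    interpret p12: atomic_pair E1.B E2.B ..
    interpret p23: atomic_pair E2.B E3.B ..
    interpret p13: atomic_pair E1.B E3.B ..
    have \<sigma>\<^sub>1: "complete_boolean_hom E1.B E2.B \<sigma>\<^sub>1" and \<sigma>\<^sub>2: "complete_boolean_hom E2.B E3.B \<sigma>\<^sub>2"
      using * fg by (auto simp: opposite_def Hom_CDeVe extension_morphism_def)
    let ?f1 = "atom_map E1.B E2.B \<sigma>\<^sub>1" and ?f2 = "atom_map E2.B E3.B \<sigma>\<^sub>2"
    have "atom_map E1.B E3.B (compose (carrier E1.B) \<sigma>\<^sub>2 \<sigma>\<^sub>1) = compose E3.X ?f1 ?f2"
    proof (rule p13.atom_map_eqI)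
      show "complete_boolean_hom E1.B E3.B (compose (carrier E1.B) \<sigma>\<^sub>2 \<sigma>\<^sub>1)"
        by (rule complete_boolean_hom_compose[OF E1.emb.B.complete_boolean_algebra_axioms \<sigma>\<^sub>1 \<sigma>\<^sub>2])
      show "compose E3.X ?f1 ?f2 \<in> E3.X \<rightarrow>\<^sub>E E1.X"
        using p12.atom_map_props(1)[OF \<sigma>\<^sub>1] p23.atom_map_props(1)[OF \<sigma>\<^sub>2] by (auto simp: compose_def)
      fix y assume y: "y \<in> E1.X"
      then have y': "y \<in> carrier E1.B"
        using E1.emb.B.atoms_carrier by auto
      then have \<sigma>y: "\<sigma>\<^sub>1 y \<in> carrier E2.B"
        using complete_boolean_homE(1)[OF \<sigma>\<^sub>1] by auto
      show "atoms_below E3.B (compose (carrier E1.B) \<sigma>\<^sub>2 \<sigma>\<^sub>1 y) = {x \<in> E3.X. compose E3.X ?f1 ?f2 x = y}"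
        using y y' p12.atom_map_props(1)[OF \<sigma>\<^sub>1] p23.atom_map_props(1)[OF \<sigma>\<^sub>2]
        by (auto simp: compose_eq p23.atoms_below_hom[OF \<sigma>\<^sub>2 \<sigma>y] p12.atoms_below_hom[OF \<sigma>\<^sub>1 y'])
          (auto simp: atoms_below_def E1.emb.B.atom_le_atom_iff)
    qed
    then show "dual_map E\<^sub>3 E\<^sub>1 (Comp (opposite CDeVe) E\<^sub>3 E\<^sub>2 E\<^sub>1 g f) =
        Comp KHaus (atom_space E\<^sub>3) (atom_space E\<^sub>2) (atom_space E\<^sub>1) (dual_map E\<^sub>2 E\<^sub>1 g) (dual_map E\<^sub>3 E\<^sub>2 f)"
      by (simp add: dual_map_def opposite_def CDeVe_def full_subcategory_def fg Comp_DeVe KHaus_def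
          E3.topspace_atom_space)
  qed
qed

theorem theorem5p5:
  shows "dually_equivalent (CDeVe :: (('u, 'u) extension, ('u \<Rightarrow> 'u) \<times> ('u \<Rightarrow> 'u)) category)
           (KHaus :: ('u topology, 'u \<Rightarrow> 'u) category)"
  unfolding dually_equivalent_def
proof (rule equivalent_categories_if_fully_faithful_surjective[OF cat_functor_dual])
  fix E' E :: "('u, 'u) extension"
  assume "E' \<in> Ob (opposite CDeVe)" "E \<in> Ob (opposite CDeVe)"
  then interpret E': compact_devries_extension E' + E: compact_devries_extension E
    by (simp_all add: opposite_def Ob_CDeVe)
  interpret extension_pair E E' ..
  have hom: "Hom (opposite CDeVe) E' E = {(\<rho>, \<sigma>). extension_morphism E E' \<rho> \<sigma>}"
    using Hom_CDeVe[of _ _ E E'] by (auto simp: opposite_def)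
  show "inj_on (dual_map E' E) (Hom (opposite CDeVe) E' E)"
    unfolding hom using atom_map_faithful by (auto simp: inj_on_def dual_map_def)
  show "Hom KHaus (atom_space E') (atom_space E) \<subseteq> dual_map E' E ` Hom (opposite CDeVe) E' E"
  proof
    fix f assume f: "f \<in> Hom KHaus (atom_space E') (atom_space E)"
    interpret extension_map E E' f
      using f by unfold_locales (simp add: KHaus_def)
    have "f \<in> E'.X \<rightarrow>\<^sub>E E.X"
      using f f_closed by (auto simp: KHaus_def E'.topspace_atom_space PiE_iff)
    then have "dual_map E' E (dual_morphism, hom_of_map f) = f"
      by (simp add: dual_map_def atom_map_hom_of_map)
    moreover have "(dual_morphism, hom_of_map f) \<in> Hom (opposite CDeVe) E' E"
      by (simp add: hom extension_morphism_dual)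
    ultimately show "f \<in> dual_map E' E ` Hom (opposite CDeVe) E' E"
      by (metis imageI)
  qed
next
  fix X :: "'u topology"
  assume X: "X \<in> Ob KHaus"
  then obtain k :: "'u set \<Rightarrow> 'u" where "inj_on k (Pow (topspace X))"
    by (auto simp: KHaus_def small_def lepoll_def)
  then interpret compact_encoded_space X k
    using X by unfold_locales (auto simp: KHaus_def intro: compact_Hausdorff_or_regular_imp_normal_space)
  have "space_extension \<in> Ob (opposite CDeVe)"
    using E.compact_devries_extension_axioms by (simp add: opposite_def Ob_CDeVe)
  then show "\<exists>E \<in> Ob (opposite (CDeVe :: (('u, 'u) extension, ('u \<Rightarrow> 'u) \<times> ('u \<Rightarrow> 'u)) category)).
      \<exists>e. isomorphism KHaus (atom_space E) X e"
    using isomorphism_KHausI[OF homeomorphic_dual] by (rule bexI[rotated])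
qed

end
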